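(* Let $\mathbb{K}$ be a field and let $G=(\mathcal{V},\mathcal{E})$ be a graph whose simplification $\widetilde G$ has a nexus or a fat nexus. Then the class of the projective graph hypersurface $X_G\subseteq\mathbb{P}\mathbb{K}^{\mathcal{E}}$ in the Grothendieck ring $\mathrm{K}_0(\mathrm{Var}_{\mathbb{K}})$ satisfies \[ [X_G]\equiv|\mathcal{E}|\mod\mathbb{T}. \] Equivalently, the class of its complement $Y_G=\mathbb{P}\mathbb{K}^{\mathcal{E}}\setminus X_G$ satisfies \[ [Y_G]\equiv 0\mod\mathbb{T}. \]
   Context: Graphs are finite and undirected; loops (edges connecting a vertex to itself) and multiple edges are allowed. Standing convention: $G$ has at least one edge which is not a loop. Grothendieck ring: $\mathrm{K}_0(\mathrm{Var}_{\mathbb{K}})$ is the Grothendieck ring of varieties over $\mathbb{K}$, $[-]$ denotes classes in it, $\mathbb{T}:=[\mathbb{G}_m]$ is the class of the $1$-torus $\mathbb{G}_m=\mathrm{Spec}\,\mathbb{K}[t^{\pm1}]$, and "$\mathrm{mod}\ \mathbb{T}$" means modulo the ideal generated by $\mathbb{T}$. Graph hypersurface: let $x=(x_e)_{e\in\mathcal{E}}$ be the coordinates on $\mathbb{K}^{\mathcal{E}}$. The Kirchhoff polynomial of $G$ is $\psi_G=\sum_T\prod_{e\in T}x_e$, where $T$ runs over the (edge sets of) spanning forests of $G$, that is, the bases of the graphic matroid of $G$ (spanning trees if $G$ is connected). $X_G=V(\psi_G)\subseteq\mathbb{P}\mathbb{K}^{\mathcal{E}}$ is the hypersurface it defines. Simplification: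 $\widetilde G$ is obtained from $G$ by merging all multiple edges, deleting all loops, and then deleting all isolated vertices. Nexus: a vertex $v$ of a graph $G$ whose deletion results in a disconnected graph $G-v$. Fat nexus: let $v_0\in\mathcal{V}$ be a vertex of a graph $G=(\mathcal{V},\mathcal{E})$ with neighborhood $\mathcal{V}_0:=\{v_0\}\cup\{v\in\mathcal{V}\mid\{v,v_0\}\in\mathcal{E}\}$. $G$ is called a cone with apex $v_0$ if $\mathcal{V}_0=\mathcal{V}$. For $\mathcal{U}\subseteq\mathcal{V}$ set $\mathcal{U}^0:=\mathcal{U}\setminus\mathcal{V}_0$. Then $v_0$ is a fat nexus in $G$ if there is a partition $\mathcal{V}=\{v_0\}\sqcup\mathcal{V}_1\sqcup\mathcal{V}_2$ such that: (a) $\mathcal{V}_1\neq\emptyset$ and $\mathcal{V}_2\ne\emptyset$; (b) all edges between $\mathcal{V}_1$ and $\mathcal{V}_2$ have both vertices in $\mathcal{V}_0$, in other words, there are no edges between $\mathcal{V}_i^0$ and $\mathcal{V}_j$ for $\{i,j\}=\{1,2\}$; (c) if $G$ is a cone with apex $v_0$, then $|\mathcal{V}_1|\neq|\mathcal{V}_2|$. *)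

theory Defs
  imports
    "HOL-Analysis.Abstract_Topology"
    "HOL-Library.Poly_Mapping"
    "HOL-Algebra.QuotRing"
    "HOL-Algebra.Algebraic_Closure_Type"
begin

text \<open>Allows \<open>X\<close> to be used as a variable.\<close>

no_notation Polynomials.var (\<open>X\<index>\<close>)

section \<open>Multigraphs\<close>

text \<open>An edge \<open>e\<close> has the set \<open>ends G e\<close> of endpoints, which is a singleton if \<open>e\<close> is a loop.
  Multiple edges are edges with the same set of endpoints.\<close>

record ('v, 'e) mgraph =
  verts :: "'v set"
  edges :: "'e set"
  ends :: "'e \<Rightarrow> 'v set"

definition is_graph :: "('v, 'e) mgraph \<Rightarrow> bool" where
  "is_graph G \<longleftrightarrow> finite (verts G) \<and> finite (edges G) \<and>
     (\<forall>e\<in>edges G. ends G e \<subseteq> verts G \<and> (card (ends G e) = 1 \<or> card (ends G e) = 2))"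

definition is_loop :: "('v, 'e) mgraph \<Rightarrow> 'e \<Rightarrow> bool" where
  "is_loop G e \<longleftrightarrow> card (ends G e) = 1"

text \<open>The \<open>k\<close>-th edge of a cycle joins the \<open>k\<close>-th vertex to the cyclically next one. Loops are the
  cycles of length 1, pairs of parallel edges are cycles of length 2.\<close>

definition is_cycle :: "('v, 'e) mgraph \<Rightarrow> 'v list \<Rightarrow> 'e list \<Rightarrow> bool" where
  "is_cycle G vs es \<longleftrightarrow> es \<noteq> [] \<and> length vs = length es \<and> distinct vs \<and> distinct es \<and>
     set es \<subseteq> edges G \<and>
     (\<forall>k<length es. ends G (es ! k) = {vs ! k, vs ! (Suc k mod length es)})"

definition is_forest :: "('v, 'e) mgraph \<Rightarrow> 'e set \<Rightarrow> bool" where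
  "is_forest G T \<longleftrightarrow> T \<subseteq> edges G \<and> \<not> (\<exists>vs es. is_cycle G vs es \<and> set es \<subseteq> T)"

text \<open>The bases of the graphic matroid, whose independent sets are the forests.\<close>

definition spanning_forests :: "('v, 'e) mgraph \<Rightarrow> 'e set set" where
  "spanning_forests G = {T. is_forest G T \<and> (\<forall>T'. is_forest G T' \<and> T \<subseteq> T' \<longrightarrow> T' = T)}"

text \<open>The edges of the simplification are the two-element sets of endpoints of edges of \<open>G\<close>. The
  vertices which are still incident to an edge after the deletion of loops are kept.\<close>

definition simplification :: "('v, 'e) mgraph \<Rightarrow> ('v, 'v set) mgraph" where
  "simplification G =
     (let E = {ends G e | e. e \<in> edges G \<and> \<not> is_loop G e}
      in \<lparr>verts = \<Union>E, edges = E, ends = (\<lambda>d. d)\<rparr>)"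

definition delete_vertex :: "('v, 'e) mgraph \<Rightarrow> 'v \<Rightarrow> ('v, 'e) mgraph" where
  "delete_vertex G v = G\<lparr>verts := verts G - {v}, edges := {e \<in> edges G. v \<notin> ends G e}\<rparr>"

definition adjacency :: "('v, 'e) mgraph \<Rightarrow> ('v \<times> 'v) set" where
  "adjacency G = {(u, w). \<exists>e\<in>edges G. ends G e = {u, w}}"

definition disconnected :: "('v, 'e) mgraph \<Rightarrow> bool" where
  "disconnected G \<longleftrightarrow> (\<exists>u\<in>verts G. \<exists>w\<in>verts G. (u, w) \<notin> (adjacency G)\<^sup>*)"

definition is_nexus :: "('v, 'e) mgraph \<Rightarrow> 'v \<Rightarrow> bool" where
  "is_nexus G v \<longleftrightarrow> v \<in> verts G \<and> disconnected (delete_vertex G v)"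

definition neighborhood :: "('v, 'e) mgraph \<Rightarrow> 'v \<Rightarrow> 'v set" where
  "neighborhood G v\<^sub>0 = {v\<^sub>0} \<union> {v \<in> verts G. \<exists>e\<in>edges G. ends G e = {v, v\<^sub>0}}"

definition is_cone :: "('v, 'e) mgraph \<Rightarrow> 'v \<Rightarrow> bool" where
  "is_cone G v\<^sub>0 \<longleftrightarrow> neighborhood G v\<^sub>0 = verts G"

definition is_fat_nexus :: "('v, 'e) mgraph \<Rightarrow> 'v \<Rightarrow> bool" where
  "is_fat_nexus G v\<^sub>0 \<longleftrightarrow> v\<^sub>0 \<in> verts G \<and>
     (\<exists>V\<^sub>1 V\<^sub>2. verts G = {v\<^sub>0} \<union> V\<^sub>1 \<union> V\<^sub>2 \<and> v\<^sub>0 \<notin> V\<^sub>1 \<and> v\<^sub>0 \<notin> V\<^sub>2 \<and> V\<^sub>1 \<inter> V\<^sub>2 = {} \<and>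
        V\<^sub>1 \<noteq> {} \<and> V\<^sub>2 \<noteq> {} \<and>
        (\<forall>e\<in>edges G. \<forall>u\<in>V\<^sub>1. \<forall>w\<in>V\<^sub>2. ends G e = {u, w} \<longrightarrow>
           u \<in> neighborhood G v\<^sub>0 \<and> w \<in> neighborhood G v\<^sub>0) \<and>
        (is_cone G v\<^sub>0 \<longrightarrow> card V\<^sub>1 \<noteq> card V\<^sub>2))"


section \<open>Polynomials\<close>

text \<open>Polynomials over \<open>'k\<close> in commuting variables indexed by \<open>'i\<close>, as finitely supported
  functions on monomials.\<close>

type_synonym ('i, 'k) mpol = "('i \<Rightarrow>\<^sub>0 nat) \<Rightarrow>\<^sub>0 'k"

definition peval :: "('i, 'k::field) mpol \<Rightarrow> ('i \<Rightarrow> 'k alg_closure) \<Rightarrow> 'k alg_closure" where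
  "peval p x = (\<Sum>m\<in>Poly_Mapping.keys p. to_ac (Poly_Mapping.lookup p m) *
     (\<Prod>i\<in>Poly_Mapping.keys m. x i ^ Poly_Mapping.lookup m i))"

definition homogeneous :: "nat \<Rightarrow> ('i, 'k::zero) mpol \<Rightarrow> bool" where
  "homogeneous d p \<longleftrightarrow>
     (\<forall>m\<in>Poly_Mapping.keys p. (\<Sum>i\<in>Poly_Mapping.keys m. Poly_Mapping.lookup m i) = d)"

definition kirchhoff :: "('v, 'e) mgraph \<Rightarrow> ('e, 'k::field) mpol" where
  "kirchhoff G = (\<Sum>T\<in>spanning_forests G.
     \<Prod>e\<in>T. Poly_Mapping.single (Poly_Mapping.single e 1) 1)"


section \<open>Varieties\<close>

text \<open>
  A variety over a field \<open>K\<close> (a reduced separated scheme of finite type over \<open>K\<close>) is encoded as a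
  space with functions: the set of its points with values in an algebraic closure of \<open>K\<close>, the
  Zariski topology whose closed sets are those defined over \<open>K\<close>, and for each open set \<open>U\<close> the
  \<open>K\<close>-algebra of regular functions on \<open>U\<close>, considered as functions with values in the algebraic
  closure. By the Nullstellensatz, affine such spaces correspond to reduced finitely generated
  \<open>K\<close>-algebras, with no assumption on \<open>K\<close>. The topology is in general not \<open>T\<^sub>0\<close>: conjugate
  points over \<open>K\<close> lie in the same open sets, but they are separated by regular functions.

  \<open>regular X U f\<close> means that the restriction of \<open>f\<close> to \<open>U\<close> is a regular function. It is only
  meaningful for open \<open>U\<close>, and must not depend on the values of \<open>f\<close> outside of \<open>U\<close>.
\<close>

record (overloaded) ('p, 'k) fspace =
  top_of :: "'p topology"
  regular :: "'p set \<Rightarrow> ('p \<Rightarrow> 'k alg_closure) \<Rightarrow> bool"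

abbreviation points :: "('p, 'k::field) fspace \<Rightarrow> 'p set" where
  "points X \<equiv> topspace (top_of X)"

definition morphism ::
  "('p, 'k::field) fspace \<Rightarrow> ('q, 'k) fspace \<Rightarrow> ('p \<Rightarrow> 'q) \<Rightarrow> bool" where
  "morphism X Y \<phi> \<longleftrightarrow> continuous_map (top_of X) (top_of Y) \<phi> \<and>
     (\<forall>U f. openin (top_of Y) U \<and> regular Y U f \<longrightarrow>
        regular X {x \<in> points X. \<phi> x \<in> U} (f \<circ> \<phi>))"

definition isomorphic :: "('p, 'k::field) fspace \<Rightarrow> ('q, 'k) fspace \<Rightarrow> bool" where
  "isomorphic X Y \<longleftrightarrow> (\<exists>\<phi> \<psi>. morphism X Y \<phi> \<and> morphism Y X \<psi> \<and>
     (\<forall>x\<in>points X. \<psi> (\<phi> x) = x) \<and> (\<forall>y\<in>points Y. \<phi> (\<psi> y) = y))"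

text \<open>The structure induced on a subset \<open>A\<close>: a function is regular if it is locally the restriction
  of a regular function of \<open>X\<close>. For closed \<open>A\<close> this is the reduced closed subvariety.\<close>

definition subspace_of :: "('p, 'k::field) fspace \<Rightarrow> 'p set \<Rightarrow> ('p, 'k) fspace" where
  "subspace_of X A = \<lparr>top_of = subtopology (top_of X) A,
     regular = (\<lambda>U f. \<forall>x\<in>U. \<exists>W g. openin (top_of X) W \<and> x \<in> W \<and> regular X W g \<and>
                  (\<forall>y\<in>W \<inter> U. f y = g y))\<rparr>"

text \<open>Affine space with coordinates indexed by the (finite) set \<open>I\<close>. The vectors vanish outside of
  \<open>I\<close>, hence variables outside of \<open>I\<close> in polynomials are evaluated to 0.\<close>

definition affine_points :: "'i set \<Rightarrow> ('i \<Rightarrow> 'k::field alg_closure) set" where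
  "affine_points I = {x. \<forall>i. i \<notin> I \<longrightarrow> x i = 0}"

definition affine_top :: "'i set \<Rightarrow> 'k::field itself \<Rightarrow> ('i \<Rightarrow> 'k alg_closure) topology" where
  "affine_top I _ = topology_generated_by
     {{x \<in> affine_points I. peval p x \<noteq> 0} | p :: ('i, 'k) mpol. True}"

definition affine_space :: "'i set \<Rightarrow> ('i \<Rightarrow> 'k::field alg_closure, 'k) fspace" where
  "affine_space I = \<lparr>top_of = affine_top I TYPE('k),
     regular = (\<lambda>U f. \<forall>x\<in>U. \<exists>W (p :: ('i, 'k) mpol) q. openin (affine_top I TYPE('k)) W \<and> x \<in> W \<and>
                  (\<forall>y\<in>W \<inter> U. peval q y \<noteq> 0 \<and> f y = peval p y / peval q y))\<rparr>"

definition affine_zeros :: "'i set \<Rightarrow> ('i, 'k::field) mpol set \<Rightarrow> ('i \<Rightarrow> 'k alg_closure, 'k) fspace"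
  where "affine_zeros I S = subspace_of (affine_space I) {x. \<forall>p\<in>S. peval p x = 0}"

definition is_affine :: "('p, 'k::field) fspace \<Rightarrow> bool" where
  "is_affine X \<longleftrightarrow> (\<exists>(n::nat) S. isomorphic X (affine_zeros {..<n} S))"

definition is_function_sheaf :: "('p, 'k::field) fspace \<Rightarrow> bool" where
  "is_function_sheaf X \<longleftrightarrow>
     (\<forall>U f g. openin (top_of X) U \<and> regular X U f \<and> (\<forall>x\<in>U. f x = g x) \<longrightarrow> regular X U g) \<and>
     (\<forall>U V f. openin (top_of X) U \<and> openin (top_of X) V \<and> V \<subseteq> U \<and> regular X U f \<longrightarrow>
        regular X V f) \<and>
     (\<forall>\<U> f. (\<forall>U\<in>\<U>. openin (top_of X) U \<and> regular X U f) \<longrightarrow> regular X (\<Union>\<U>) f)"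

text \<open>Separatedness is the requirement that equalizers of morphisms are closed, which can be tested
  on affine sources.\<close>

definition is_separated :: "('p, 'k::field) fspace \<Rightarrow> bool" where
  "is_separated X \<longleftrightarrow> (\<forall>(n::nat) S \<phi> \<psi>.
     morphism (affine_zeros {..<n} S) X \<phi> \<and> morphism (affine_zeros {..<n} S) X \<psi> \<longrightarrow>
     closedin (top_of (affine_zeros {..<n} S)) {w \<in> points (affine_zeros {..<n} S). \<phi> w = \<psi> w})"

definition is_variety :: "('p, 'k::field) fspace \<Rightarrow> bool" where
  "is_variety X \<longleftrightarrow> is_function_sheaf X \<and> is_separated X \<and>
     (\<exists>\<U>. finite \<U> \<and> \<Union>\<U> = points X \<and>
        (\<forall>U\<in>\<U>. openin (top_of X) U \<and> is_affine (subspace_of X U)))"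

text \<open>The points of projective space are the lines through the origin, without the origin.\<close>

definition proj_points :: "'i set \<Rightarrow> ('i \<Rightarrow> 'k::field alg_closure) set set" where
  "proj_points I = (affine_points I - {\<lambda>_. 0}) //
     {(x, y). x \<in> affine_points I - {\<lambda>_. 0} \<and> (\<exists>c. c \<noteq> 0 \<and> y = (\<lambda>i. c * x i))}"

definition proj_top :: "'i set \<Rightarrow> 'k::field itself \<Rightarrow> ('i \<Rightarrow> 'k alg_closure) set topology" where
  "proj_top I _ = topology_generated_by
     {{L \<in> proj_points I. \<forall>x\<in>L. peval p x \<noteq> 0} | p :: ('i, 'k) mpol. \<exists>d. homogeneous d p}"

definition proj_space :: "'i set \<Rightarrow> (('i \<Rightarrow> 'k::field alg_closure) set, 'k) fspace" where
  "proj_space I = \<lparr>top_of = proj_top I TYPE('k),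
     regular = (\<lambda>U f. \<forall>L\<in>U. \<exists>W d (p :: ('i, 'k) mpol) q. openin (proj_top I TYPE('k)) W \<and> L \<in> W \<and>
                  homogeneous d p \<and> homogeneous d q \<and>
                  (\<forall>M\<in>W \<inter> U. \<forall>y\<in>M. peval q y \<noteq> 0 \<and> f M = peval p y / peval q y))\<rparr>"

definition proj_hypersurface ::
  "'i set \<Rightarrow> ('i, 'k::field) mpol \<Rightarrow> (('i \<Rightarrow> 'k alg_closure) set, 'k) fspace" where
  "proj_hypersurface I p = subspace_of (proj_space I) {L. \<forall>x\<in>L. peval p x = 0}"

definition graph_hypersurface :: "('v, 'e) mgraph \<Rightarrow> (('e \<Rightarrow> 'k::field alg_closure) set, 'k) fspace"
  where "graph_hypersurface G = proj_hypersurface (edges G) (kirchhoff G)"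

definition graph_complement :: "('v, 'e) mgraph \<Rightarrow> (('e \<Rightarrow> 'k::field alg_closure) set, 'k) fspace"
  where "graph_complement G =
    subspace_of (proj_space (edges G)) (points (proj_space (edges G)) - points (graph_hypersurface G))"


section \<open>The Grothendieck ring of varieties\<close>

text \<open>Every variety has at most as many points as the algebraic closure, so every variety is
  isomorphic to one with points in \<open>nat \<Rightarrow> 'k alg_closure\<close>. These are used as generators.\<close>

lemma ex_variety: "\<exists>X :: ('p, 'k::field) fspace. is_variety X"
proof -
  define X :: "('p, 'k) fspace" where "X = \<lparr>top_of = subtopology undefined {}, regular = (\<lambda>_ _. True)\<rparr>"
  have pts: "points X = {}"
    by (simp add: X_def)
  have "is_separated X"
    unfolding is_separated_def
  proof (intro allI impI, elim conjE)
    fix n :: nat and S \<phi> \<psi>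
    assume "morphism (affine_zeros {..<n} S) X \<phi>"
    then have "continuous_map (top_of (affine_zeros {..<n} S)) (top_of X) \<phi>"
      by (simp add: morphism_def)
    from continuous_map_image_subset_topspace [OF this]
    have "points (affine_zeros {..<n} S) = {}"
      unfolding pts by blast
    then show "closedin (top_of (affine_zeros {..<n} S))
        {w \<in> points (affine_zeros {..<n} S). \<phi> w = \<psi> w}"
      by (metis (no_types, lifting) closedin_empty empty_iff mem_Collect_eq equals0I)
  qed
  moreover have "is_function_sheaf X"
    by (simp add: is_function_sheaf_def X_def)
  ultimately have "is_variety X"
    using pts unfolding is_variety_def by (intro conjI exI[of _ "{}"]) auto
  then show ?thesis ..
qed

typedef (overloaded) 'k variety = "{X :: (nat \<Rightarrow> 'k::field alg_closure, 'k) fspace. is_variety X}"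
  using ex_variety by blast

text \<open>Products are characterized by their universal property in the category of varieties.\<close>

definition is_product :: "'k::field variety \<Rightarrow> 'k variety \<Rightarrow> 'k variety \<Rightarrow> bool" where
  "is_product P X Y \<longleftrightarrow>
     (\<exists>p q. morphism (Rep_variety P) (Rep_variety X) p \<and> morphism (Rep_variety P) (Rep_variety Y) q \<and>
       (\<forall>W f g. morphism (Rep_variety W) (Rep_variety X) f \<and>
                morphism (Rep_variety W) (Rep_variety Y) g \<longrightarrow>
          (\<exists>h. morphism (Rep_variety W) (Rep_variety P) h \<and>
               (\<forall>w\<in>points (Rep_variety W). p (h w) = f w \<and> q (h w) = g w) \<and>
               (\<forall>h'. morphism (Rep_variety W) (Rep_variety P) h' \<and>
                     (\<forall>w\<in>points (Rep_variety W). p (h' w) = f w \<and> q (h' w) = g w) \<longrightarrow>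
                  (\<forall>w\<in>points (Rep_variety W). h' w = h w)))))"

text \<open>\<open>K0\<close> is the commutative ring with one generator for each variety, subject to the relations
  below: the free commutative ring on the varieties is the ring of integral polynomials with
  the varieties as variables. Since products of generators are again generators, this is the
  free abelian group on isomorphism classes modulo the scissor relations, with the multiplication
  induced by products and the class of a point as its one.\<close>

type_synonym 'k free_ring = "('k variety, int) mpol"

definition gen :: "'k::field variety \<Rightarrow> 'k free_ring" where
  "gen X = Poly_Mapping.single (Poly_Mapping.single X 1) 1"

definition K0_relations :: "'k::field free_ring set" where
  "K0_relations =
     {gen X - gen Y | X Y. isomorphic (Rep_variety X) (Rep_variety Y)} \<union>
     {gen X - gen Z - gen U | X Z U. \<exists>A. closedin (top_of (Rep_variety X)) A \<and>
        Rep_variety Z = subspace_of (Rep_variety X) A \<and>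
        Rep_variety U = subspace_of (Rep_variety X) (points (Rep_variety X) - A)} \<union>
     {gen P - gen X * gen Y | P X Y. is_product P X Y} \<union>
     {gen P - 1 | P. Rep_variety P = affine_space {}}"

definition K0_ideal :: "'k::field free_ring set" where
  "K0_ideal = Idl\<^bsub>ring_of_type_algebra\<^esub> K0_relations"

definition K0 :: "'k::field itself \<Rightarrow> 'k free_ring set ring" where
  "K0 _ = ring_of_type_algebra Quot K0_ideal"

lemma cring_K0: "cring (K0 TYPE('k::field))"
proof -
  interpret R: cring "ring_of_type_algebra :: 'k free_ring ring"
    by (rule cring_from_type_algebra)
  have "ideal (K0_ideal :: 'k free_ring set) ring_of_type_algebra"
    unfolding K0_ideal_def
    by (rule R.genideal_ideal) (simp add: ring_of_type_algebra_def)
  then show ?thesis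
    unfolding K0_def by (rule ideal.quotient_is_cring) (rule R.is_cring)
qed

text \<open>The class of a variety with points in an arbitrary type. An isomorphic generator exists for
  every variety, and the class does not depend on its choice.\<close>

definition var_class :: "('p, 'k::field) fspace \<Rightarrow> 'k free_ring set" where
  "var_class X = K0_ideal +>\<^bsub>ring_of_type_algebra\<^esub> gen (SOME Y. isomorphic (Rep_variety Y) X)"

text \<open>The 1-torus is the complement of the origin in the affine line.\<close>

definition torus :: "'k::field itself \<Rightarrow> (nat \<Rightarrow> 'k alg_closure, 'k) fspace" where
  "torus _ = subspace_of (affine_space {0}) {x. x 0 \<noteq> 0}"

definition torus_class :: "'k::field itself \<Rightarrow> 'k free_ring set" where
  "torus_class _ = var_class (torus TYPE('k))"

end

theory Submission
  imports Defs "HOL-Combinatorics.Permutations"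
begin

text \<open>
  The complement \<open>Y\<close> of the graph hypersurface carries an action of the torus without fixed points,
  and this makes its class divisible by the class of the torus.

  The action. By the matrix-tree theorem (\<open>matrix_tree\<close>), the Kirchhoff polynomial is the determinant
  of the Laplacian restricted to a set \<open>U\<close> of vertices that omits one root from each connected
  component. A nexus or a fat nexus splits \<open>U\<close> into two parts such that edges between the parts exist only
  between neighbors of the root. A linear change of coordinates (\<open>straighten_laplacian\<close>) then separates
  the blocks of the Laplacian: the diagonal blocks depend on disjoint sets \<open>A\<close> and \<open>C\<close> of
  coordinates, the off-diagonal blocks on a third set \<open>B\<close>. Scaling \<open>A\<close> by \<open>t\<close> and \<open>C\<close> by the inverse of \<open>t\<close>
  is the same as multiplying the matrix from both sides by a diagonal matrix with entries
  \<open>t\<close> to the powers 1/2 and -1/2. So the action preserves \<open>Y\<close>. Its fixed points in projective space are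
  the points supported in one of \<open>A\<close>, \<open>B\<close> and \<open>C\<close>, and the determinant vanishes there; for \<open>B\<close> this is where
  the condition on the sizes of the two parts enters (\<open>cl_complement_split\<close>). If the simplification
  is disconnected, its components can be scaled separately, which is a special case of this
  construction.

  The class. If two coordinates of weights differing by 1 vanish nowhere on an invariant locus, then the
  locus is the product of the torus and the slice on which the two coordinates agree
  (\<open>cl_torus_action\<close>). As \<open>Y\<close> contains no fixed points, it is a disjoint union of loci of this type, given by
  the vanishing of some coordinates and the nonvanishing of two others
  (\<open>cl_torus_fixed_point_free\<close>). Hence the class of \<open>Y\<close> is 0 modulo the class of the torus. The same method
  shows that the class of projective space is the number of its homogeneous coordinates
  (\<open>cl_proj_space\<close>), and the class of the hypersurface is the difference.

  For these computations, the pieces have to be known to be varieties, and morphisms between them have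
  to be constructed from formulas in coordinates. The first sections provide this for loci in affine and
  projective space which are given by equations and one inequation.
\<close>

section \<open>Polynomials\<close>

definition monomial_eval :: "('i \<Rightarrow>\<^sub>0 nat) \<Rightarrow> ('i \<Rightarrow> 'a::comm_semiring_1) \<Rightarrow> 'a" where
  "monomial_eval m x = (\<Prod>i\<in>Poly_Mapping.keys m. x i ^ Poly_Mapping.lookup m i)"

lemma monomial_eval_superset:
  assumes "finite S" "Poly_Mapping.keys m \<subseteq> S"
  shows "monomial_eval m x = (\<Prod>i\<in>S. x i ^ Poly_Mapping.lookup m i)"
  unfolding monomial_eval_def
  by (rule prod.mono_neutral_left) (use assms in \<open>auto simp: in_keys_iff\<close>)

lemma monomial_eval_0 [simp]: "monomial_eval 0 x = 1"
  by (simp add: monomial_eval_def)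

lemma monomial_eval_single [simp]: "monomial_eval (Poly_Mapping.single i n) x = x i ^ n"
  by (cases "n = 0") (auto simp: monomial_eval_def)

lemma monomial_eval_add: "monomial_eval (m + m') x = monomial_eval m x * monomial_eval m' x"
proof -
  let ?S = "Poly_Mapping.keys m \<union> Poly_Mapping.keys m'"
  have "monomial_eval (m + m') x = (\<Prod>i\<in>?S. x i ^ Poly_Mapping.lookup (m + m') i)"
    by (rule monomial_eval_superset) (use keys_add[of m m'] in auto)
  also have "\<dots> = (\<Prod>i\<in>?S. x i ^ Poly_Mapping.lookup m i) * (\<Prod>i\<in>?S. x i ^ Poly_Mapping.lookup m' i)"
    by (simp add: lookup_add power_add prod.distrib)
  also have "\<dots> = monomial_eval m x * monomial_eval m' x"
    by (simp add: monomial_eval_superset[symmetric])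
  finally show ?thesis .
qed

lemma peval_eq: "peval p x = (\<Sum>m\<in>Poly_Mapping.keys p. to_ac (Poly_Mapping.lookup p m) * monomial_eval m x)"
  by (simp add: peval_def monomial_eval_def)

lemma peval_superset:
  assumes "finite S" "Poly_Mapping.keys p \<subseteq> S"
  shows "peval p x = (\<Sum>m\<in>S. to_ac (Poly_Mapping.lookup p m) * monomial_eval m x)"
  unfolding peval_eq
  by (rule sum.mono_neutral_left) (use assms in \<open>auto simp: in_keys_iff\<close>)

lemma peval_0 [simp]: "peval 0 x = 0"
  by (simp add: peval_eq)

lemma peval_single [simp]: "peval (Poly_Mapping.single m a) x = to_ac a * monomial_eval m x"
  by (cases "a = 0") (auto simp: peval_eq)

lemma peval_1 [simp]: "peval 1 x = 1"
  using peval_single[of 0 1 x] by simp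

lemma peval_add [simp]: "peval (p + q) x = peval p x + peval q x"
proof -
  let ?S = "Poly_Mapping.keys p \<union> Poly_Mapping.keys q"
  have "peval (p + q) x = (\<Sum>m\<in>?S. to_ac (Poly_Mapping.lookup (p + q) m) * monomial_eval m x)"
    by (rule peval_superset) (use keys_add[of p q] in auto)
  also have "\<dots> = (\<Sum>m\<in>?S. to_ac (Poly_Mapping.lookup p m) * monomial_eval m x)
      + (\<Sum>m\<in>?S. to_ac (Poly_Mapping.lookup q m) * monomial_eval m x)"
    by (simp add: lookup_add algebra_simps sum.distrib)
  also have "\<dots> = peval p x + peval q x"
    by (simp add: peval_superset[symmetric])
  finally show ?thesis .
qed

lemma peval_uminus [simp]: "peval (- p) x = - peval p x"
proof -
  have "peval (- p) x + peval p x = 0"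
    by (simp flip: peval_add)
  then show ?thesis
    by (simp add: eq_neg_iff_add_eq_0)
qed

lemma peval_diff [simp]: "peval (p - q) x = peval p x - peval q x"
  using peval_add[of p "- q" x] by (simp del: peval_add)

lemma peval_sum: "peval (sum p S) x = (\<Sum>s\<in>S. peval (p s) x)"
  by (induction S rule: infinite_finite_induct) auto

lemma mpol_as_sum:
  "p = (\<Sum>m\<in>Poly_Mapping.keys p. Poly_Mapping.single m (Poly_Mapping.lookup p m))"
  by (rule poly_mapping_eqI)
    (auto simp: lookup_sum lookup_single when_def in_keys_iff)

lemma peval_mult [simp]: "peval (p * q) x = peval p x * peval q x"
proof -
  let ?s = "\<lambda>p m. Poly_Mapping.single m (Poly_Mapping.lookup p m)"
  have "p * q = (\<Sum>m\<in>Poly_Mapping.keys p. ?s p m) * (\<Sum>m\<in>Poly_Mapping.keys q. ?s q m)"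
    by (simp flip: mpol_as_sum)
  also have "\<dots> = (\<Sum>m\<in>Poly_Mapping.keys p. \<Sum>m'\<in>Poly_Mapping.keys q. ?s p m * ?s q m')"
    by (rule sum_product)
  finally have "p * q = (\<Sum>m\<in>Poly_Mapping.keys p. \<Sum>m'\<in>Poly_Mapping.keys q. ?s p m * ?s q m')" .
  then have "peval (p * q) x = (\<Sum>m\<in>Poly_Mapping.keys p. \<Sum>m'\<in>Poly_Mapping.keys q.
      (to_ac (Poly_Mapping.lookup p m) * monomial_eval m x) *
      (to_ac (Poly_Mapping.lookup q m') * monomial_eval m' x))"
    by (simp add: peval_sum mult_single monomial_eval_add mult_ac)
  also have "\<dots> = peval p x * peval q x"
    unfolding peval_eq by (rule sum_product[symmetric])
  finally show ?thesis .
qed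

lemma peval_prod: "peval (prod p S) x = (\<Prod>s\<in>S. peval (p s) x)"
  by (induction S rule: infinite_finite_induct) auto

lemma peval_power [simp]: "peval (p ^ n) x = peval p x ^ n"
  by (induction n) auto

definition pvar :: "'i \<Rightarrow> ('i, 'k::field) mpol" where
  "pvar i = Poly_Mapping.single (Poly_Mapping.single i 1) 1"

lemma peval_pvar [simp]: "peval (pvar i) x = x i"
  by (simp add: pvar_def)

definition psubst :: "('i \<Rightarrow> ('j, 'k) mpol) \<Rightarrow> ('i, 'k::field) mpol \<Rightarrow> ('j, 'k) mpol" where
  "psubst s p = (\<Sum>m\<in>Poly_Mapping.keys p.
     Poly_Mapping.single 0 (Poly_Mapping.lookup p m) * monomial_eval m s)"

lemma peval_psubst: "peval (psubst s p) x = peval p (\<lambda>i. peval (s i) x)"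
  by (simp add: psubst_def peval_eq[of p] peval_sum monomial_eval_def peval_prod)

subsection \<open>Homogeneity\<close>

definition monomial_degree :: "('i \<Rightarrow>\<^sub>0 nat) \<Rightarrow> nat" where
  "monomial_degree m = (\<Sum>i\<in>Poly_Mapping.keys m. Poly_Mapping.lookup m i)"

lemma homogeneous_iff: "homogeneous d p \<longleftrightarrow> (\<forall>m\<in>Poly_Mapping.keys p. monomial_degree m = d)"
  by (simp add: homogeneous_def monomial_degree_def)

lemma monomial_degree_superset:
  assumes "finite S" "Poly_Mapping.keys m \<subseteq> S"
  shows "monomial_degree m = (\<Sum>i\<in>S. Poly_Mapping.lookup m i)"
  unfolding monomial_degree_def
  by (rule sum.mono_neutral_left) (use assms in \<open>auto simp: in_keys_iff\<close>)

lemma monomial_degree_add: "monomial_degree (m + m') = monomial_degree m + monomial_degree m'"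
proof -
  let ?S = "Poly_Mapping.keys m \<union> Poly_Mapping.keys m'"
  have "monomial_degree (m + m') = (\<Sum>i\<in>?S. Poly_Mapping.lookup (m + m') i)"
    by (rule monomial_degree_superset) (use keys_add[of m m'] in auto)
  also have "\<dots> = monomial_degree m + monomial_degree m'"
    by (simp add: monomial_degree_superset[of ?S] lookup_add sum.distrib)
  finally show ?thesis .
qed

lemma homogeneous_0 [simp]: "homogeneous d 0"
  by (simp add: homogeneous_def)

lemma homogeneous_const: "homogeneous 0 (Poly_Mapping.single 0 a)"
  by (cases "a = 0") (auto simp: homogeneous_def)

lemma homogeneous_1 [simp]: "homogeneous 0 (1 :: ('i, 'k::field) mpol)"
  using homogeneous_const[of "1 :: 'k"] by (simp only: single_one)

lemma homogeneous_pvar [simp]: "homogeneous 1 (pvar i)"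
  by (auto simp: homogeneous_def pvar_def)

lemma homogeneous_add: "homogeneous d p \<Longrightarrow> homogeneous d q \<Longrightarrow> homogeneous d (p + q)"
  using keys_add[of p q] by (auto simp: homogeneous_iff)

lemma homogeneous_uminus: "homogeneous d (p :: ('i, 'k::field) mpol) \<Longrightarrow> homogeneous d (- p)"
  by (auto simp: homogeneous_iff in_keys_iff)

lemma homogeneous_diff:
  "homogeneous d p \<Longrightarrow> homogeneous d (q :: ('i, 'k::field) mpol) \<Longrightarrow> homogeneous d (p - q)"
  using homogeneous_add[of d p "- q"] homogeneous_uminus[of d q] by simp

lemma homogeneous_sum: "(\<And>s. s \<in> S \<Longrightarrow> homogeneous d (p s)) \<Longrightarrow> homogeneous d (sum p S)"
  by (induction S rule: infinite_finite_induct) (auto intro: homogeneous_add)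

lemma homogeneous_mult:
  assumes "homogeneous d p" "homogeneous e q"
  shows "homogeneous (d + e) (p * q)"
  using keys_mult[of p q] assms by (fastforce simp: homogeneous_iff monomial_degree_add)

lemma homogeneous_power:
  "homogeneous d (p :: ('i, 'k::field) mpol) \<Longrightarrow> homogeneous (d * n) (p ^ n)"
  by (induction n) (auto dest: homogeneous_mult)

lemma homogeneous_prod:
  fixes p :: "'s \<Rightarrow> ('i, 'k::field) mpol"
  shows "(\<And>s. s \<in> S \<Longrightarrow> homogeneous (d s) (p s)) \<Longrightarrow> homogeneous (sum d S) (prod p S)"
  by (induction S rule: infinite_finite_induct) (auto intro: homogeneous_mult)

lemma homogeneous_psubst:
  assumes "homogeneous d p" "\<And>i. homogeneous 1 (s i)"
  shows "homogeneous d (psubst s p)"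
  unfolding psubst_def
proof (rule homogeneous_sum)
  fix m assume m: "m \<in> Poly_Mapping.keys p"
  have "homogeneous (\<Sum>i\<in>Poly_Mapping.keys m. 1 * Poly_Mapping.lookup m i) (monomial_eval m s)"
    unfolding monomial_eval_def
    by (intro homogeneous_prod homogeneous_power assms)
  then have "homogeneous d (monomial_eval m s)"
    using assms m by (simp add: homogeneous_def)
  then show "homogeneous d (Poly_Mapping.single 0 (Poly_Mapping.lookup p m) * monomial_eval m s)"
    using homogeneous_mult[OF homogeneous_const] by fastforce
qed

lemma monomial_eval_scale:
  "monomial_eval m (\<lambda>i. c * x i) = c ^ monomial_degree m * monomial_eval m x"
  by (simp add: monomial_eval_def monomial_degree_def power_mult_distrib prod.distrib power_sum)

lemma peval_scale:
  assumes "homogeneous d p"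
  shows "peval p (\<lambda>i. c * x i) = c ^ d * peval p x"
proof -
  have "peval p (\<lambda>i. c * x i) = (\<Sum>m\<in>Poly_Mapping.keys p. c ^ d * (to_ac (Poly_Mapping.lookup p m) * monomial_eval m x))"
    unfolding peval_eq
    by (rule sum.cong) (use assms in \<open>auto simp: homogeneous_iff monomial_eval_scale\<close>)
  then show ?thesis
    by (simp add: peval_eq sum_distrib_left)
qed

section \<open>Spaces with functions\<close>

subsection \<open>Morphisms and subspaces\<close>

lemma morphism_continuous: "morphism X Y \<phi> \<Longrightarrow> continuous_map (top_of X) (top_of Y) \<phi>"
  by (simp add: morphism_def)

lemma morphism_points: "morphism X Y \<phi> \<Longrightarrow> x \<in> points X \<Longrightarrow> \<phi> x \<in> points Y"
  using continuous_map_image_subset_topspace[OF morphism_continuous] by blast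

lemma morphism_openin:
  "morphism X Y \<phi> \<Longrightarrow> openin (top_of Y) U \<Longrightarrow> openin (top_of X) {x \<in> points X. \<phi> x \<in> U}"
  by (rule openin_continuous_map_preimage[OF morphism_continuous])

lemma morphism_regular:
  "morphism X Y \<phi> \<Longrightarrow> openin (top_of Y) U \<Longrightarrow> regular Y U f \<Longrightarrow>
    regular X {x \<in> points X. \<phi> x \<in> U} (f \<circ> \<phi>)"
  by (simp add: morphism_def)

lemma morphism_id: "morphism X X (\<lambda>x. x)"
proof -
  have "{x \<in> points X. x \<in> U} = U" if "openin (top_of X) U" for U
    using openin_subset[OF that] by blast
  then show ?thesis
    by (auto simp: morphism_def comp_def)
qed

lemma morphism_comp:
  assumes "morphism X Y \<phi>" "morphism Y Z \<psi>"
  shows "morphism X Z (\<lambda>x. \<psi> (\<phi> x))"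
  unfolding morphism_def
proof (intro conjI allI impI; (elim conjE)?)
  show "continuous_map (top_of X) (top_of Z) (\<lambda>x. \<psi> (\<phi> x))"
    using continuous_map_compose[OF morphism_continuous[OF assms(1)] morphism_continuous[OF assms(2)]]
    by (simp add: comp_def)
  fix U f assume U: "openin (top_of Z) U" "regular Z U f"
  have "regular X {x \<in> points X. \<phi> x \<in> {y \<in> points Y. \<psi> y \<in> U}} ((f \<circ> \<psi>) \<circ> \<phi>)"
    by (intro morphism_regular[OF assms(1)] morphism_openin[OF assms(2)]
        morphism_regular[OF assms(2)] U)
  moreover have "{x \<in> points X. \<phi> x \<in> {y \<in> points Y. \<psi> y \<in> U}} = {x \<in> points X. \<psi> (\<phi> x) \<in> U}"
    using morphism_points[OF assms(1)] by auto
  ultimately show "regular X {x \<in> points X. \<psi> (\<phi> x) \<in> U} (f \<circ> (\<lambda>x. \<psi> (\<phi> x)))"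
    by (simp add: comp_def)
qed

lemma top_of_subspace [simp]: "top_of (subspace_of X A) = subtopology (top_of X) A"
  by (simp add: subspace_of_def)

lemma regular_subspace: "regular (subspace_of X A) U f \<longleftrightarrow>
    (\<forall>x\<in>U. \<exists>W g. openin (top_of X) W \<and> x \<in> W \<and> regular X W g \<and> (\<forall>y\<in>W \<inter> U. f y = g y))"
  by (simp add: subspace_of_def)

lemma points_subspace: "points (subspace_of X A) = points X \<inter> A"
  by (simp add: topspace_subtopology)

lemma subspace_restrict: "subspace_of X A = subspace_of X (points X \<inter> A)"
  by (simp add: subspace_of_def subtopology_restrict)

lemma morphism_inclusion: "morphism (subspace_of X A) X (\<lambda>x. x)"
  unfolding morphism_def
proof (intro conjI allI impI; (elim conjE)?)
  show "continuous_map (top_of (subspace_of X A)) (top_of X) (\<lambda>x. x)"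
    by (simp add: continuous_map_from_subtopology)
  fix U f assume U: "openin (top_of X) U" "regular X U f"
  then show "regular (subspace_of X A) {x \<in> points (subspace_of X A). x \<in> U} (f \<circ> (\<lambda>x. x))"
    by (auto simp: regular_subspace)
qed

lemma sheaf_cong:
  assumes "is_function_sheaf X" "openin (top_of X) U" "regular X U f" "\<And>x. x \<in> U \<Longrightarrow> f x = g x"
  shows "regular X U g"
  using conjunct1[OF assms(1)[unfolded is_function_sheaf_def], rule_format, of U f g] assms(2-4)
  by simp

lemma sheaf_restrict:
  assumes "is_function_sheaf X" "openin (top_of X) U" "regular X U f" "openin (top_of X) V" "V \<subseteq> U"
  shows "regular X V f"
  using conjunct1[OF conjunct2[OF assms(1)[unfolded is_function_sheaf_def]], rule_format, of U V f]
    assms(2-5)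
  by simp

lemma sheaf_Union:
  assumes "is_function_sheaf X" "\<And>U. U \<in> \<U> \<Longrightarrow> openin (top_of X) U \<and> regular X U f"
  shows "regular X (\<Union>\<U>) f"
  using conjunct2[OF conjunct2[OF assms(1)[unfolded is_function_sheaf_def]], rule_format, of \<U> f]
    assms(2)
  by simp

lemma sheaf_local:
  assumes "is_function_sheaf X"
    and "\<And>x. x \<in> U \<Longrightarrow> \<exists>V g. openin (top_of X) V \<and> x \<in> V \<and> V \<subseteq> U \<and> regular X V g \<and> (\<forall>y\<in>V. f y = g y)"
  shows "regular X U f"
proof -
  define \<U> where "\<U> = {V. openin (top_of X) V \<and> V \<subseteq> U \<and> regular X V f}"
  have "\<exists>V\<in>\<U>. x \<in> V" if x: "x \<in> U" for x
  proof -
    obtain V g where V: "openin (top_of X) V" "x \<in> V" "V \<subseteq> U" "regular X V g" "\<forall>y\<in>V. f y = g y"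
      using assms(2)[OF x] by blast
    have "regular X V f"
      by (rule sheaf_cong[OF assms(1) V(1,4)]) (use V(5) in auto)
    then show ?thesis
      unfolding \<U>_def using V by blast
  qed
  then have "\<Union>\<U> = U"
    unfolding \<U>_def by blast
  moreover have "regular X (\<Union>\<U>) f"
    by (rule sheaf_Union[OF assms(1)]) (auto simp: \<U>_def)
  ultimately show ?thesis by simp
qed

lemma morphism_into_subspace:
  assumes \<phi>: "morphism X Y \<phi>" and sheaf: "is_function_sheaf X"
    and im: "\<And>x. x \<in> points X \<Longrightarrow> \<phi> x \<in> B"
  shows "morphism X (subspace_of Y B) \<phi>"
  unfolding morphism_def
proof (intro conjI allI impI; (elim conjE)?)
  show cont: "continuous_map (top_of X) (top_of (subspace_of Y B)) \<phi>"
    using morphism_continuous[OF \<phi>] im by (auto simp: continuous_map_in_subtopology)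
  fix U f assume U: "openin (top_of (subspace_of Y B)) U" "regular (subspace_of Y B) U f"
  let ?V = "{x \<in> points X. \<phi> x \<in> U}"
  have V: "openin (top_of X) ?V"
    by (rule openin_continuous_map_preimage[OF cont U(1)])
  show "regular X ?V (f \<circ> \<phi>)"
  proof (rule sheaf_local[OF sheaf])
    fix x assume x: "x \<in> ?V"
    then obtain W g where W: "openin (top_of Y) W" "\<phi> x \<in> W" "regular Y W g"
      "\<forall>y\<in>W \<inter> U. f y = g y"
      using U(2) by (auto simp: regular_subspace)
    let ?W = "{x \<in> points X. \<phi> x \<in> W}"
    have 1: "openin (top_of X) ?W" "regular X ?W (g \<circ> \<phi>)"
      using morphism_openin[OF \<phi> W(1)] morphism_regular[OF \<phi> W(1,3)] by auto
    have 2: "openin (top_of X) (?W \<inter> ?V)"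
      by (rule openin_Int[OF 1(1) V])
    have "regular X (?W \<inter> ?V) (g \<circ> \<phi>)"
      by (rule sheaf_restrict[OF sheaf 1 2]) auto
    then show "\<exists>V g. openin (top_of X) V \<and> x \<in> V \<and> V \<subseteq> ?V \<and> regular X V g \<and> (\<forall>y\<in>V. (f \<circ> \<phi>) y = g y)"
      using 2 W x by (intro exI[of _ "?W \<inter> ?V"] exI[of _ "g \<circ> \<phi>"]) auto
  qed
qed

lemma sheaf_locally:
  assumes "is_function_sheaf X"
    and "\<And>x. x \<in> U \<Longrightarrow> \<exists>V. openin (top_of X) V \<and> x \<in> V \<and> V \<subseteq> U \<and> regular X V f"
  shows "regular X U f"
  by (rule sheaf_local[OF assms(1)]) (use assms(2) in blast)

lemma is_function_sheaf_subspace: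
  assumes X: "is_function_sheaf X"
  shows "is_function_sheaf (subspace_of X A)"
  unfolding is_function_sheaf_def
proof (intro conjI allI impI; (elim conjE)?)
  fix U f g assume "regular (subspace_of X A) U f" "\<forall>x\<in>U. f x = g x"
  then show "regular (subspace_of X A) U g"
    unfolding regular_subspace by fastforce
next
  fix U V f assume VU: "V \<subseteq> U" and f: "regular (subspace_of X A) U f"
  show "regular (subspace_of X A) V f"
    unfolding regular_subspace
  proof
    fix x assume "x \<in> V"
    then have "x \<in> U" using VU by blast
    then obtain W g where "openin (top_of X) W" "x \<in> W" "regular X W g" "\<forall>y\<in>W \<inter> U. f y = g y"
      using f unfolding regular_subspace by blast
    then show "\<exists>W g. openin (top_of X) W \<and> x \<in> W \<and> regular X W g \<and> (\<forall>y\<in>W \<inter> V. f y = g y)"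
      using VU by (intro exI[of _ W] exI[of _ g]) auto
  qed
next
  fix \<U> f assume *: "\<forall>U\<in>\<U>. openin (top_of (subspace_of X A)) U \<and> regular (subspace_of X A) U f"
  show "regular (subspace_of X A) (\<Union>\<U>) f"
    unfolding regular_subspace
  proof
    fix x assume "x \<in> \<Union>\<U>"
    then obtain U where U: "U \<in> \<U>" "x \<in> U" by blast
    with * have "regular (subspace_of X A) U f" by blast
    with U(2) obtain W g where W: "openin (top_of X) W" "x \<in> W" "regular X W g" "\<forall>y\<in>W \<inter> U. f y = g y"
      unfolding regular_subspace by blast
    from * U(1) obtain U' where U': "openin (top_of X) U'" "U = U' \<inter> A"
      by (auto simp: openin_subtopology)
    have sub: "\<Union>\<U> \<subseteq> A"
      using * by (auto simp: openin_subtopology)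
    have "openin (top_of X) (W \<inter> U')"
      using W U' by blast
    moreover from this have "regular X (W \<inter> U') g"
      by (rule sheaf_restrict[OF X W(1,3)]) auto
    ultimately show "\<exists>W g. openin (top_of X) W \<and> x \<in> W \<and> regular X W g \<and> (\<forall>y\<in>W \<inter> \<Union>\<U>. f y = g y)"
      using U U' W sub by (intro exI[of _ "W \<inter> U'"] exI[of _ g]) auto
  qed
qed

lemma morphism_subspace:
  assumes \<phi>: "morphism X Y \<phi>" and im: "\<And>x. x \<in> points X \<Longrightarrow> x \<in> A \<Longrightarrow> \<phi> x \<in> B"
  shows "morphism (subspace_of X A) (subspace_of Y B) \<phi>"
  unfolding morphism_def
proof (intro conjI allI impI; (elim conjE)?)
  show cont: "continuous_map (top_of (subspace_of X A)) (top_of (subspace_of Y B)) \<phi>"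
    using morphism_continuous[OF \<phi>] im
    by (auto simp: continuous_map_in_subtopology continuous_map_from_subtopology)
  fix U f assume U: "openin (top_of (subspace_of Y B)) U" "regular (subspace_of Y B) U f"
  show "regular (subspace_of X A) {x \<in> points (subspace_of X A). \<phi> x \<in> U} (f \<circ> \<phi>)"
    unfolding regular_subspace
  proof
    fix x assume x: "x \<in> {x \<in> points (subspace_of X A). \<phi> x \<in> U}"
    with U(2) obtain W g where W: "openin (top_of Y) W" "\<phi> x \<in> W" "regular Y W g"
      "\<forall>y\<in>W \<inter> U. f y = g y"
      by (auto simp: regular_subspace)
    let ?W = "{x \<in> points X. \<phi> x \<in> W}"
    show "\<exists>W g. openin (top_of X) W \<and> x \<in> W \<and> regular X W g \<and>
        (\<forall>y\<in>W \<inter> {x \<in> points (subspace_of X A). \<phi> x \<in> U}. (f \<circ> \<phi>) y = g y)"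
      using morphism_openin[OF \<phi> W(1)] morphism_regular[OF \<phi> W(1,3)] W x
      by (intro exI[of _ ?W] exI[of _ "g \<circ> \<phi>"]) (auto simp: topspace_subtopology)
  qed
qed

lemma isomorphic_refl: "isomorphic X X"
  unfolding isomorphic_def using morphism_id by blast

lemma isomorphic_sym: "isomorphic X Y \<Longrightarrow> isomorphic Y X"
  unfolding isomorphic_def by blast

lemma isomorphic_trans:
  assumes "isomorphic X Y" "isomorphic Y Z"
  shows "isomorphic X Z"
proof -
  from assms(1) obtain \<phi> \<psi> where 1: "morphism X Y \<phi>" "morphism Y X \<psi>"
    "\<forall>x\<in>points X. \<psi> (\<phi> x) = x" "\<forall>y\<in>points Y. \<phi> (\<psi> y) = y"
    unfolding isomorphic_def by blast
  from assms(2) obtain \<phi>' \<psi>' where 2: "morphism Y Z \<phi>'" "morphism Z Y \<psi>'"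
    "\<forall>x\<in>points Y. \<psi>' (\<phi>' x) = x" "\<forall>y\<in>points Z. \<phi>' (\<psi>' y) = y"
    unfolding isomorphic_def by blast
  have "morphism X Z (\<lambda>x. \<phi>' (\<phi> x))" "morphism Z X (\<lambda>x. \<psi> (\<psi>' x))"
    using 1 2 morphism_comp by blast+
  moreover have "\<forall>x\<in>points X. \<psi> (\<psi>' (\<phi>' (\<phi> x))) = x"
    using 1 2 morphism_points[OF 1(1)] by simp
  moreover have "\<forall>x\<in>points Z. \<phi>' (\<phi> (\<psi> (\<psi>' x))) = x"
    using 1 2 morphism_points[OF 2(2)] by simp
  ultimately show ?thesis
    unfolding isomorphic_def by blast
qed

lemma isomorphic_subspaceI:
  assumes "morphism X Y \<phi>" "morphism Y X \<psi>"
    "\<And>x. x \<in> points X \<Longrightarrow> \<psi> (\<phi> x) = x" "\<And>y. y \<in> points Y \<Longrightarrow> \<phi> (\<psi> y) = y"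
    "\<And>x. x \<in> points X \<Longrightarrow> x \<in> A \<longleftrightarrow> \<phi> x \<in> B"
  shows "isomorphic (subspace_of X A) (subspace_of Y B)"
proof -
  have "morphism (subspace_of X A) (subspace_of Y B) \<phi>"
    by (rule morphism_subspace[OF assms(1)]) (use assms in auto)
  moreover have "morphism (subspace_of Y B) (subspace_of X A) \<psi>"
    by (rule morphism_subspace[OF assms(2)]) (use assms morphism_points[OF assms(2)] in auto)
  ultimately show ?thesis
    unfolding isomorphic_def using assms
    by (intro exI[of _ \<phi>] exI[of _ \<psi>]) (auto simp: topspace_subtopology)
qed

text \<open>The two structures agree on open sets, which is all that morphisms see; on other sets the iterated
  restriction admits more functions, so this is an isomorphism and not an equation.\<close>

lemma isomorphic_subspace_subspace:
  assumes X: "is_function_sheaf X"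
  shows "isomorphic (subspace_of (subspace_of X A) B) (subspace_of X (A \<inter> B))"
proof -
  have "morphism (subspace_of (subspace_of X A) B) (subspace_of X (A \<inter> B)) (\<lambda>x. x)"
    by (rule morphism_into_subspace)
      (auto intro!: is_function_sheaf_subspace X morphism_comp[OF morphism_inclusion morphism_inclusion]
        simp: topspace_subtopology)
  moreover have "morphism (subspace_of X (A \<inter> B)) (subspace_of (subspace_of X A) B) (\<lambda>x. x)"
    by (intro morphism_into_subspace morphism_inclusion is_function_sheaf_subspace X)
      (auto simp: topspace_subtopology)
  ultimately show ?thesis
    unfolding isomorphic_def
    by (intro exI[of _ "\<lambda>x. x"]) (auto simp: topspace_subtopology)
qed

subsection \<open>Spaces whose functions form rings\<close>

text \<open>Spaces with functions come with no algebraic structure on their functions. The closure properties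
  collected here hold for varieties, because they can be checked on affine charts, and they are what
  allows a morphism to be defined by giving its coordinates.\<close>

definition is_ringed :: "('p, 'k::field) fspace \<Rightarrow> bool" where
  "is_ringed X \<longleftrightarrow> is_function_sheaf X \<and>
     (\<forall>U c. openin (top_of X) U \<longrightarrow> regular X U (\<lambda>_. to_ac c)) \<and>
     (\<forall>U f g. openin (top_of X) U \<and> regular X U f \<and> regular X U g \<longrightarrow>
        regular X U (\<lambda>x. f x + g x) \<and> regular X U (\<lambda>x. f x * g x)) \<and>
     (\<forall>U f. openin (top_of X) U \<and> regular X U f \<longrightarrow>
        openin (top_of X) {x \<in> U. f x \<noteq> 0} \<and> regular X {x \<in> U. f x \<noteq> 0} (\<lambda>x. inverse (f x)))"

lemma ringed_sheaf: "is_ringed X \<Longrightarrow> is_function_sheaf X"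
  by (simp add: is_ringed_def)

lemma regular_const: "is_ringed X \<Longrightarrow> openin (top_of X) U \<Longrightarrow> regular X U (\<lambda>_. to_ac c)"
  by (simp add: is_ringed_def)

lemma regular_add: "is_ringed X \<Longrightarrow> openin (top_of X) U \<Longrightarrow> regular X U f \<Longrightarrow> regular X U g \<Longrightarrow>
    regular X U (\<lambda>x. f x + g x)"
  by (simp add: is_ringed_def)

lemma regular_mult: "is_ringed X \<Longrightarrow> openin (top_of X) U \<Longrightarrow> regular X U f \<Longrightarrow> regular X U g \<Longrightarrow>
    regular X U (\<lambda>x. f x * g x)"
  by (simp add: is_ringed_def)

lemma openin_nonzero: "is_ringed X \<Longrightarrow> openin (top_of X) U \<Longrightarrow> regular X U f \<Longrightarrow>
    openin (top_of X) {x \<in> U. f x \<noteq> 0}"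
  by (simp add: is_ringed_def)

lemma regular_inverse: 
  assumes "is_ringed X" "openin (top_of X) U" "regular X U f" "\<And>x. x \<in> U \<Longrightarrow> f x \<noteq> 0"
  shows "regular X U (\<lambda>x. inverse (f x))"
proof -
  have "{x \<in> U. f x \<noteq> 0} = U" using assms(4) by blast
  moreover have "regular X {x \<in> U. f x \<noteq> 0} (\<lambda>x. inverse (f x))"
    using assms by (simp add: is_ringed_def)
  ultimately show ?thesis by simp
qed

lemma regular_0: "is_ringed X \<Longrightarrow> openin (top_of X) U \<Longrightarrow> regular X U (\<lambda>_. 0)"
  using regular_const[of X U 0] by simp

lemma regular_1: "is_ringed X \<Longrightarrow> openin (top_of X) U \<Longrightarrow> regular X U (\<lambda>_. 1)"
  using regular_const[of X U 1] by simp

lemma regular_sum: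
  assumes "is_ringed X" "openin (top_of X) U" "\<And>s. s \<in> S \<Longrightarrow> regular X U (f s)"
  shows "regular X U (\<lambda>x. \<Sum>s\<in>S. f s x)"
  using assms(3)
  by (induction S rule: infinite_finite_induct) (auto intro: regular_0 regular_add assms(1,2))

lemma regular_prod:
  assumes "is_ringed X" "openin (top_of X) U" "\<And>s. s \<in> S \<Longrightarrow> regular X U (f s)"
  shows "regular X U (\<lambda>x. \<Prod>s\<in>S. f s x)"
  using assms(3)
  by (induction S rule: infinite_finite_induct) (auto intro: regular_1 regular_mult assms(1,2))

lemma regular_power:
  assumes "is_ringed X" "openin (top_of X) U" "regular X U f"
  shows "regular X U (\<lambda>x. f x ^ n)"
  by (induction n) (auto intro: regular_1 regular_mult assms)

lemma regular_power_int:
  assumes "is_ringed X" "openin (top_of X) U" "regular X U f" "\<And>x. x \<in> U \<Longrightarrow> f x \<noteq> 0"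
  shows "regular X U (\<lambda>x. f x powi n)"
  by (cases "0 \<le> n")
    (simp_all add: power_int_def regular_power regular_inverse assms)

lemma regular_peval:
  assumes "is_ringed X" "openin (top_of X) U" "\<And>i. regular X U (\<lambda>x. v x i)"
  shows "regular X U (\<lambda>x. peval p (v x))"
  unfolding peval_def
  by (intro regular_sum regular_mult regular_const regular_prod regular_power assms)

lemma regular_diff:
  assumes "is_ringed X" "openin (top_of X) U" "regular X U f" "regular X U g"
  shows "regular X U (\<lambda>x. f x - g x)"
proof -
  have "regular X U (\<lambda>x. f x + to_ac (- 1) * g x)"
    by (intro regular_add regular_mult regular_const assms)
  then show ?thesis by simp
qed

text \<open>Locally, functions on a subspace are restrictions of functions of the ambient space, so sums, products
  and inverses can be formed there.\<close>

lemma ringed_subspace: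
  assumes X: "is_ringed X"
  shows "is_ringed (subspace_of X A)"
proof -
  note sheaf = ringed_sheaf[OF X]
  let ?Y = "subspace_of X A"
  have two: "\<exists>W g g'. openin (top_of X) W \<and> x \<in> W \<and> regular X W g \<and> regular X W g' \<and>
      (\<forall>y\<in>W \<inter> U. f y = g y \<and> f' y = g' y)"
    if f: "regular ?Y U f" "regular ?Y U f'" and x: "x \<in> U" for U f f' x
  proof -
    obtain W g where W: "openin (top_of X) W" "x \<in> W" "regular X W g" "\<forall>y\<in>W \<inter> U. f y = g y"
      using f(1) x unfolding regular_subspace by blast
    obtain W' g' where W': "openin (top_of X) W'" "x \<in> W'" "regular X W' g'" "\<forall>y\<in>W' \<inter> U. f' y = g' y"
      using f(2) x unfolding regular_subspace by blast
    have o: "openin (top_of X) (W \<inter> W')"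
      using W W' by blast
    have "regular X (W \<inter> W') g" "regular X (W \<inter> W') g'"
      using sheaf_restrict[OF sheaf W(1,3) o] sheaf_restrict[OF sheaf W'(1,3) o] by auto
    then show ?thesis
      using o W W' by (intro exI[of _ "W \<inter> W'"] exI[of _ g] exI[of _ g']) auto
  qed
  show ?thesis
    unfolding is_ringed_def
  proof (intro conjI allI impI; (elim conjE)?)
    show "is_function_sheaf ?Y"
      by (rule is_function_sheaf_subspace[OF sheaf])
  next
    fix U c assume "openin (top_of ?Y) U"
    then have "U \<subseteq> points X"
      using openin_subset by (fastforce simp: topspace_subtopology)
    then show "regular ?Y U (\<lambda>_. to_ac c)"
      unfolding regular_subspace using regular_const[OF X openin_topspace, of c] by blast
  next
    fix U f g assume "regular ?Y U f" "regular ?Y U g"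
    note * = two[OF this]
    show "regular ?Y U (\<lambda>x. f x + g x)"
      unfolding regular_subspace
    proof
      fix x assume "x \<in> U"
      from *[OF this] obtain W h h' where W: "openin (top_of X) W" "x \<in> W" "regular X W h"
        "regular X W h'" "\<forall>y\<in>W \<inter> U. f y = h y \<and> g y = h' y" by blast
      then show "\<exists>W h. openin (top_of X) W \<and> x \<in> W \<and> regular X W h \<and>
          (\<forall>y\<in>W \<inter> U. f y + g y = h y)"
        by (intro exI[of _ W] exI[of _ "\<lambda>x. h x + h' x"])
          (auto intro: regular_add[OF X])
    qed
  next
    fix U f g assume "regular ?Y U f" "regular ?Y U g"
    note * = two[OF this]
    show "regular ?Y U (\<lambda>x. f x * g x)"
      unfolding regular_subspace
    proof
      fix x assume "x \<in> U"
      from *[OF this] obtain W h h' where W: "openin (top_of X) W" "x \<in> W" "regular X W h"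
        "regular X W h'" "\<forall>y\<in>W \<inter> U. f y = h y \<and> g y = h' y" by blast
      then show "\<exists>W h. openin (top_of X) W \<and> x \<in> W \<and> regular X W h \<and>
          (\<forall>y\<in>W \<inter> U. f y * g y = h y)"
        by (intro exI[of _ W] exI[of _ "\<lambda>x. h x * h' x"])
          (auto intro: regular_mult[OF X])
    qed
  next
    fix U f assume U: "openin (top_of ?Y) U" and f: "regular ?Y U f"
    have *: "\<exists>W g. openin (top_of X) W \<and> x \<in> W \<and> regular X W g \<and> (\<forall>y\<in>W. g y \<noteq> 0) \<and>
        (\<forall>y\<in>W \<inter> U. f y = g y)" if x: "x \<in> U" "f x \<noteq> 0" for x
    proof -
      obtain W g where W: "openin (top_of X) W" "x \<in> W" "regular X W g" "\<forall>y\<in>W \<inter> U. f y = g y"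
        using f x unfolding regular_subspace by blast
      have "openin (top_of X) {y \<in> W. g y \<noteq> 0}"
        by (rule openin_nonzero[OF X W(1,3)])
      moreover from this have "regular X {y \<in> W. g y \<noteq> 0} g"
        by (rule sheaf_restrict[OF sheaf W(1,3)]) auto
      ultimately show ?thesis
        using W x by (intro exI[of _ "{y \<in> W. g y \<noteq> 0}"] exI[of _ g]) auto
    qed
    show "openin (top_of ?Y) {x \<in> U. f x \<noteq> 0}"
      unfolding openin_subopen[of _ "{x \<in> U. f x \<noteq> 0}"]
    proof
      fix x assume x: "x \<in> {x \<in> U. f x \<noteq> 0}"
      with * obtain W g where W: "openin (top_of X) W" "x \<in> W" "regular X W g" "\<forall>y\<in>W. g y \<noteq> 0"
        "\<forall>y\<in>W \<inter> U. f y = g y" by blast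
      have "openin (top_of ?Y) ((W \<inter> A) \<inter> U)"
        by (rule openin_Int[OF _ U]) (use W in \<open>auto intro: openin_subtopology_Int\<close>)
      moreover have "U \<subseteq> A"
        using U by (auto simp: openin_subtopology)
      ultimately show "\<exists>T. openin (top_of ?Y) T \<and> x \<in> T \<and> T \<subseteq> {x \<in> U. f x \<noteq> 0}"
        using W x by (intro exI[of _ "(W \<inter> A) \<inter> U"]) auto
    qed
    show "regular ?Y {x \<in> U. f x \<noteq> 0} (\<lambda>x. inverse (f x))"
      unfolding regular_subspace
    proof
      fix x assume x: "x \<in> {x \<in> U. f x \<noteq> 0}"
      with * obtain W g where W: "openin (top_of X) W" "x \<in> W" "regular X W g" "\<forall>y\<in>W. g y \<noteq> 0"
        "\<forall>y\<in>W \<inter> U. f y = g y" by blast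
      have "regular X W (\<lambda>x. inverse (g x))"
        using W by (intro regular_inverse[OF X]) auto
      then show "\<exists>W g. openin (top_of X) W \<and> x \<in> W \<and> regular X W g \<and>
          (\<forall>y\<in>W \<inter> {x \<in> U. f x \<noteq> 0}. inverse (f y) = g y)"
        using W by (intro exI[of _ W] exI[of _ "\<lambda>x. inverse (g x)"]) auto
    qed
  qed
qed

text \<open>Pulling back along \<open>\<phi>\<close> and then along its inverse changes a function at most outside of \<open>V\<close>, which a
  sheaf of functions does not notice.\<close>

lemma regular_iso:
  assumes "morphism X Y \<phi>" "morphism Y X \<psi>"
    "\<forall>y\<in>points Y. \<phi> (\<psi> y) = y"
    and Y: "is_function_sheaf Y" and V: "openin (top_of Y) V"
  shows "regular Y V g \<longleftrightarrow> regular X {x \<in> points X. \<phi> x \<in> V} (g \<circ> \<phi>)"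
proof
  assume "regular Y V g"
  then show "regular X {x \<in> points X. \<phi> x \<in> V} (g \<circ> \<phi>)"
    by (rule morphism_regular[OF assms(1) V])
next
  assume g: "regular X {x \<in> points X. \<phi> x \<in> V} (g \<circ> \<phi>)"
  have "regular Y {y \<in> points Y. \<psi> y \<in> {x \<in> points X. \<phi> x \<in> V}} ((g \<circ> \<phi>) \<circ> \<psi>)"
    by (rule morphism_regular[OF assms(2) morphism_openin[OF assms(1) V] g])
  moreover have "{y \<in> points Y. \<psi> y \<in> {x \<in> points X. \<phi> x \<in> V}} = V"
    using assms(3) openin_subset[OF V] morphism_points[OF assms(2)] by auto
  ultimately have "regular Y V ((g \<circ> \<phi>) \<circ> \<psi>)" by simp
  then show "regular Y V g"
    by (rule sheaf_cong[OF Y V]) (use assms(3) openin_subset[OF V] in auto)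
qed

lemma ringed_iso:
  assumes X: "is_ringed X" and iso: "isomorphic X Y" and Y: "is_function_sheaf Y"
  shows "is_ringed Y"
proof -
  from iso obtain \<phi> \<psi> where m: "morphism X Y \<phi>" "morphism Y X \<psi>"
    "\<forall>y\<in>points Y. \<phi> (\<psi> y) = y"
    unfolding isomorphic_def by blast
  note reg = regular_iso[OF m Y]
  note op = morphism_openin[OF m(1)]
  show ?thesis
    unfolding is_ringed_def
  proof (intro conjI allI impI; (elim conjE)?)
    fix U c assume "openin (top_of Y) U"
    then show "regular Y U (\<lambda>_. to_ac c)"
      using regular_const[OF X op] by (simp add: reg comp_def)
  next
    fix U f g assume "openin (top_of Y) U" "regular Y U f" "regular Y U g"
    then show "regular Y U (\<lambda>x. f x + g x)" "regular Y U (\<lambda>x. f x * g x)"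
      using regular_add[OF X op] regular_mult[OF X op] by (simp_all add: reg comp_def)
  next
    fix U f assume U: "openin (top_of Y) U" and f: "regular Y U f"
    let ?V = "{x \<in> {x \<in> points X. \<phi> x \<in> U}. (f \<circ> \<phi>) x \<noteq> 0}"
    have f': "regular X {x \<in> points X. \<phi> x \<in> U} (f \<circ> \<phi>)"
      using f U reg by blast
    have V: "openin (top_of X) ?V"
      by (rule openin_nonzero[OF X op[OF U] f'])
    have eq: "{y \<in> points Y. \<psi> y \<in> ?V} = {x \<in> U. f x \<noteq> 0}"
      using m(3) morphism_points[OF m(2)] openin_subset[OF U] by auto
    show W: "openin (top_of Y) {x \<in> U. f x \<noteq> 0}"
      using morphism_openin[OF m(2) V] unfolding eq .
    have eq': "{x \<in> points X. \<phi> x \<in> {x \<in> U. f x \<noteq> 0}} = ?V" by auto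
    have "regular X {x \<in> points X. \<phi> x \<in> U} (f \<circ> \<phi>)"
      using f U reg by blast
    then have "regular X ?V (\<lambda>x. inverse ((f \<circ> \<phi>) x))"
      using X op[OF U] unfolding is_ringed_def by blast
    then show "regular Y {x \<in> U. f x \<noteq> 0} (\<lambda>x. inverse (f x))"
      unfolding reg[OF W] eq' by (simp add: comp_def)
  qed (rule Y)
qed

lemma regular_open_subspace:
  assumes Y: "is_function_sheaf Y" and U: "openin (top_of Y) U" and V: "openin (top_of Y) V" "V \<subseteq> U"
  shows "regular (subspace_of Y U) V f \<longleftrightarrow> regular Y V f"
proof
  assume "regular Y V f"
  then show "regular (subspace_of Y U) V f"
    unfolding regular_subspace using V(1) by blast
next
  assume f: "regular (subspace_of Y U) V f"
  show "regular Y V f"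
  proof (rule sheaf_local[OF Y])
    fix x assume x: "x \<in> V"
    then obtain W g where W: "openin (top_of Y) W" "x \<in> W" "regular Y W g" "\<forall>y\<in>W \<inter> V. f y = g y"
      using f unfolding regular_subspace by blast
    have o: "openin (top_of Y) (W \<inter> V)" using W V by blast
    then have "regular Y (W \<inter> V) g"
      by (rule sheaf_restrict[OF Y W(1,3)]) auto
    then show "\<exists>V' g. openin (top_of Y) V' \<and> x \<in> V' \<and> V' \<subseteq> V \<and> regular Y V' g \<and> (\<forall>y\<in>V'. f y = g y)"
      using o W x by (intro exI[of _ "W \<inter> V"] exI[of _ g]) auto
  qed
qed

text \<open>Regularity is local in a sheaf of functions, so the ring operations may be performed on the members
  of an open cover.\<close>

lemma ringed_cover:
  assumes Y: "is_function_sheaf Y"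
    and cover: "\<And>x. x \<in> points Y \<Longrightarrow> \<exists>U. openin (top_of Y) U \<and> x \<in> U \<and> is_ringed (subspace_of Y U)"
  shows "is_ringed Y"
proof -
  have nbhd: "\<exists>U V. openin (top_of Y) U \<and> is_ringed (subspace_of Y U) \<and> openin (top_of Y) V \<and> x \<in> V \<and>
      V \<subseteq> U \<and> V \<subseteq> O' \<and> openin (top_of (subspace_of Y U)) V" if O': "openin (top_of Y) O'" "x \<in> O'" for x O'
  proof -
    have "x \<in> points Y" using O' openin_subset by blast
    then obtain U where U: "openin (top_of Y) U" "x \<in> U" "is_ringed (subspace_of Y U)"
      using cover by blast
    have "openin (top_of Y) (O' \<inter> U)" using U O' by blast
    moreover have "openin (top_of (subspace_of Y U)) (O' \<inter> U)"
      using O' by (auto intro: openin_subtopology_Int)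
    ultimately show ?thesis
      using U O' by (intro exI[of _ U] exI[of _ "O' \<inter> U"]) auto
  qed
  show ?thesis
    unfolding is_ringed_def
  proof (intro conjI allI impI; (elim conjE)?)
    fix O' c assume O': "openin (top_of Y) O'"
    show "regular Y O' (\<lambda>_. to_ac c)"
    proof (rule sheaf_local[OF Y])
      fix x assume "x \<in> O'"
      with nbhd[OF O'] obtain U V where U: "openin (top_of Y) U" "is_ringed (subspace_of Y U)"
        "openin (top_of Y) V" "x \<in> V" "V \<subseteq> U" "V \<subseteq> O'" "openin (top_of (subspace_of Y U)) V" by blast
      then have "regular Y V (\<lambda>_. to_ac c)"
        using regular_const[OF U(2,7)] regular_open_subspace[OF Y U(1,3,5)] by blast
      with U show "\<exists>V g. openin (top_of Y) V \<and> x \<in> V \<and> V \<subseteq> O' \<and> regular Y V g \<and> (\<forall>y\<in>V. to_ac c = g y)"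
        by blast
    qed
  next
    fix O' f g assume O': "openin (top_of Y) O'" and f: "regular Y O' f" and g: "regular Y O' g"
    have *: "\<exists>V. openin (top_of Y) V \<and> x \<in> V \<and> V \<subseteq> O' \<and> regular Y V (\<lambda>x. f x + g x) \<and>
       regular Y V (\<lambda>x. f x * g x)" if "x \<in> O'" for x
    proof -
      from that nbhd[OF O'] obtain U V where U: "openin (top_of Y) U" "is_ringed (subspace_of Y U)"
        "openin (top_of Y) V" "x \<in> V" "V \<subseteq> U" "V \<subseteq> O'" "openin (top_of (subspace_of Y U)) V" by blast
      have "regular Y V f" "regular Y V g"
        using sheaf_restrict[OF Y O'] f g U by blast+
      then have "regular Y V (\<lambda>x. f x + g x)" "regular Y V (\<lambda>x. f x * g x)"
        using regular_add[OF U(2,7)] regular_mult[OF U(2,7)] regular_open_subspace[OF Y U(1,3,5)] by blast+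
      with U show ?thesis by blast
    qed
    show "regular Y O' (\<lambda>x. f x + g x)"
      by (rule sheaf_locally[OF Y]) (use * in blast)
    show "regular Y O' (\<lambda>x. f x * g x)"
      by (rule sheaf_locally[OF Y]) (use * in blast)
  next
    fix O' f assume O': "openin (top_of Y) O'" and f: "regular Y O' f"
    have *: "\<exists>V. openin (top_of Y) V \<and> x \<in> V \<and> V \<subseteq> {x \<in> O'. f x \<noteq> 0} \<and> regular Y V (\<lambda>x. inverse (f x))"
      if "x \<in> {x \<in> O'. f x \<noteq> 0}" for x
    proof -
      from that nbhd[OF O', of x] obtain U V where U: "openin (top_of Y) U" "is_ringed (subspace_of Y U)"
        "openin (top_of Y) V" "x \<in> V" "V \<subseteq> U" "V \<subseteq> O'" "openin (top_of (subspace_of Y U)) V" by blast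
      have "regular Y V f"
        using sheaf_restrict[OF Y O'] f U by blast
      then have "regular (subspace_of Y U) V f"
        using regular_open_subspace[OF Y U(1,3,5)] by blast
      then have 1: "openin (top_of (subspace_of Y U)) {x \<in> V. f x \<noteq> 0}"
        and 2: "regular (subspace_of Y U) {x \<in> V. f x \<noteq> 0} (\<lambda>x. inverse (f x))"
        using U(2,7) unfolding is_ringed_def by blast+
      have 3: "openin (top_of Y) {x \<in> V. f x \<noteq> 0}"
        using 1 U(1) by (auto dest: openin_trans_full)
      have "regular Y {x \<in> V. f x \<noteq> 0} (\<lambda>x. inverse (f x))"
        using 2 3 U(5) regular_open_subspace[OF Y U(1) 3] by blast
      with 3 that U show ?thesis by (intro exI[of _ "{x \<in> V. f x \<noteq> 0}"]) auto
    qed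
    show "openin (top_of Y) {x \<in> O'. f x \<noteq> 0}"
      unfolding openin_subopen[of _ "{x \<in> O'. f x \<noteq> 0}"] using * by blast
    show "regular Y {x \<in> O'. f x \<noteq> 0} (\<lambda>x. inverse (f x))"
      by (rule sheaf_locally[OF Y]) (rule *)
  qed (rule Y)
qed

text \<open>In affine as well as in projective space the regular functions are locally quotients \<open>a / b\<close> with
  \<open>(a, b)\<close> in a set \<open>D\<close> of admissible pairs: pairs of polynomials, respectively pairs of forms of
  equal degree. The calculus of fractions then gives all closure properties at once.\<close>

lemma ringed_fractions:
  fixes X :: "('p, 'k::field) fspace"
  assumes regular: "\<And>U f. openin (top_of X) U \<Longrightarrow> regular X U f \<longleftrightarrow> (\<forall>x\<in>U. \<exists>W a b.
      openin (top_of X) W \<and> x \<in> W \<and> (a, b) \<in> D \<and> (\<forall>y\<in>W \<inter> U. b y \<noteq> 0 \<and> f y = a y / b y))"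
    and const: "\<And>c. (\<lambda>_. to_ac c, \<lambda>_. 1) \<in> D"
    and add: "\<And>a b a' b'. (a, b) \<in> D \<Longrightarrow> (a', b') \<in> D \<Longrightarrow>
      (\<lambda>x. a x * b' x + a' x * b x, \<lambda>x. b x * b' x) \<in> D"
    and mult: "\<And>a b a' b'. (a, b) \<in> D \<Longrightarrow> (a', b') \<in> D \<Longrightarrow> (\<lambda>x. a x * a' x, \<lambda>x. b x * b' x) \<in> D"
    and swap: "\<And>a b. (a, b) \<in> D \<Longrightarrow> (b, a) \<in> D"
    and op: "\<And>a b. (a, b) \<in> D \<Longrightarrow> openin (top_of X) {x \<in> points X. a x \<noteq> 0}"
  shows "is_ringed X"
proof -
  have sheaf: "is_function_sheaf X"
    unfolding is_function_sheaf_def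
  proof (intro conjI allI impI; (elim conjE)?)
    fix U f g assume "openin (top_of X) U" "regular X U f" "\<forall>x\<in>U. f x = g x"
    then show "regular X U g" by (simp add: regular)
  next
    fix U V f
    assume U: "openin (top_of X) U" and V: "openin (top_of X) V" and VU: "V \<subseteq> U"
      and f: "regular X U f"
    show "regular X V f"
      unfolding regular[OF V]
    proof
      fix x assume "x \<in> V"
      then have "x \<in> U" using VU by blast
      then obtain W a b where "openin (top_of X) W" "x \<in> W" "(a, b) \<in> D"
        "\<forall>y\<in>W \<inter> U. b y \<noteq> 0 \<and> f y = a y / b y"
        using f unfolding regular[OF U] by blast
      then show "\<exists>W a b. openin (top_of X) W \<and> x \<in> W \<and> (a, b) \<in> D \<and>
          (\<forall>y\<in>W \<inter> V. b y \<noteq> 0 \<and> f y = a y / b y)"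
        using VU by (intro exI[of _ W] exI[of _ a] exI[of _ b]) auto
    qed
  next
    fix \<U> f assume *: "\<forall>U\<in>\<U>. openin (top_of X) U \<and> regular X U f"
    then have o: "openin (top_of X) (\<Union>\<U>)" by blast
    show "regular X (\<Union>\<U>) f"
      unfolding regular[OF o]
    proof
      fix x assume "x \<in> \<Union>\<U>"
      then obtain U where U: "U \<in> \<U>" "x \<in> U" by blast
      then have oU: "openin (top_of X) U" and fU: "regular X U f" using * by auto
      from fU U(2) obtain W a b where W: "openin (top_of X) W" "x \<in> W" "(a, b) \<in> D"
        "\<forall>y\<in>W \<inter> U. b y \<noteq> 0 \<and> f y = a y / b y" unfolding regular[OF oU] by blast
      have "openin (top_of X) (W \<inter> U)" using W oU by blast
      then show "\<exists>W a b. openin (top_of X) W \<and> x \<in> W \<and> (a, b) \<in> D \<and>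
          (\<forall>y\<in>W \<inter> \<Union>\<U>. b y \<noteq> 0 \<and> f y = a y / b y)"
        using W U by (intro exI[of _ "W \<inter> U"] exI[of _ a] exI[of _ b]) auto
    qed
  qed
  have two: "\<exists>W a b a' b'. openin (top_of X) W \<and> x \<in> W \<and> (a, b) \<in> D \<and> (a', b') \<in> D \<and>
      (\<forall>y\<in>W \<inter> U. b y \<noteq> 0 \<and> f y = a y / b y \<and> b' y \<noteq> 0 \<and> g y = a' y / b' y)"
    if U: "openin (top_of X) U" "regular X U f" "regular X U g" "x \<in> U" for U f g x
  proof -
    from U(2,4) obtain W a b where W: "openin (top_of X) W" "x \<in> W" "(a, b) \<in> D"
        "\<forall>y\<in>W \<inter> U. b y \<noteq> 0 \<and> f y = a y / b y" unfolding regular[OF U(1)] by blast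
    from U(3,4) obtain W' a' b' where W': "openin (top_of X) W'" "x \<in> W'" "(a', b') \<in> D"
        "\<forall>y\<in>W' \<inter> U. b' y \<noteq> 0 \<and> g y = a' y / b' y" unfolding regular[OF U(1)] by blast
    have "openin (top_of X) (W \<inter> W')" using W W' by blast
    then show ?thesis using W W' 
      by (intro exI[of _ "W \<inter> W'"] exI[of _ a] exI[of _ b] exI[of _ a'] exI[of _ b']) auto
  qed
  show ?thesis
    unfolding is_ringed_def
  proof (intro conjI allI impI; (elim conjE)?)
    fix U c assume U: "openin (top_of X) U"
    then show "regular X U (\<lambda>_. to_ac c)"
      unfolding regular[OF U]
      by (intro ballI exI[of _ U] exI[of _ "\<lambda>_. to_ac c"] exI[of _ "\<lambda>_. 1"]) (auto simp: const)
  next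
    fix U f g assume U: "openin (top_of X) U" "regular X U f" "regular X U g"
    show "regular X U (\<lambda>x. f x + g x)"
      unfolding regular[OF U(1)]
    proof
      fix x assume x: "x \<in> U"
      from two[OF U x] obtain W a b a' b' where W: "openin (top_of X) W" "x \<in> W" "(a, b) \<in> D" "(a', b') \<in> D"
        "\<forall>y\<in>W \<inter> U. b y \<noteq> 0 \<and> f y = a y / b y \<and> b' y \<noteq> 0 \<and> g y = a' y / b' y" by blast
      show "\<exists>W a b. openin (top_of X) W \<and> x \<in> W \<and> (a, b) \<in> D \<and>
          (\<forall>y\<in>W \<inter> U. b y \<noteq> 0 \<and> f y + g y = a y / b y)"
        using W add[OF W(3,4)]
        by (intro exI[of _ W] exI[of _ "\<lambda>x. a x * b' x + a' x * b x"] exI[of _ "\<lambda>x. b x * b' x"])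
          (auto simp: add_frac_eq)
    qed
    show "regular X U (\<lambda>x. f x * g x)"
      unfolding regular[OF U(1)]
    proof
      fix x assume x: "x \<in> U"
      from two[OF U x] obtain W a b a' b' where W: "openin (top_of X) W" "x \<in> W" "(a, b) \<in> D" "(a', b') \<in> D"
        "\<forall>y\<in>W \<inter> U. b y \<noteq> 0 \<and> f y = a y / b y \<and> b' y \<noteq> 0 \<and> g y = a' y / b' y" by blast
      show "\<exists>W a b. openin (top_of X) W \<and> x \<in> W \<and> (a, b) \<in> D \<and>
          (\<forall>y\<in>W \<inter> U. b y \<noteq> 0 \<and> f y * g y = a y / b y)"
        using W mult[OF W(3,4)]
        by (intro exI[of _ W] exI[of _ "\<lambda>x. a x * a' x"] exI[of _ "\<lambda>x. b x * b' x"]) auto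
    qed
  next
    fix U f assume U: "openin (top_of X) U" and f: "regular X U f"
    have *: "\<exists>W a b. openin (top_of X) W \<and> x \<in> W \<and> W \<subseteq> U \<and> (a, b) \<in> D \<and>
        (\<forall>y\<in>W. a y \<noteq> 0 \<and> b y \<noteq> 0 \<and> f y = a y / b y)" if x: "x \<in> {x \<in> U. f x \<noteq> 0}" for x
    proof -
      from f x obtain W a b where W: "openin (top_of X) W" "x \<in> W" "(a, b) \<in> D"
        "\<forall>y\<in>W \<inter> U. b y \<noteq> 0 \<and> f y = a y / b y" unfolding regular[OF U] by blast
      have "openin (top_of X) (W \<inter> U \<inter> {x \<in> points X. a x \<noteq> 0})"
        using W U op[OF W(3)] by blast
      moreover have "x \<in> points X" using U openin_subset x by blast
      ultimately show ?thesis
        using W x by (intro exI[of _ "W \<inter> U \<inter> {x \<in> points X. a x \<noteq> 0}"] exI[of _ a] exI[of _ b]) auto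
    qed
    show V: "openin (top_of X) {x \<in> U. f x \<noteq> 0}"
      unfolding openin_subopen[of _ "{x \<in> U. f x \<noteq> 0}"]
    proof
      fix x assume "x \<in> {x \<in> U. f x \<noteq> 0}"
      from *[OF this] show "\<exists>T. openin (top_of X) T \<and> x \<in> T \<and> T \<subseteq> {x \<in> U. f x \<noteq> 0}"
        by fastforce
    qed
    show "regular X {x \<in> U. f x \<noteq> 0} (\<lambda>x. inverse (f x))"
      unfolding regular[OF V]
    proof
      fix x assume "x \<in> {x \<in> U. f x \<noteq> 0}"
      from *[OF this] obtain W a b where W: "openin (top_of X) W" "x \<in> W" "(a, b) \<in> D"
        "\<forall>y\<in>W. a y \<noteq> 0 \<and> b y \<noteq> 0 \<and> f y = a y / b y" by blast
      then show "\<exists>W a b. openin (top_of X) W \<and> x \<in> W \<and> (a, b) \<in> D \<and>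
          (\<forall>y\<in>W \<inter> {x \<in> U. f x \<noteq> 0}. b y \<noteq> 0 \<and> inverse (f y) = a y / b y)"
        using swap[OF W(3)] by (intro exI[of _ W] exI[of _ b] exI[of _ a]) auto
    qed
  qed (rule sheaf)
qed

section \<open>Loci in affine and projective space\<close>

subsection \<open>Affine space\<close>

lemma openin_affine_basic:
  "openin (affine_top I TYPE('k)) {x \<in> affine_points I. peval (p :: ('i, 'k::field) mpol) x \<noteq> 0}"
  unfolding affine_top_def by (rule topology_generated_by_Basis) blast

lemma topspace_affine_top [simp]: "topspace (affine_top I TYPE('k::field)) = affine_points I"
proof -
  have "affine_points I \<subseteq> \<Union>{{x \<in> affine_points I. peval p x \<noteq> 0} | p :: ('a, 'k) mpol. True}"
  proof
    fix x :: "'a \<Rightarrow> 'k alg_closure" assume "x \<in> affine_points I"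
    then have "x \<in> {x \<in> affine_points I. peval (1 :: ('a, 'k) mpol) x \<noteq> 0}" by simp
    then show "x \<in> \<Union>{{x \<in> affine_points I. peval p x \<noteq> 0} | p :: ('a, 'k) mpol. True}" by blast
  qed
  then show ?thesis
    unfolding affine_top_def topology_generated_by_topspace by blast
qed

lemma top_of_affine_space [simp]: "top_of (affine_space I :: (_, 'k::field) fspace) = affine_top I TYPE('k)"
  by (simp add: affine_space_def)

lemma regular_affine_space: "regular (affine_space I) U f \<longleftrightarrow>
    (\<forall>x\<in>U. \<exists>W (p :: ('i, 'k::field) mpol) q. openin (affine_top I TYPE('k)) W \<and> x \<in> W \<and>
      (\<forall>y\<in>W \<inter> U. peval q y \<noteq> 0 \<and> f y = peval p y / peval q y))"
  by (simp add: affine_space_def)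

lemma ringed_affine_space: "is_ringed (affine_space I :: (_, 'k::field) fspace)"
proof (rule ringed_fractions)
  let ?D = "{(\<lambda>x. peval (p :: ('a, 'k) mpol) x, \<lambda>x. peval (q :: ('a, 'k) mpol) x) | p q. True}"
  fix U and f :: "('a \<Rightarrow> 'k alg_closure) \<Rightarrow> 'k alg_closure"
  show "regular (affine_space I) U f \<longleftrightarrow> (\<forall>x\<in>U. \<exists>W a b. openin (top_of (affine_space I :: (_, 'k) fspace)) W \<and>
      x \<in> W \<and> (a, b) \<in> ?D \<and> (\<forall>y\<in>W \<inter> U. b y \<noteq> 0 \<and> f y = a y / b y))"
    unfolding regular_affine_space by fastforce
  fix c :: 'k
  show "(\<lambda>_. to_ac c, \<lambda>_. 1) \<in> ?D"
    by (rule CollectI, rule exI[of _ "Poly_Mapping.single 0 c"], rule exI[of _ 1]) simp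
  fix a b a' b' assume "(a, b) \<in> ?D"
  then obtain p q where 1: "a = (\<lambda>x. peval p x)" "b = (\<lambda>x. peval q x)" by blast
  show "(b, a) \<in> ?D" using 1 by blast
  show "openin (top_of (affine_space I :: (_, 'k) fspace)) {x \<in> points (affine_space I). a x \<noteq> 0}"
    using 1 by (simp add: openin_affine_basic)
  assume "(a', b') \<in> ?D"
  then obtain p' q' where 2: "a' = (\<lambda>x. peval p' x)" "b' = (\<lambda>x. peval q' x)" by blast
  show "(\<lambda>x. a x * b' x + a' x * b x, \<lambda>x. b x * b' x) \<in> ?D"
    by (rule CollectI, rule exI[of _ "p * q' + p' * q"], rule exI[of _ "q * q'"]) (simp add: 1 2)
  show "(\<lambda>x. a x * a' x, \<lambda>x. b x * b' x) \<in> ?D"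
    by (rule CollectI, rule exI[of _ "p * p'"], rule exI[of _ "q * q'"]) (simp add: 1 2)
qed

lemma regular_affine_peval:
  assumes "openin (affine_top I TYPE('k::field)) U"
  shows "regular (affine_space I) U (\<lambda>x. peval (p :: ('i, 'k) mpol) x)"
  unfolding regular_affine_space
  by (intro ballI, rule exI[of _ U], rule exI[of _ p], rule exI[of _ 1]) (use assms in auto)

lemma regular_affine_coordinate:
  assumes "openin (affine_top I TYPE('k::field)) U"
  shows "regular (affine_space I :: (_, 'k) fspace) U (\<lambda>x. x i)"
  using regular_affine_peval[OF assms, of "pvar i"] by simp

text \<open>Polynomials in the coordinates of \<open>v\<close> are regular on \<open>W\<close>, since the functions of \<open>W\<close> form rings;
  their zero sets are closed and their quotients are regular.\<close>

lemma morphism_into_affine: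
  fixes W :: "('w, 'k::field) fspace"
  assumes W: "is_ringed W"
    and v: "\<And>w. w \<in> points W \<Longrightarrow> v w \<in> affine_points I"
    and reg: "\<And>i. regular W (points W) (\<lambda>w. v w i)"
  shows "morphism W (affine_space I) v"
proof -
  note sheaf = ringed_sheaf[OF W]
  have regp: "regular W (points W) (\<lambda>w. peval p (v w))" for p :: "(_, 'k) mpol"
    by (rule regular_peval[OF W openin_topspace reg])
  have cont: "continuous_map (top_of W) (affine_top I TYPE('k)) v"
    unfolding affine_top_def
  proof (rule continuous_on_generated_topo)
    fix U assume "U \<in> {{x \<in> affine_points I. peval (p :: (_, 'k) mpol) x \<noteq> 0} | p. True}"
    then obtain p :: "(_, 'k) mpol" where U: "U = {x \<in> affine_points I. peval p x \<noteq> 0}" by blast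
    have "v -` U \<inter> points W = {w \<in> points W. peval p (v w) \<noteq> 0}"
      unfolding U using v by blast
    then show "openin (top_of W) (v -` U \<inter> points W)"
      using openin_nonzero[OF W openin_topspace regp[of p]] by simp
  next
    show "v ` points W \<subseteq> \<Union>{{x \<in> affine_points I. peval (p :: (_, 'k) mpol) x \<noteq> 0} | p. True}"
      using v topspace_affine_top[of I, where 'k = 'k]
      unfolding affine_top_def topology_generated_by_topspace by blast
  qed
  show ?thesis
    unfolding morphism_def
  proof (intro conjI allI impI; (elim conjE)?)
    show "continuous_map (top_of W) (top_of (affine_space I :: (_, 'k) fspace)) v"
      using cont by simp
    fix U f assume U: "openin (top_of (affine_space I :: (_, 'k) fspace)) U" and f: "regular (affine_space I) U f"
    let ?V = "{w \<in> points W. v w \<in> U}"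
    have V: "openin (top_of W) ?V"
      using openin_continuous_map_preimage[OF cont] U by simp
    show "regular W ?V (f \<circ> v)"
    proof (rule sheaf_local[OF sheaf])
      fix w assume w: "w \<in> ?V"
      with f obtain O' and p q :: "(_, 'k) mpol" where O': "openin (affine_top I TYPE('k)) O'" "v w \<in> O'"
        "\<forall>y\<in>O' \<inter> U. peval q y \<noteq> 0 \<and> f y = peval p y / peval q y"
        unfolding regular_affine_space by blast
      let ?O = "{w \<in> points W. v w \<in> O'} \<inter> ?V"
      have o: "openin (top_of W) ?O"
        by (rule openin_Int[OF openin_continuous_map_preimage[OF cont O'(1)] V])
      have regO: "regular W ?O (\<lambda>w. peval p (v w))" for p :: "(_, 'k) mpol"
        by (rule sheaf_restrict[OF sheaf openin_topspace regp o]) blast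
      have "regular W ?O (\<lambda>w. peval p (v w) * inverse (peval q (v w)))"
        by (intro regular_mult[OF W o] regular_inverse[OF W o] regO) (use O' in auto)
      then show "\<exists>V g. openin (top_of W) V \<and> w \<in> V \<and> V \<subseteq> ?V \<and> regular W V g \<and> (\<forall>y\<in>V. (f \<circ> v) y = g y)"
        using o O' w by (intro exI[of _ ?O] exI[of _ "\<lambda>w. peval p (v w) * inverse (peval q (v w))"])
          (auto simp: divide_inverse)
    qed
  qed
qed

subsection \<open>Projective space\<close>

definition line :: "('i \<Rightarrow> 'a::field) \<Rightarrow> ('i \<Rightarrow> 'a) set" where
  "line x = {y. \<exists>c. c \<noteq> 0 \<and> y = (\<lambda>i. c * x i)}"

lemma line_self: "x \<in> line x"
  unfolding line_def by (rule CollectI, rule exI[of _ 1]) simp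

lemma line_scale:
  assumes "c \<noteq> 0"
  shows "line (\<lambda>i. c * x i) = line x"
proof -
  have "y \<in> line x" if "y \<in> line (\<lambda>i. c * x i)" for y
  proof -
    from that obtain d where "d \<noteq> 0" "y = (\<lambda>i. d * (c * x i))" unfolding line_def by blast
    then show ?thesis
      unfolding line_def using assms by (intro CollectI exI[of _ "d * c"]) (auto simp: mult.assoc)
  qed
  moreover have "y \<in> line (\<lambda>i. c * x i)" if "y \<in> line x" for y
  proof -
    from that obtain d where "d \<noteq> 0" "y = (\<lambda>i. d * x i)" unfolding line_def by blast
    then show ?thesis
      unfolding line_def using assms by (intro CollectI exI[of _ "d / c"]) auto
  qed
  ultimately show ?thesis by blast
qed

lemma line_eq: "y \<in> line x \<Longrightarrow> line y = line x"
  using line_scale[of _ x] unfolding line_def[of x] by auto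

lemma proj_points_eq: "proj_points I = line ` (affine_points I - {\<lambda>_. 0})"
  unfolding proj_points_def quotient_def line_def by (auto simp: Image_def)

lemma line_in_proj: "x \<in> affine_points I \<Longrightarrow> x i \<noteq> 0 \<Longrightarrow> line x \<in> proj_points I"
  unfolding proj_points_eq by auto

lemma proj_pointE:
  assumes "L \<in> proj_points I"
  obtains x i where "x \<in> affine_points I" "L = line x" "x i \<noteq> 0" "i \<in> I"
proof -
  from assms obtain x where x: "x \<in> affine_points I" "x \<noteq> (\<lambda>_. 0)" "L = line x"
    unfolding proj_points_eq by auto
  then obtain i where "x i \<noteq> 0" by auto
  moreover from this have "i \<in> I" using x(1) by (auto simp: affine_points_def)
  ultimately show thesis using that x by blast
qed

lemma proj_point_eq_line:
  assumes "L \<in> proj_points I" "x \<in> L"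
  shows "L = line x" "x \<in> affine_points I" "\<exists>i. x i \<noteq> 0"
proof -
  from assms(1) obtain y i where y: "y \<in> affine_points I" "L = line y" "y i \<noteq> 0" "i \<in> I"
    by (rule proj_pointE)
  then have x: "x \<in> line y" using assms by simp
  then show "L = line x" using line_eq y by metis
  from x obtain c where "c \<noteq> 0" "x = (\<lambda>i. c * y i)" unfolding line_def by blast
  then show "x \<in> affine_points I" "\<exists>i. x i \<noteq> 0"
    using y by (auto simp: affine_points_def)
qed

lemma line_all_iff:
  assumes "homogeneous d p"
  shows "(\<forall>y\<in>line x. peval p y \<noteq> 0) \<longleftrightarrow> peval p x \<noteq> 0"
    and "(\<forall>y\<in>line x. peval p y = 0) \<longleftrightarrow> peval p x = 0"
proof -
  have *: "peval p y \<noteq> 0 \<longleftrightarrow> peval p x \<noteq> 0" if "y \<in> line x" for y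
    using that unfolding line_def by (auto simp: peval_scale[OF assms])
  show "(\<forall>y\<in>line x. peval p y \<noteq> 0) \<longleftrightarrow> peval p x \<noteq> 0"
    and "(\<forall>y\<in>line x. peval p y = 0) \<longleftrightarrow> peval p x = 0"
    using * line_self[of x] by blast+
qed

lemma openin_proj_basic:
  assumes "homogeneous d p"
  shows "openin (proj_top I TYPE('k)) {L \<in> proj_points I. \<forall>x\<in>L. peval (p :: ('i, 'k::field) mpol) x \<noteq> 0}"
  unfolding proj_top_def by (rule topology_generated_by_Basis) (use assms in blast)

lemma topspace_proj_top [simp]: "topspace (proj_top I TYPE('k::field)) = proj_points I"
proof -
  let ?B = "{{L \<in> proj_points I. \<forall>x\<in>L. peval p x \<noteq> 0} | p :: ('a, 'k) mpol. \<exists>d. homogeneous d p}"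
  have "{L \<in> proj_points I. \<forall>x\<in>L. peval (1 :: ('a, 'k) mpol) x \<noteq> 0} \<in> ?B"
    using homogeneous_1 by blast
  then have "proj_points I \<subseteq> \<Union>?B" by auto
  then show ?thesis
    unfolding proj_top_def topology_generated_by_topspace by blast
qed

lemma top_of_proj_space [simp]: "top_of (proj_space I :: (_, 'k::field) fspace) = proj_top I TYPE('k)"
  by (simp add: proj_space_def)

text \<open>Any vector of the line would do: what is built from it is homogeneous, or merely has to tell lines
  apart.\<close>

definition rep :: "'a set \<Rightarrow> 'a" where "rep L = (SOME x. x \<in> L)"

lemma rep_in: "L \<in> proj_points I \<Longrightarrow> rep L \<in> L"
  unfolding rep_def using line_self by (metis proj_pointE someI_ex)

lemma ratio_on_line:
  assumes "homogeneous d p" "homogeneous d q" "y \<in> line x"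
  shows "peval p y / peval q y = peval p x / peval q x"
  using assms(3) unfolding line_def
  by (auto simp: peval_scale[OF assms(1)] peval_scale[OF assms(2)])

lemma regular_proj_space: "regular (proj_space I) U f \<longleftrightarrow>
    (\<forall>L\<in>U. \<exists>W d (p :: ('i, 'k::field) mpol) q. openin (proj_top I TYPE('k)) W \<and> L \<in> W \<and>
      homogeneous d p \<and> homogeneous d q \<and>
      (\<forall>M\<in>W \<inter> U. \<forall>y\<in>M. peval q y \<noteq> 0 \<and> f M = peval p y / peval q y))"
  by (simp add: proj_space_def)

lemma ringed_proj_space: "is_ringed (proj_space I :: (('i \<Rightarrow> _) set, 'k::field) fspace)"
proof (rule ringed_fractions)
  let ?D = "{(\<lambda>L. peval (p :: ('i, 'k) mpol) (rep L), \<lambda>L. peval (q :: ('i, 'k) mpol) (rep L)) | p q.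
    \<exists>d. homogeneous d p \<and> homogeneous d q}"
  fix U and f :: "('i \<Rightarrow> 'k alg_closure) set \<Rightarrow> 'k alg_closure"
  assume U: "openin (top_of (proj_space I :: (_, 'k) fspace)) U"
  have *: "(\<forall>y\<in>M. peval q y \<noteq> 0 \<and> f M = peval p y / peval q y) \<longleftrightarrow>
      peval q (rep M) \<noteq> 0 \<and> f M = peval p (rep M) / peval q (rep M)"
    if M: "M \<in> U" and hom: "homogeneous d p" "homogeneous d q" for M d and p q :: "('i, 'k) mpol"
  proof -
    have "M \<in> proj_points I" using openin_subset[OF U] M by auto
    then have r: "rep M \<in> M" "M = line (rep M)"
      using rep_in proj_point_eq_line by blast+
    have nz: "peval q y \<noteq> 0 \<longleftrightarrow> peval q (rep M) \<noteq> 0" if "y \<in> M" for y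
    proof -
      have "y \<in> line (rep M)" using that r(2) by blast
      then show ?thesis unfolding line_def by (auto simp: peval_scale[OF hom(2)])
    qed
    have eq: "peval p y / peval q y = peval p (rep M) / peval q (rep M)" if "y \<in> M" for y
      using ratio_on_line[OF hom] that r(2) by blast
    show ?thesis
    proof
      assume "\<forall>y\<in>M. peval q y \<noteq> 0 \<and> f M = peval p y / peval q y"
      from bspec[OF this r(1)] show "peval q (rep M) \<noteq> 0 \<and> f M = peval p (rep M) / peval q (rep M)" .
    next
      assume c: "peval q (rep M) \<noteq> 0 \<and> f M = peval p (rep M) / peval q (rep M)"
      show "\<forall>y\<in>M. peval q y \<noteq> 0 \<and> f M = peval p y / peval q y"
      proof
        fix y assume "y \<in> M"
        from nz[OF this] eq[OF this] c show "peval q y \<noteq> 0 \<and> f M = peval p y / peval q y" by simp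
      qed
    qed
  qed
  show "regular (proj_space I) U f \<longleftrightarrow> (\<forall>x\<in>U. \<exists>W a b. openin (top_of (proj_space I :: (_, 'k) fspace)) W \<and>
      x \<in> W \<and> (a, b) \<in> ?D \<and> (\<forall>y\<in>W \<inter> U. b y \<noteq> 0 \<and> f y = a y / b y))"
  proof
    assume r: "regular (proj_space I) U f"
    show "\<forall>x\<in>U. \<exists>W a b. openin (top_of (proj_space I :: (_, 'k) fspace)) W \<and>
      x \<in> W \<and> (a, b) \<in> ?D \<and> (\<forall>y\<in>W \<inter> U. b y \<noteq> 0 \<and> f y = a y / b y)"
    proof
      fix x assume "x \<in> U"
      from bspec[OF r[unfolded regular_proj_space] this]
      obtain W d and p q :: "('i, 'k) mpol" where W: "openin (proj_top I TYPE('k)) W" "x \<in> W"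
        "homogeneous d p" "homogeneous d q"
        "\<forall>M\<in>W \<inter> U. \<forall>y\<in>M. peval q y \<noteq> 0 \<and> f M = peval p y / peval q y"
        by (elim exE conjE)
      show "\<exists>W a b. openin (top_of (proj_space I :: (_, 'k) fspace)) W \<and>
        x \<in> W \<and> (a, b) \<in> ?D \<and> (\<forall>y\<in>W \<inter> U. b y \<noteq> 0 \<and> f y = a y / b y)"
        using W(5) *[OF _ W(3,4)]
        by (intro exI[of _ W] exI[of _ "\<lambda>L. peval p (rep L)"] exI[of _ "\<lambda>L. peval q (rep L)"])
          (use W in auto)
    qed
  next
    assume r: "\<forall>x\<in>U. \<exists>W a b. openin (top_of (proj_space I :: (_, 'k) fspace)) W \<and>
      x \<in> W \<and> (a, b) \<in> ?D \<and> (\<forall>y\<in>W \<inter> U. b y \<noteq> 0 \<and> f y = a y / b y)"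
    have "\<exists>W d (p :: ('i, 'k) mpol) q. openin (proj_top I TYPE('k)) W \<and> x \<in> W \<and>
        homogeneous d p \<and> homogeneous d q \<and>
        (\<forall>M\<in>W \<inter> U. \<forall>y\<in>M. peval q y \<noteq> 0 \<and> f M = peval p y / peval q y)" if x: "x \<in> U" for x
    proof -
      from bspec[OF r x]
      obtain W a b where W: "openin (top_of (proj_space I :: (_, 'k) fspace)) W" "x \<in> W" "(a, b) \<in> ?D"
        "\<forall>y\<in>W \<inter> U. b y \<noteq> 0 \<and> f y = a y / b y" by (elim exE conjE)
      from W(3) obtain p q :: "('i, 'k) mpol" and d where p: "a = (\<lambda>L. peval p (rep L))"
        "b = (\<lambda>L. peval q (rep L))" "homogeneous d p" "homogeneous d q" by blast
      have "\<forall>M\<in>W \<inter> U. \<forall>y\<in>M. peval q y \<noteq> 0 \<and> f M = peval p y / peval q y"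
      proof
        fix M assume "M \<in> W \<inter> U"
        with W(4) have "peval q (rep M) \<noteq> 0 \<and> f M = peval p (rep M) / peval q (rep M)" and "M \<in> U"
          unfolding p(1,2) by auto
        with *[OF _ p(3,4)] show "\<forall>y\<in>M. peval q y \<noteq> 0 \<and> f M = peval p y / peval q y" by blast
      qed
      then show ?thesis using W(1,2) p(3,4) unfolding top_of_proj_space by blast
    qed
    then show "regular (proj_space I) U f" unfolding regular_proj_space by blast
  qed
next
  let ?D = "{(\<lambda>L. peval (p :: ('i, 'k) mpol) (rep L), \<lambda>L. peval (q :: ('i, 'k) mpol) (rep L)) | p q.
    \<exists>d. homogeneous d p \<and> homogeneous d q}"
  fix c :: 'k
  show "(\<lambda>_. to_ac c, \<lambda>_. 1) \<in> ?D"
    by (rule CollectI, rule exI[of _ "Poly_Mapping.single 0 c"], rule exI[of _ 1])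
      (auto intro!: exI[of _ 0] homogeneous_const)
  fix a b a' b' assume "(a, b) \<in> ?D"
  then obtain p q :: "('i, 'k) mpol" and d where 1: "a = (\<lambda>L. peval p (rep L))" "b = (\<lambda>L. peval q (rep L))"
    "homogeneous d p" "homogeneous d q" by blast
  show "(b, a) \<in> ?D" using 1 by blast
  have "{L \<in> proj_points I. \<forall>x\<in>L. peval p x \<noteq> 0} = {L \<in> proj_points I. peval p (rep L) \<noteq> 0}"
    using line_all_iff(1)[OF 1(3)] rep_in proj_point_eq_line(1) by (metis (no_types, lifting))
  then show "openin (top_of (proj_space I :: (_, 'k) fspace)) {x \<in> points (proj_space I). a x \<noteq> 0}"
    using openin_proj_basic[OF 1(3), of I] by (simp add: 1)
  assume "(a', b') \<in> ?D"
  then obtain p' q' :: "('i, 'k) mpol" and d' where 2: "a' = (\<lambda>L. peval p' (rep L))" "b' = (\<lambda>L. peval q' (rep L))"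
    "homogeneous d' p'" "homogeneous d' q'" by blast
  have h: "homogeneous (d + d') (p * q' + p' * q)" "homogeneous (d + d') (q * q')" "homogeneous (d + d') (p * p')"
    using homogeneous_mult[OF 1(3) 2(4)] homogeneous_mult[OF 2(3) 1(4)] homogeneous_mult[OF 1(4) 2(4)]
      homogeneous_mult[OF 1(3) 2(3)] homogeneous_add by (auto simp: add.commute)
  show "(\<lambda>x. a x * b' x + a' x * b x, \<lambda>x. b x * b' x) \<in> ?D"
    by (rule CollectI, rule exI[of _ "p * q' + p' * q"], rule exI[of _ "q * q'"]) (use h 1 2 in auto)
  show "(\<lambda>x. a x * a' x, \<lambda>x. b x * b' x) \<in> ?D"
    by (rule CollectI, rule exI[of _ "p * p'"], rule exI[of _ "q * q'"]) (use h 1 2 in auto)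
qed

text \<open>The coordinates of \<open>v\<close> serve as homogeneous coordinates of the morphism. The condition that they do
  not vanish simultaneously makes \<open>line (v w)\<close> a point.\<close>

lemma morphism_into_proj:
  fixes W :: "('w, 'k::field) fspace"
  assumes W: "is_ringed W"
    and v: "\<And>w. w \<in> points W \<Longrightarrow> v w \<in> affine_points I" "\<And>w. w \<in> points W \<Longrightarrow> \<exists>i. v w i \<noteq> 0"
    and reg: "\<And>i. regular W (points W) (\<lambda>w. v w i)"
  shows "morphism W (proj_space I) (\<lambda>w. line (v w))"
proof -
  note sheaf = ringed_sheaf[OF W]
  have regp: "regular W (points W) (\<lambda>w. peval p (v w))" for p :: "(_, 'k) mpol"
    by (rule regular_peval[OF W openin_topspace reg])
  have im: "line (v w) \<in> proj_points I" if "w \<in> points W" for w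
    using v(1)[OF that] v(2)[OF that] line_in_proj[of "v w" I] by auto
  have cont: "continuous_map (top_of W) (proj_top I TYPE('k)) (\<lambda>w. line (v w))"
    unfolding proj_top_def
  proof (rule continuous_on_generated_topo)
    fix U assume "U \<in> {{L \<in> proj_points I. \<forall>x\<in>L. peval (p :: (_, 'k) mpol) x \<noteq> 0} | p. \<exists>d. homogeneous d p}"
    then obtain d and p :: "(_, 'k) mpol" where U: "U = {L \<in> proj_points I. \<forall>x\<in>L. peval p x \<noteq> 0}"
      "homogeneous d p" by blast
    have "(\<lambda>w. line (v w)) -` U \<inter> points W = {w \<in> points W. peval p (v w) \<noteq> 0}"
      unfolding U(1) using im line_all_iff(1)[OF U(2)] by auto
    then show "openin (top_of W) ((\<lambda>w. line (v w)) -` U \<inter> points W)"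
      using openin_nonzero[OF W openin_topspace regp[of p]] by simp
  next
    show "(\<lambda>w. line (v w)) ` points W \<subseteq>
        \<Union>{{L \<in> proj_points I. \<forall>x\<in>L. peval (p :: (_, 'k) mpol) x \<noteq> 0} | p. \<exists>d. homogeneous d p}"
      using im topspace_proj_top[of I, where 'k = 'k]
      unfolding proj_top_def topology_generated_by_topspace by blast
  qed
  show ?thesis
    unfolding morphism_def
  proof (intro conjI allI impI; (elim conjE)?)
    show "continuous_map (top_of W) (top_of (proj_space I :: (_, 'k) fspace)) (\<lambda>w. line (v w))"
      using cont by simp
    fix U f assume U: "openin (top_of (proj_space I :: (_, 'k) fspace)) U" and f: "regular (proj_space I) U f"
    let ?V = "{w \<in> points W. line (v w) \<in> U}"
    have V: "openin (top_of W) ?V"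
      using openin_continuous_map_preimage[OF cont] U by simp
    show "regular W ?V (f \<circ> (\<lambda>w. line (v w)))"
    proof (rule sheaf_local[OF sheaf])
      fix w assume w: "w \<in> ?V"
      then have "line (v w) \<in> U" by blast
      from bspec[OF f[unfolded regular_proj_space] this]
      obtain O' d and p q :: "(_, 'k) mpol" where O': "openin (proj_top I TYPE('k)) O'" "line (v w) \<in> O'"
        "\<forall>M\<in>O' \<inter> U. \<forall>y\<in>M. peval q y \<noteq> 0 \<and> f M = peval p y / peval q y"
        by (elim exE conjE)
      let ?O = "{w \<in> points W. line (v w) \<in> O'} \<inter> ?V"
      have o: "openin (top_of W) ?O"
        by (rule openin_Int[OF openin_continuous_map_preimage[OF cont O'(1)] V])
      have regO: "regular W ?O (\<lambda>w. peval p (v w))" for p :: "(_, 'k) mpol"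
        by (rule sheaf_restrict[OF sheaf openin_topspace regp o]) blast
      have *: "peval q (v w) \<noteq> 0 \<and> f (line (v w)) = peval p (v w) / peval q (v w)" if "w \<in> ?O" for w
        using O'(3) that line_self[of "v w"] by blast
      have "regular W ?O (\<lambda>w. peval p (v w) * inverse (peval q (v w)))"
        by (intro regular_mult[OF W o] regular_inverse[OF W o] regO) (use * in auto)
      then show "\<exists>V g. openin (top_of W) V \<and> w \<in> V \<and> V \<subseteq> ?V \<and> regular W V g \<and>
          (\<forall>y\<in>V. (f \<circ> (\<lambda>w. line (v w))) y = g y)"
        using o O' w * by (intro exI[of _ ?O] exI[of _ "\<lambda>w. peval p (v w) * inverse (peval q (v w))"])
          (auto simp: divide_inverse)
    qed
  qed
qed

definition ratio :: "'i \<Rightarrow> 'i \<Rightarrow> ('i \<Rightarrow> 'a::field) set \<Rightarrow> 'a" where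
  "ratio i k L = rep L k / rep L i"

lemma ratio_line: "ratio i k (line x) = x k / x i"
proof -
  have "rep (line x) \<in> line x"
    unfolding rep_def using line_self by (metis someI)
  then show ?thesis
    unfolding ratio_def line_def by auto
qed

definition chart :: "'i set \<Rightarrow> 'i \<Rightarrow> ('i \<Rightarrow> 'k::field alg_closure) set set" where
  "chart I i = {L \<in> proj_points I. \<forall>x\<in>L. x i \<noteq> 0}"

lemma openin_chart: "openin (proj_top I TYPE('k::field)) (chart I i)"
  using openin_proj_basic[OF homogeneous_pvar, of I i] by (simp add: chart_def)

lemma line_in_chart: "line x \<in> chart I i \<longleftrightarrow> line x \<in> proj_points I \<and> x i \<noteq> 0"
  unfolding chart_def using line_all_iff(1)[OF homogeneous_pvar, of x i] by auto

lemma regular_ratio: "regular (proj_space I :: (_, 'k::field) fspace) (chart I i) (ratio i k)"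
proof -
  have *: "peval (pvar i) y \<noteq> 0 \<and> ratio i k M = peval (pvar k) y / peval (pvar i) y"
    if "M \<in> chart I i" "y \<in> M" for M and y :: "_ \<Rightarrow> 'k alg_closure"
  proof -
    have "M = line y"
      using that proj_point_eq_line(1) unfolding chart_def by blast
    then show ?thesis using that ratio_line by (auto simp: chart_def)
  qed
  show ?thesis
    unfolding regular_proj_space
    by (intro ballI, rule exI[of _ "chart I i"], rule exI[of _ 1], rule exI[of _ "pvar k"],
        rule exI[of _ "pvar i"])
      (use openin_chart[of I i, where 'k = 'k] homogeneous_pvar[of k] homogeneous_pvar[of i] * in auto)
qed

subsection \<open>Separatedness\<close>

lemma affine_space_separated: "is_separated (affine_space I :: (_, 'k::field) fspace)"
  unfolding is_separated_def
proof (intro allI impI; elim conjE)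
  fix n :: nat and S and \<phi> \<psi> :: "(nat \<Rightarrow> 'k alg_closure) \<Rightarrow> 'a \<Rightarrow> 'k alg_closure"
  let ?W = "affine_zeros {..<n} S :: (_, 'k) fspace"
  assume \<phi>: "morphism ?W (affine_space I) \<phi>" and \<psi>: "morphism ?W (affine_space I) \<psi>"
  have W: "is_ringed ?W"
    unfolding affine_zeros_def by (intro ringed_subspace ringed_affine_space)
  have reg: "regular ?W (points ?W) (\<lambda>w. \<phi> w i)" if "morphism ?W (affine_space I) \<phi>" for \<phi> i
  proof -
    have "{w \<in> points ?W. \<phi> w \<in> affine_points I} = points ?W"
      using morphism_points[OF that] by auto
    then show ?thesis
      using morphism_regular[OF that _ regular_affine_coordinate, of "affine_points I" i]
        openin_topspace[of "affine_top I TYPE('k)"] by (simp add: comp_def)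
  qed
  have "openin (top_of ?W) {w \<in> points ?W. \<phi> w i - \<psi> w i \<noteq> 0}" for i
    by (intro openin_nonzero[OF W openin_topspace] regular_diff[OF W openin_topspace] reg \<phi> \<psi>)
  then have "openin (top_of ?W) (\<Union>i. {w \<in> points ?W. \<phi> w i - \<psi> w i \<noteq> 0})"
    by (intro openin_Union) auto
  moreover have "points ?W - {w \<in> points ?W. \<phi> w = \<psi> w} = (\<Union>i. {w \<in> points ?W. \<phi> w i - \<psi> w i \<noteq> 0})"
    by (auto simp: fun_eq_iff)
  ultimately show "closedin (top_of ?W) {w \<in> points ?W. \<phi> w = \<psi> w}"
    by (simp add: closedin_def)
qed

text \<open>On the open set where the \<open>i\<close>-th coordinate of \<open>\<phi>\<close> and the \<open>k\<close>-th coordinate of \<open>\<psi>\<close> do not vanish,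
  let \<open>a\<^sub>j\<close> and \<open>b\<^sub>j\<close> be the regular functions obtained by dividing the coordinates by these. The two
  lines agree if and only if \<open>b\<^sub>j = a\<^sub>j b\<^sub>i\<close> for all \<open>j\<close>, so they differ on an open set.\<close>

lemma proj_space_separated: "is_separated (proj_space I :: (_, 'k::field) fspace)"
  unfolding is_separated_def
proof (intro allI impI; elim conjE)
  fix n :: nat and S and \<phi> \<psi> :: "(nat \<Rightarrow> 'k alg_closure) \<Rightarrow> ('a \<Rightarrow> 'k alg_closure) set"
  let ?W = "affine_zeros {..<n} S :: (_, 'k) fspace"
  assume \<phi>: "morphism ?W (proj_space I) \<phi>" and \<psi>: "morphism ?W (proj_space I) \<psi>"
  have W: "is_ringed ?W"
    unfolding affine_zeros_def by (intro ringed_subspace ringed_affine_space)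
  have "openin (top_of ?W) (points ?W - {w \<in> points ?W. \<phi> w = \<psi> w})"
    unfolding openin_subopen[of _ "points ?W - {w \<in> points ?W. \<phi> w = \<psi> w}"]
  proof
    fix w assume "w \<in> points ?W - {w \<in> points ?W. \<phi> w = \<psi> w}"
    then have w: "w \<in> points ?W" "\<phi> w \<noteq> \<psi> w" by auto
    obtain x i where x: "x \<in> affine_points I" "\<phi> w = line x" "x i \<noteq> 0" "i \<in> I"
      using morphism_points[OF \<phi> w(1)] by (auto elim: proj_pointE)
    obtain y k where y: "y \<in> affine_points I" "\<psi> w = line y" "y k \<noteq> 0" "k \<in> I"
      using morphism_points[OF \<psi> w(1)] by (auto elim: proj_pointE)
    let ?U = "{w \<in> points ?W. \<phi> w \<in> chart I i} \<inter> {w \<in> points ?W. \<psi> w \<in> chart I k}"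
    have o1: "openin (top_of ?W) {w \<in> points ?W. \<phi> w \<in> chart I i}"
      by (rule morphism_openin[OF \<phi>]) (simp add: openin_chart)
    have o2: "openin (top_of ?W) {w \<in> points ?W. \<psi> w \<in> chart I k}"
      by (rule morphism_openin[OF \<psi>]) (simp add: openin_chart)
    have U: "openin (top_of ?W) ?U"
      by (rule openin_Int[OF o1 o2])
    have r1: "regular ?W ?U (\<lambda>w. ratio i j (\<phi> w))" for j
      using sheaf_restrict[OF ringed_sheaf[OF W] o1 _ U]
        morphism_regular[OF \<phi> _ regular_ratio[of I i j]] openin_chart[of I i, where 'k = 'k]
      by (simp add: comp_def)
    have r2: "regular ?W ?U (\<lambda>w. ratio k j (\<psi> w))" for j
      using sheaf_restrict[OF ringed_sheaf[OF W] o2 _ U]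
        morphism_regular[OF \<psi> _ regular_ratio[of I k j]] openin_chart[of I k, where 'k = 'k]
      by (simp add: comp_def)
    have "\<exists>j. ratio k j (\<psi> w) \<noteq> ratio i j (\<phi> w) * ratio k i (\<psi> w)"
    proof (rule ccontr)
      assume "\<not> (\<exists>j. ratio k j (\<psi> w) \<noteq> ratio i j (\<phi> w) * ratio k i (\<psi> w))"
      then have "y j / y k = x j / x i * (y i / y k)" for j
        unfolding x(2) y(2) ratio_line by blast
      then have *: "y j = (y i / x i) * x j" for j
        using x(3) y(3) by (simp add: field_simps)
      have "y i / x i \<noteq> 0"
      proof
        assume "y i / x i = 0"
        with *[of k] show False using y(3) by simp
      qed
      moreover have "y = (\<lambda>j. (y i / x i) * x j)" using * by blast
      ultimately have "line y = line x" using line_scale by metis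
      then show False using w x y by simp
    qed
    then obtain j where j: "ratio k j (\<psi> w) \<noteq> ratio i j (\<phi> w) * ratio k i (\<psi> w)" by blast
    let ?V = "{w \<in> ?U. ratio k j (\<psi> w) - ratio i j (\<phi> w) * ratio k i (\<psi> w) \<noteq> 0}"
    have "openin (top_of ?W) ?V"
      by (intro openin_nonzero[OF W U] regular_diff[OF W U] regular_mult[OF W U] r1 r2)
    moreover have "w \<in> ?V"
      using w j x y by (auto simp: line_in_chart line_in_proj)
    moreover have "?V \<subseteq> points ?W - {w \<in> points ?W. \<phi> w = \<psi> w}"
    proof
      fix u assume u: "u \<in> ?V"
      have "\<phi> u \<noteq> \<psi> u"
      proof
        assume eq: "\<phi> u = \<psi> u"
        have "\<phi> u \<in> proj_points I" using u unfolding chart_def by blast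
        then obtain z where z: "\<phi> u = line z" by (auto elim: proj_pointE)
        have "z i \<noteq> 0" using u z by (auto simp: line_in_chart)
        then have "ratio k j (\<psi> u) - ratio i j (\<phi> u) * ratio k i (\<psi> u) = 0"
          unfolding eq[symmetric] z ratio_line by simp
        then show False using u by simp
      qed
      then show "u \<in> points ?W - {w \<in> points ?W. \<phi> w = \<psi> w}" using u by blast
    qed
    ultimately show "\<exists>T. openin (top_of ?W) T \<and> w \<in> T \<and> T \<subseteq> points ?W - {w \<in> points ?W. \<phi> w = \<psi> w}"
      by blast
  qed
  then show "closedin (top_of ?W) {w \<in> points ?W. \<phi> w = \<psi> w}"
    by (simp add: closedin_def)
qed

lemma separated_subspace: "is_separated X \<Longrightarrow> is_separated (subspace_of X A)"
  unfolding is_separated_def using morphism_comp[OF _ morphism_inclusion] by blast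

subsection \<open>Varieties\<close>

lemma isomorphic_separated:
  fixes X :: "('p, 'k::field) fspace" and Y :: "('q, 'k) fspace"
  assumes iso: "isomorphic X Y" and X: "is_separated X"
  shows "is_separated Y"
  unfolding is_separated_def
proof (intro allI impI; elim conjE)
  fix n :: nat and S and \<phi> \<psi> :: "(nat \<Rightarrow> 'k alg_closure) \<Rightarrow> 'q"
  let ?W = "affine_zeros {..<n} S :: (_, 'k) fspace"
  assume m: "morphism ?W Y \<phi>" "morphism ?W Y \<psi>"
  from iso obtain \<alpha> \<beta> where i: "morphism X Y \<alpha>" "morphism Y X \<beta>" "\<forall>y\<in>points Y. \<alpha> (\<beta> y) = y"
    unfolding isomorphic_def by blast
  have c: "closedin (top_of ?W) {w \<in> points ?W. \<beta> (\<phi> w) = \<beta> (\<psi> w)}"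
    using X[unfolded is_separated_def, rule_format, OF conjI, OF morphism_comp[OF m(1) i(2)]
        morphism_comp[OF m(2) i(2)]] .
  have "\<beta> (\<phi> w) = \<beta> (\<psi> w) \<longleftrightarrow> \<phi> w = \<psi> w" if "w \<in> points ?W" for w
    using i(3) morphism_points[OF m(1) that] morphism_points[OF m(2) that] by metis
  then have "{w \<in> points ?W. \<beta> (\<phi> w) = \<beta> (\<psi> w)} = {w \<in> points ?W. \<phi> w = \<psi> w}"
    by blast
  with c show "closedin (top_of ?W) {w \<in> points ?W. \<phi> w = \<psi> w}"
    by simp
qed

lemma isomorphic_affine: "isomorphic X Y \<Longrightarrow> is_affine X \<Longrightarrow> is_affine Y"
  unfolding is_affine_def using isomorphic_trans[OF isomorphic_sym] by blast

text \<open>An isomorphism determines the regular functions of \<open>Y\<close> only up to their values outside of the open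
  set in question, hence the sheaf condition for \<open>Y\<close> has to be required.\<close>

lemma isomorphic_variety:
  assumes iso: "isomorphic X Y" and X: "is_variety X" and Y: "is_function_sheaf Y"
  shows "is_variety Y"
proof -
  from X obtain \<U> where U: "finite \<U>" "\<Union>\<U> = points X"
    "\<And>U. U \<in> \<U> \<Longrightarrow> openin (top_of X) U" "\<And>U. U \<in> \<U> \<Longrightarrow> is_affine (subspace_of X U)"
    unfolding is_variety_def by blast
  from iso obtain \<phi> \<psi> where m: "morphism X Y \<phi>" "morphism Y X \<psi>"
    "\<forall>x\<in>points X. \<psi> (\<phi> x) = x" "\<forall>y\<in>points Y. \<phi> (\<psi> y) = y"
    unfolding isomorphic_def by blast
  let ?V = "\<lambda>U. {y \<in> points Y. \<psi> y \<in> U}"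
  have "is_affine (subspace_of Y (?V U))" if "U \<in> \<U>" for U
  proof (rule isomorphic_affine[OF _ U(4)[OF that]])
    show "isomorphic (subspace_of X U) (subspace_of Y (?V U))"
      by (rule isomorphic_subspaceI[OF m(1,2)]) (use m morphism_points[OF m(1)] in auto)
  qed
  moreover have "openin (top_of Y) (?V U)" if "U \<in> \<U>" for U
    by (rule morphism_openin[OF m(2) U(3)[OF that]])
  moreover have "\<Union>(?V ` \<U>) = points Y"
    using U(2) morphism_points[OF m(2)] by blast
  ultimately show ?thesis
    unfolding is_variety_def using U(1) Y X isomorphic_separated[OF iso]
    by (intro conjI exI[of _ "?V ` \<U>"]) (auto simp: is_variety_def)
qed

lemma variety_sheaf: "is_variety X \<Longrightarrow> is_function_sheaf X"
  by (simp add: is_variety_def)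

lemma variety_ringed:
  fixes X :: "('p, 'k::field) fspace"
  assumes X: "is_variety X"
  shows "is_ringed X"
proof (rule ringed_cover[OF variety_sheaf[OF X]])
  fix x assume "x \<in> points X"
  then obtain U where U: "x \<in> U" "openin (top_of X) U" "is_affine (subspace_of X U)"
    using X unfolding is_variety_def by blast
  from U(3) obtain n :: nat and S :: "(nat, 'k) mpol set" where "isomorphic (subspace_of X U) (affine_zeros {..<n} S)"
    unfolding is_affine_def by blast
  from isomorphic_sym[OF this] have "is_ringed (subspace_of X U)"
    by (rule ringed_iso[rotated])
      (auto simp: affine_zeros_def intro: ringed_subspace ringed_affine_space
        is_function_sheaf_subspace variety_sheaf[OF X])
  with U(1,2) show "\<exists>U. openin (top_of X) U \<and> x \<in> U \<and> is_ringed (subspace_of X U)"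
    by (intro exI[of _ U]) simp
qed

text \<open>Generators of the Grothendieck ring have points in a fixed type. A variety is replaced by an
  isomorphic generator by renaming its points.\<close>

definition transport :: "('p \<Rightarrow> 'q) \<Rightarrow> ('p, 'k::field) fspace \<Rightarrow> ('q, 'k) fspace" where
  "transport h X = \<lparr>top_of = pullback_topology (h ` points X) (inv_into (points X) h) (top_of X),
     regular = (\<lambda>V f. regular X {x \<in> points X. h x \<in> V} (f \<circ> h))\<rparr>"

lemma openin_transport:
  assumes "inj_on h (points X)"
  shows "openin (top_of (transport h X)) V \<longleftrightarrow> V \<subseteq> h ` points X \<and> openin (top_of X) {x \<in> points X. h x \<in> V}"
proof
  assume "openin (top_of (transport h X)) V"
  then obtain U where U: "openin (top_of X) U" "V = inv_into (points X) h -` U \<inter> h ` points X"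
    by (auto simp: transport_def openin_pullback_topology)
  then have "{x \<in> points X. h x \<in> V} = U"
    using assms openin_subset[OF U(1)] by (auto dest: inj_onD)
  with U show "V \<subseteq> h ` points X \<and> openin (top_of X) {x \<in> points X. h x \<in> V}" by auto
next
  assume V: "V \<subseteq> h ` points X \<and> openin (top_of X) {x \<in> points X. h x \<in> V}"
  then have "V = inv_into (points X) h -` {x \<in> points X. h x \<in> V} \<inter> h ` points X"
    using assms by auto
  with V show "openin (top_of (transport h X)) V"
    by (auto simp: transport_def openin_pullback_topology)
qed

lemma points_transport: "inj_on h (points X) \<Longrightarrow> points (transport h X) = h ` points X"
  by (auto simp: transport_def topspace_pullback_topology)

lemma transport_isomorphic:
  assumes inj: "inj_on h (points X)" and X: "is_function_sheaf X"
  shows "isomorphic X (transport h X)" "is_function_sheaf (transport h X)"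
proof -
  let ?Y = "transport h X" and ?g = "inv_into (points X) h"
  have reg: "regular ?Y V f \<longleftrightarrow> regular X {x \<in> points X. h x \<in> V} (f \<circ> h)" for V f
    by (simp add: transport_def)
  have 1: "morphism X ?Y h"
    unfolding morphism_def
  proof (intro conjI allI impI; (elim conjE)?)
    show "continuous_map (top_of X) (top_of ?Y) h"
      unfolding continuous_map_def points_transport[OF inj] using openin_transport[OF inj] by auto
  qed (simp add: reg)
  have pre: "{x \<in> points X. h x \<in> {y \<in> points ?Y. ?g y \<in> U}} = U" if "openin (top_of X) U" for U
    using openin_subset[OF that] inj unfolding points_transport[OF inj] by (auto dest: inj_onD)
  have 2: "morphism ?Y X ?g"
    unfolding morphism_def
  proof (intro conjI allI impI; (elim conjE)?)
    show "continuous_map (top_of ?Y) (top_of X) ?g"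
      unfolding continuous_map_def
    proof (intro conjI allI impI)
      show "?g \<in> points ?Y \<rightarrow> points X"
        using inj by (auto simp: points_transport[OF inj])
      fix U assume "openin (top_of X) U"
      then show "openin (top_of ?Y) {y \<in> points ?Y. ?g y \<in> U}"
        unfolding openin_transport[OF inj] using pre[of U] by (auto simp: points_transport[OF inj])
    qed
    fix U f assume U: "openin (top_of X) U" "regular X U f"
    have "regular X U ((f \<circ> ?g) \<circ> h)"
      by (rule sheaf_cong[OF X U]) (use openin_subset[OF U(1)] inj in auto)
    then show "regular ?Y {y \<in> points ?Y. ?g y \<in> U} (f \<circ> ?g)"
      unfolding reg pre[OF U(1)] .
  qed
  show "isomorphic X ?Y"
    unfolding isomorphic_def using 1 2 inj
    by (intro exI[of _ h] exI[of _ ?g]) (auto simp: points_transport[OF inj])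
  show "is_function_sheaf ?Y"
    unfolding is_function_sheaf_def reg
  proof (intro conjI allI impI; (elim conjE)?)
    fix U and f g :: "'b \<Rightarrow> 'c alg_closure"
    assume U: "openin (top_of ?Y) U" and f: "regular X {x \<in> points X. h x \<in> U} (f \<circ> h)" and "\<forall>x\<in>U. f x = g x"
    then show "regular X {x \<in> points X. h x \<in> U} (g \<circ> h)"
      by (intro sheaf_cong[OF X _ f]) (auto simp: openin_transport[OF inj])
  next
    fix U V and f :: "'b \<Rightarrow> 'c alg_closure"
    assume U: "openin (top_of ?Y) U" and V: "openin (top_of ?Y) V" "V \<subseteq> U"
      and f: "regular X {x \<in> points X. h x \<in> U} (f \<circ> h)"
    show "regular X {x \<in> points X. h x \<in> V} (f \<circ> h)"
      by (rule sheaf_restrict[OF X _ f]) (use U V in \<open>auto simp: openin_transport[OF inj]\<close>)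
  next
    fix \<U> and f :: "'b \<Rightarrow> 'c alg_closure"
    assume *: "\<forall>U\<in>\<U>. openin (top_of ?Y) U \<and> regular X {x \<in> points X. h x \<in> U} (f \<circ> h)"
    have "regular X (\<Union>((\<lambda>U. {x \<in> points X. h x \<in> U}) ` \<U>)) (f \<circ> h)"
      by (rule sheaf_Union[OF X]) (use * in \<open>auto simp: openin_transport[OF inj]\<close>)
    moreover have "\<Union>((\<lambda>U. {x \<in> points X. h x \<in> U}) ` \<U>) = {x \<in> points X. h x \<in> \<Union>\<U>}" by auto
    ultimately show "regular X {x \<in> points X. h x \<in> \<Union>\<U>} (f \<circ> h)" by simp
  qed
qed

lemma subspace_cong: "points X \<inter> A = points X \<inter> B \<Longrightarrow> subspace_of X A = subspace_of X B"
  using subspace_restrict[of X A] subspace_restrict[of X B] by simp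

subsection \<open>Loci given by equations and one inequation\<close>

text \<open>All varieties in the proof are cut out of affine or projective space by equations and one
  inequation. This class is closed under cutting along a further hypersurface: the equation of the
  hypersurface joins \<open>S\<close> on the one part, and \<open>f\<close> gets multiplied by it on the other part.\<close>

definition on_locus :: "('i, 'k::field) mpol set \<Rightarrow> ('i, 'k) mpol \<Rightarrow> ('i \<Rightarrow> 'k alg_closure) \<Rightarrow> bool" where
  "on_locus S f x \<longleftrightarrow> (\<forall>p\<in>S. peval p x = 0) \<and> peval f x \<noteq> 0"

definition affine_locus :: "'i set \<Rightarrow> ('i, 'k::field) mpol set \<Rightarrow> ('i, 'k) mpol \<Rightarrow> ('i \<Rightarrow> 'k alg_closure, 'k) fspace" where
  "affine_locus I S f = subspace_of (affine_space I) {x. on_locus S f x}"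

definition proj_locus :: "'i set \<Rightarrow> ('i, 'k::field) mpol set \<Rightarrow> ('i, 'k) mpol \<Rightarrow> (('i \<Rightarrow> 'k alg_closure) set, 'k) fspace" where
  "proj_locus I S f = subspace_of (proj_space I) {L. \<forall>x\<in>L. on_locus S f x}"

lemma points_affine_locus: "points (affine_locus I S f) = {x \<in> affine_points I. on_locus S f x}"
  by (auto simp: affine_locus_def points_subspace topspace_subtopology)

lemma points_proj_locus: "points (proj_locus I S f) = {L \<in> proj_points I. \<forall>x\<in>L. on_locus S f x}"
  by (auto simp: proj_locus_def points_subspace topspace_subtopology)

definition all_homogeneous :: "('i, 'k::field) mpol set \<Rightarrow> bool" where
  "all_homogeneous S \<longleftrightarrow> (\<forall>p\<in>S. \<exists>d. homogeneous d p)"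

lemma on_locus_line:
  assumes "all_homogeneous S" "all_homogeneous {f}"
  shows "(\<forall>y\<in>line x. on_locus S f y) \<longleftrightarrow> on_locus S f x"
proof -
  have "on_locus S f y \<longleftrightarrow> on_locus S f x" if "y \<in> line x" for y
  proof -
    from that obtain c where c: "c \<noteq> 0" "y = (\<lambda>i. c * x i)" unfolding line_def by blast
    have "peval p y = 0 \<longleftrightarrow> peval p x = 0" if "p \<in> S \<union> {f}" for p
    proof -
      from that assms obtain d where "homogeneous d p" unfolding all_homogeneous_def by blast
      then show ?thesis using c by (simp add: peval_scale)
    qed
    then show ?thesis unfolding on_locus_def by auto
  qed
  then show ?thesis using line_self by blast
qed

lemma proj_locusE:
  assumes "L \<in> points (proj_locus I S f)"
  obtains x i where "x \<in> affine_points I" "L = line x" "x i \<noteq> 0" "i \<in> I" "on_locus S f x"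
proof -
  from assms have "L \<in> proj_points I" "\<forall>x\<in>L. on_locus S f x"
    by (auto simp: points_proj_locus)
  then show thesis
    using that proj_pointE line_self by metis
qed

lemma ringed_affine_locus: "is_ringed (affine_locus I S f)"
  unfolding affine_locus_def by (intro ringed_subspace ringed_affine_space)

lemma ringed_proj_locus: "is_ringed (proj_locus I S f)"
  unfolding proj_locus_def by (intro ringed_subspace ringed_proj_space)

lemma regular_affine_locus_coordinate:
  fixes S :: "('i, 'k::field) mpol set"
  shows "regular (affine_locus I S f) (points (affine_locus I S f)) (\<lambda>x. x i)"
proof -
  have m: "morphism (affine_locus I S f) (affine_space I) (\<lambda>x. x)"
    unfolding affine_locus_def by (rule morphism_inclusion)
  have "{w \<in> points (affine_locus I S f). w \<in> affine_points I} = points (affine_locus I S f)"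
    by (auto simp: points_affine_locus)
  then show ?thesis
    using morphism_regular[OF m _ regular_affine_coordinate, of "affine_points I" i]
      openin_topspace[of "affine_top I TYPE('k)"] by (simp add: comp_def)
qed

lemma morphism_into_affine_locus:
  fixes W :: "('w, 'k::field) fspace"
  assumes W: "is_ringed W"
    and v: "\<And>w. w \<in> points W \<Longrightarrow> v w \<in> affine_points I" "\<And>w. w \<in> points W \<Longrightarrow> on_locus S f (v w)"
    and reg: "\<And>i. regular W (points W) (\<lambda>w. v w i)"
  shows "morphism W (affine_locus I S f) v"
  unfolding affine_locus_def
  by (rule morphism_into_subspace[OF morphism_into_affine[OF W v(1) reg] ringed_sheaf[OF W]])
    (use v in auto)

lemma morphism_into_proj_locus:
  fixes W :: "('w, 'k::field) fspace"
  assumes W: "is_ringed W" and hom: "all_homogeneous S" "all_homogeneous {f}"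
    and v: "\<And>w. w \<in> points W \<Longrightarrow> v w \<in> affine_points I" "\<And>w. w \<in> points W \<Longrightarrow> \<exists>i. v w i \<noteq> 0"
      "\<And>w. w \<in> points W \<Longrightarrow> on_locus S f (v w)"
    and reg: "\<And>i. regular W (points W) (\<lambda>w. v w i)"
  shows "morphism W (proj_locus I S f) (\<lambda>w. line (v w))"
  unfolding proj_locus_def
  by (rule morphism_into_subspace[OF morphism_into_proj[OF W v(1,2) reg] ringed_sheaf[OF W]])
    (use v on_locus_line[OF hom] in auto)

lemma on_locus_insert: "on_locus (insert g S) f x \<longleftrightarrow> peval g x = 0 \<and> on_locus S f x"
  by (auto simp: on_locus_def)

lemma on_locus_mult: "on_locus S (f * g) x \<longleftrightarrow> peval g x \<noteq> 0 \<and> on_locus S f x"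
  by (auto simp: on_locus_def)

lemma all_homogeneous_mult: "all_homogeneous {f} \<Longrightarrow> all_homogeneous {g} \<Longrightarrow> all_homogeneous {f * g}"
  unfolding all_homogeneous_def using homogeneous_mult by blast

lemma all_homogeneous_pvar [simp]: "all_homogeneous {pvar i}"
  unfolding all_homogeneous_def by (metis homogeneous_pvar singletonD)

lemma all_homogeneous_insert: "all_homogeneous (insert p S) \<longleftrightarrow> all_homogeneous {p} \<and> all_homogeneous S"
  unfolding all_homogeneous_def by blast

text \<open>The trick of Rabinowitsch: an additional coordinate \<open>z\<close> with \<open>z f = 1\<close> turns the inequation into an
  equation.\<close>

lemma is_affine_affine_locus:
  fixes S :: "('i, 'k::field) mpol set"
  assumes "finite I"
  shows "is_affine (affine_locus I S f)"
proof -
  \<comment> \<open>The coordinates in \<open>I\<close> are renumbered by \<open>h\<close>; the additional coordinate has number \<open>n\<close>.\<close>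
  define n where "n = card I"
  obtain h where h: "bij_betw h I {..<n}"
    using ex_bij_betw_finite_nat[OF assms] unfolding n_def atLeast0LessThan by blast
  define g where "g = inv_into I h"
  have hg: "h i < n" "g (h i) = i" if "i \<in> I" for i
    using that h unfolding g_def bij_betw_def by (auto simp: inv_into_f_f)
  have gh: "g m \<in> I" "h (g m) = m" if "m < n" for m
    using that h unfolding g_def bij_betw_def by (auto intro: inv_into_into simp: f_inv_into_f)
  define \<rho> :: "'i \<Rightarrow> (nat, 'k) mpol" where "\<rho> i = (if i \<in> I then pvar (h i) else 0)" for i
  define S' where "S' = insert (pvar n * psubst \<rho> f - 1) (psubst \<rho> ` S)"
  define \<phi> :: "('i \<Rightarrow> 'k alg_closure) \<Rightarrow> nat \<Rightarrow> 'k alg_closure"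
    where "\<phi> x m = (if m < n then x (g m) else if m = n then inverse (peval f x) else 0)" for x m
  define \<psi> :: "(nat \<Rightarrow> 'k alg_closure) \<Rightarrow> 'i \<Rightarrow> 'k alg_closure"
    where "\<psi> z i = (if i \<in> I then z (h i) else 0)" for z i
  have \<psi>_eq: "(\<lambda>i. peval (\<rho> i) z) = \<psi> z" for z
    by (auto simp: \<rho>_def \<psi>_def)
  have \<psi>\<phi>: "\<psi> (\<phi> x) = x" if "x \<in> affine_points I" for x
    using that hg by (auto simp: \<psi>_def \<phi>_def affine_points_def)
  have zeros: "affine_zeros {..<Suc n} S' = affine_locus {..<Suc n} S' 1"
    by (simp add: affine_zeros_def affine_locus_def on_locus_def)
  have Z: "on_locus S' 1 z \<longleftrightarrow> on_locus S f (\<psi> z) \<and> z n * peval f (\<psi> z) = 1" for z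
    by (auto simp: S'_def on_locus_def peval_psubst \<psi>_eq)
  let ?X = "affine_locus I S f" and ?Z = "affine_locus {..<Suc n} S' 1"
  have X: "is_ringed ?X" and ZZ: "is_ringed ?Z" by (rule ringed_affine_locus)+
  have "morphism ?X ?Z \<phi>"
  proof (rule morphism_into_affine_locus[OF X])
    fix x assume "x \<in> points ?X"
    then have x: "x \<in> affine_points I" "on_locus S f x" by (auto simp: points_affine_locus)
    show "\<phi> x \<in> affine_points {..<Suc n}"
      by (auto simp: affine_points_def \<phi>_def)
    show "on_locus S' 1 (\<phi> x)"
      unfolding Z \<psi>\<phi>[OF x(1)] using x(2) by (auto simp: \<phi>_def on_locus_def)
  next
    fix m
    have f: "regular ?X (points ?X) (\<lambda>x. inverse (peval f x))"
      by (intro regular_inverse[OF X openin_topspace] regular_peval[OF X openin_topspace]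
          regular_affine_locus_coordinate) (auto simp: points_affine_locus on_locus_def)
    show "regular ?X (points ?X) (\<lambda>x. \<phi> x m)"
    proof -
      consider "m < n" | "m = n" | "m > n" by linarith
      then show ?thesis
        unfolding \<phi>_def
        by cases (simp_all add: f regular_affine_locus_coordinate regular_0[OF X openin_topspace])
    qed
  qed
  moreover have "morphism ?Z ?X \<psi>"
  proof (rule morphism_into_affine_locus[OF ZZ])
    fix z assume "z \<in> points ?Z"
    then show "\<psi> z \<in> affine_points I" "on_locus S f (\<psi> z)"
      using Z by (auto simp: points_affine_locus affine_points_def \<psi>_def)
  next
    fix i
    show "regular ?Z (points ?Z) (\<lambda>z. \<psi> z i)"
      unfolding \<psi>_def
      by (cases "i \<in> I") (simp_all add: regular_affine_locus_coordinate regular_0[OF ZZ openin_topspace])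
  qed
  moreover have "\<phi> (\<psi> z) = z" if "z \<in> points ?Z" for z
  proof
    fix m
    from that have z: "\<forall>m. m \<ge> Suc n \<longrightarrow> z m = 0" "z n * peval f (\<psi> z) = 1"
      using Z by (auto simp: points_affine_locus affine_points_def)
    have "z n = inverse (peval f (\<psi> z))"
      using z(2) by (metis inverse_unique mult.commute)
    then show "\<phi> (\<psi> z) m = z m"
      using z(1) gh[of m] by (auto simp: \<phi>_def \<psi>_def not_less_eq_eq)
  qed
  ultimately have "isomorphic ?X ?Z"
    unfolding isomorphic_def using \<psi>\<phi>
    by (intro exI[of _ \<phi>] exI[of _ \<psi>]) (auto simp: points_affine_locus)
  then show ?thesis
    unfolding is_affine_def zeros[symmetric] by blast
qed

lemma is_variety_affine_locus:
  fixes S :: "('i, 'k::field) mpol set"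
  assumes "finite I"
  shows "is_variety (affine_locus I S f)"
proof -
  let ?X = "affine_locus I S f"
  have "isomorphic ?X (subspace_of ?X (points ?X))"
    unfolding isomorphic_def
  proof (intro exI conjI)
    show "morphism ?X (subspace_of ?X (points ?X)) (\<lambda>x. x)"
      by (intro morphism_into_subspace morphism_id ringed_sheaf ringed_affine_locus)
    show "morphism (subspace_of ?X (points ?X)) ?X (\<lambda>x. x)"
      by (rule morphism_inclusion)
  qed auto
  then have "is_affine (subspace_of ?X (points ?X))"
    by (rule isomorphic_affine) (rule is_affine_affine_locus[OF assms])
  moreover have "is_separated ?X"
    unfolding affine_locus_def by (intro separated_subspace affine_space_separated)
  ultimately show ?thesis
    unfolding is_variety_def using ringed_sheaf[OF ringed_affine_locus]
    by (intro conjI exI[of _ "{points ?X}"]) auto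
qed

lemma regular_proj_locus_ratio:
  fixes S :: "('i, 'k::field) mpol set"
  assumes "\<And>L. L \<in> points (proj_locus I S f) \<Longrightarrow> L \<in> chart I i"
  shows "regular (proj_locus I S f) (points (proj_locus I S f)) (ratio i k)"
proof -
  have m: "morphism (proj_locus I S f) (proj_space I) (\<lambda>x. x)"
    unfolding proj_locus_def by (rule morphism_inclusion)
  have "{w \<in> points (proj_locus I S f). w \<in> chart I i} = points (proj_locus I S f)"
    using assms by blast
  then show ?thesis
    using morphism_regular[OF m _ regular_ratio, of i k] openin_chart[of I i, where 'k = 'k]
    by (simp add: comp_def)
qed

text \<open>Dehomogenization: a line on which the \<open>i\<close>-th coordinate does not vanish contains exactly one vector
  whose \<open>i\<close>-th coordinate is 1.\<close>

lemma proj_locus_chart_isomorphic: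
  fixes S :: "('i, 'k::field) mpol set"
  assumes hom: "all_homogeneous S" "all_homogeneous {f}" and i: "i \<in> I"
  shows "isomorphic (proj_locus I S (f * pvar i)) (affine_locus I (insert (pvar i - 1) S) f)"
proof -
  let ?X = "proj_locus I S (f * pvar i)" and ?Z = "affine_locus I (insert (pvar i - 1) S) f"
  have X: "is_ringed ?X" and Z: "is_ringed ?Z" by (rule ringed_proj_locus ringed_affine_locus)+
  have hom': "all_homogeneous {f * pvar i}"
    by (intro all_homogeneous_mult hom) simp
  have ch: "L \<in> chart I i" if "L \<in> points ?X" for L
    using that unfolding points_proj_locus chart_def on_locus_mult by auto
  define \<phi> :: "('i \<Rightarrow> 'k alg_closure) set \<Rightarrow> 'i \<Rightarrow> 'k alg_closure" where "\<phi> L k = ratio i k L" for L k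
  have norm: "\<phi> (line x) \<in> affine_points I \<and> \<phi> (line x) i = 1 \<and> on_locus S f (\<phi> (line x)) \<and> line (\<phi> (line x)) = line x"
    if x: "x \<in> affine_points I" "x i \<noteq> 0" "on_locus S f x" for x
  proof -
    have eq: "\<phi> (line x) = (\<lambda>k. inverse (x i) * x k)"
      unfolding \<phi>_def by (auto simp: ratio_line divide_inverse mult.commute)
    have l: "line (\<phi> (line x)) = line x"
      unfolding eq by (rule line_scale) (use x in simp)
    have "on_locus S f (\<phi> (line x))"
      using on_locus_line[OF hom, of x] x(3) line_self[of "\<phi> (line x)"] unfolding l by blast
    with l show ?thesis unfolding eq using x by (auto simp: affine_points_def)
  qed
  have mX: "morphism ?X ?Z \<phi>"
  proof (rule morphism_into_affine_locus[OF X])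
    fix L assume "L \<in> points ?X"
    then obtain x where x: "x \<in> affine_points I" "L = line x" "on_locus S f x" "x i \<noteq> 0"
      by (elim proj_locusE) (auto simp: on_locus_mult)
    show "\<phi> L \<in> affine_points I" "on_locus (insert (pvar i - 1) S) f (\<phi> L)"
      unfolding x(2) on_locus_insert using norm[OF x(1,4,3)] by auto
  next
    fix k
    show "regular ?X (points ?X) (\<lambda>L. \<phi> L k)"
      unfolding \<phi>_def using regular_proj_locus_ratio[OF ch] by auto
  qed
  have Zi: "z i = 1" "on_locus S f z" "z \<in> affine_points I" if "z \<in> points ?Z" for z
    using that by (auto simp: points_affine_locus on_locus_insert)
  have mZ: "morphism ?Z ?X line"
  proof (rule morphism_into_proj_locus[OF Z hom(1) hom'])
    fix z assume z: "z \<in> points ?Z"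
    show "z \<in> affine_points I" "\<exists>i. z i \<noteq> 0" "on_locus S (f * pvar i) z"
      using Zi[OF z] by (auto simp: on_locus_mult intro: exI[of _ i])
  next
    fix k show "regular ?Z (points ?Z) (\<lambda>z. z k)"
      by (rule regular_affine_locus_coordinate)
  qed
  have "line (\<phi> L) = L" if "L \<in> points ?X" for L
    using that norm by (elim proj_locusE) (auto simp: on_locus_mult)
  moreover have "\<phi> (line z) = z" if "z \<in> points ?Z" for z
    using Zi[OF that] by (auto simp: \<phi>_def ratio_line)
  ultimately show ?thesis
    unfolding isomorphic_def using mX mZ by blast
qed

lemma is_variety_proj_locus:
  fixes S :: "('i, 'k::field) mpol set"
  assumes I: "finite I" and hom: "all_homogeneous S" "all_homogeneous {f}"
  shows "is_variety (proj_locus I S f)"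
proof -
  let ?X = "proj_locus I S f"
  let ?U = "\<lambda>i. {L \<in> points ?X. L \<in> chart I i}"
  have m: "morphism ?X (proj_space I) (\<lambda>x. x)"
    unfolding proj_locus_def by (rule morphism_inclusion)
  have "openin (top_of ?X) (?U i)" for i
    by (rule morphism_openin[OF m]) (simp add: openin_chart)
  moreover have "is_affine (subspace_of ?X (?U i))" if i: "i \<in> I" for i
  proof -
    have "isomorphic (subspace_of ?X (?U i)) (subspace_of (proj_space I) ({L. \<forall>x\<in>L. on_locus S f x} \<inter> ?U i))"
      unfolding proj_locus_def
      by (rule isomorphic_subspace_subspace[OF ringed_sheaf[OF ringed_proj_space]])
    moreover have "subspace_of (proj_space I) ({L. \<forall>x\<in>L. on_locus S f x} \<inter> ?U i) = proj_locus I S (f * pvar i)"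
      unfolding proj_locus_def[of I S "f * pvar i"]
      by (rule subspace_cong) (auto simp: points_proj_locus on_locus_mult chart_def)
    ultimately have "isomorphic (subspace_of ?X (?U i)) (proj_locus I S (f * pvar i))"
      by simp
    from isomorphic_trans[OF this proj_locus_chart_isomorphic[OF hom i]]
    show ?thesis
      by (intro isomorphic_affine[OF isomorphic_sym is_affine_affine_locus[OF I]])
  qed
  moreover have "\<Union>(?U ` I) = points ?X"
  proof -
    have "\<exists>i\<in>I. L \<in> chart I i" if "L \<in> points ?X" for L
      using that by (elim proj_locusE) (auto simp: line_in_chart line_in_proj)
    then show ?thesis by blast
  qed
  moreover have "is_separated ?X"
    unfolding proj_locus_def by (intro separated_subspace proj_space_separated)
  ultimately show ?thesis
    unfolding is_variety_def using ringed_sheaf[OF ringed_proj_locus] I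
    by (intro conjI exI[of _ "?U ` I"]) auto
qed

section \<open>The Grothendieck ring modulo the class of the torus\<close>

text \<open>The preimage in the free ring of the ideal generated by the class of the torus. Working there
  replaces computations with cosets in \<open>K0\<close> by congruences between elements of a commutative ring
  which is a type.\<close>

definition torus_ideal :: "'k::field itself \<Rightarrow> 'k free_ring set" where
  "torus_ideal _ = {p. K0_ideal +>\<^bsub>ring_of_type_algebra\<^esub> p \<in> Idl\<^bsub>K0 TYPE('k)\<^esub> {torus_class TYPE('k)}}"

text \<open>A lift of \<open>var_class X\<close> to the free ring. It is meaningful only if \<open>X\<close> is isomorphic to a generator.\<close>

definition cl :: "('p, 'k::field) fspace \<Rightarrow> 'k free_ring" where
  "cl X = gen (SOME Y. isomorphic (Rep_variety Y) X)"

lemma var_class_cl: "var_class X = K0_ideal +>\<^bsub>ring_of_type_algebra\<^esub> cl X"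
  by (simp add: var_class_def cl_def)

lemma ideal_K0_ideal: "ideal (K0_ideal :: 'k::field free_ring set) ring_of_type_algebra"
proof -
  interpret R: cring "ring_of_type_algebra :: 'k free_ring ring"
    by (rule cring_from_type_algebra)
  show ?thesis
    unfolding K0_ideal_def
    by (rule R.genideal_ideal) (simp add: ring_of_type_algebra_def)
qed

lemma K0_coset_hom:
  "(\<lambda>p. K0_ideal +>\<^bsub>ring_of_type_algebra\<^esub> p) \<in> ring_hom (ring_of_type_algebra :: 'k::field free_ring ring) (K0 TYPE('k))"
  unfolding K0_def by (rule ideal.rcos_ring_hom[OF ideal_K0_ideal])

lemma K0_coset_simps:
  fixes p q :: "'k::field free_ring"
  defines "c \<equiv> \<lambda>p. K0_ideal +>\<^bsub>ring_of_type_algebra\<^esub> (p :: 'k free_ring)"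
  shows "c p \<in> carrier (K0 TYPE('k))"
    and "c (p + q) = c p \<oplus>\<^bsub>K0 TYPE('k)\<^esub> c q"
    and "c (p * q) = c p \<otimes>\<^bsub>K0 TYPE('k)\<^esub> c q"
    and "c 1 = \<one>\<^bsub>K0 TYPE('k)\<^esub>"
    and "c 0 = \<zero>\<^bsub>K0 TYPE('k)\<^esub>"
    and "c (- p) = \<ominus>\<^bsub>K0 TYPE('k)\<^esub> c p"
    and "c (p - q) = c p \<ominus>\<^bsub>K0 TYPE('k)\<^esub> c q"
    and "c (of_nat n) = [n] \<cdot>\<^bsub>K0 TYPE('k)\<^esub> \<one>\<^bsub>K0 TYPE('k)\<^esub>"
proof -
  interpret K: cring "K0 TYPE('k)" by (rule cring_K0)
  note hom = K0_coset_hom[where 'k = 'k]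
  show car: "c p \<in> carrier (K0 TYPE('k))" for p
    using ring_hom_closed[OF hom, of p] by (simp add: c_def ring_of_type_algebra_def)
  show add: "c (p + q) = c p \<oplus>\<^bsub>K0 TYPE('k)\<^esub> c q" for p q
    using ring_hom_add[OF hom, of p q] by (simp add: c_def ring_of_type_algebra_def)
  show "c (p * q) = c p \<otimes>\<^bsub>K0 TYPE('k)\<^esub> c q"
    using ring_hom_mult[OF hom, of p q] by (simp add: c_def ring_of_type_algebra_def)
  show one: "c 1 = \<one>\<^bsub>K0 TYPE('k)\<^esub>"
    using ring_hom_one[OF hom] by (simp add: c_def ring_of_type_algebra_def)
  show zero: "c 0 = \<zero>\<^bsub>K0 TYPE('k)\<^esub>"
    using add[of 0 0] car[of 0] by (simp add: K.add.l_cancel_one)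
  show um: "c (- p) = \<ominus>\<^bsub>K0 TYPE('k)\<^esub> c p" for p
    using add[of "- p" p] car zero by (intro K.minus_equality[symmetric]) auto
  show "c (p - q) = c p \<ominus>\<^bsub>K0 TYPE('k)\<^esub> c q"
    using add[of p "- q"] um[of q] by (simp add: a_minus_def)
  show "c (of_nat n) = [n] \<cdot>\<^bsub>K0 TYPE('k)\<^esub> \<one>\<^bsub>K0 TYPE('k)\<^esub>"
  proof (induction n)
    case 0
    then show ?case by (simp add: zero)
  next
    case (Suc n)
    then show ?case
      using K.a_comm[of "\<one>\<^bsub>K0 TYPE('k)\<^esub>" "[n] \<cdot>\<^bsub>K0 TYPE('k)\<^esub> \<one>\<^bsub>K0 TYPE('k)\<^esub>"]
      by (simp add: one add)
  qed
qed

lemma ideal_generated_by_torus: "ideal (Idl\<^bsub>K0 TYPE('k::field)\<^esub> {torus_class TYPE('k)}) (K0 TYPE('k))"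
proof -
  interpret K: cring "K0 TYPE('k)" by (rule cring_K0)
  show ?thesis
    by (rule K.genideal_ideal) (simp add: torus_class_def var_class_cl K0_coset_simps)
qed

lemma torus_ideal_add: "p \<in> torus_ideal TYPE('k::field) \<Longrightarrow> q \<in> torus_ideal TYPE('k) \<Longrightarrow> p + q \<in> torus_ideal TYPE('k)"
  unfolding torus_ideal_def
  by (simp add: K0_coset_simps additive_subgroup.a_closed[OF ideal.axioms(1)[OF ideal_generated_by_torus]])

lemma torus_ideal_0: "0 \<in> torus_ideal TYPE('k::field)"
  unfolding torus_ideal_def
  by (simp add: K0_coset_simps additive_subgroup.zero_closed[OF ideal.axioms(1)[OF ideal_generated_by_torus]])

lemma torus_ideal_mult: "q \<in> torus_ideal TYPE('k::field) \<Longrightarrow> p * q \<in> torus_ideal TYPE('k)"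
  unfolding torus_ideal_def
  by (simp add: K0_coset_simps ideal.I_l_closed[OF ideal_generated_by_torus])

lemma torus_ideal_uminus: "q \<in> torus_ideal TYPE('k::field) \<Longrightarrow> - q \<in> torus_ideal TYPE('k)"
  using torus_ideal_mult[of q "- 1"] by simp

lemma torus_ideal_diff: "p \<in> torus_ideal TYPE('k::field) \<Longrightarrow> q \<in> torus_ideal TYPE('k) \<Longrightarrow> p - q \<in> torus_ideal TYPE('k)"
  using torus_ideal_add[of p "- q"] torus_ideal_uminus[of q] by simp

lemma torus_ideal_relation:
  assumes "p \<in> K0_relations"
  shows "p \<in> torus_ideal TYPE('k::field)"
proof -
  interpret R: cring "ring_of_type_algebra :: 'k free_ring ring"
    by (rule cring_from_type_algebra)
  interpret I: ideal "K0_ideal :: 'k free_ring set" "ring_of_type_algebra"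
    by (rule ideal_K0_ideal)
  have "K0_relations \<subseteq> (K0_ideal :: 'k free_ring set)"
    unfolding K0_ideal_def by (rule R.genideal_self) (simp add: ring_of_type_algebra_def)
  then have "p \<in> K0_ideal" using assms by blast
  then have "K0_ideal +>\<^bsub>ring_of_type_algebra\<^esub> p = K0_ideal"
    by (rule I.a_rcos_const)
  also have "\<dots> = \<zero>\<^bsub>K0 TYPE('k)\<^esub>"
    by (simp add: K0_def FactRing_def)
  finally show ?thesis
    unfolding torus_ideal_def
    by (simp add: additive_subgroup.zero_closed[OF ideal.axioms(1)[OF ideal_generated_by_torus]])
qed

lemma torus_ideal_torus: "cl (torus TYPE('k::field)) \<in> torus_ideal TYPE('k)"
proof -
  interpret K: cring "K0 TYPE('k)" by (rule cring_K0)
  have "torus_class TYPE('k) \<in> Idl\<^bsub>K0 TYPE('k)\<^esub> {torus_class TYPE('k)}"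
    by (rule K.genideal_self') (simp add: torus_class_def var_class_cl K0_coset_simps)
  then show ?thesis
    by (simp add: torus_ideal_def torus_class_def var_class_cl)
qed

definition congT :: "'k::field free_ring \<Rightarrow> 'k free_ring \<Rightarrow> bool" where
  "congT a b \<longleftrightarrow> a - b \<in> torus_ideal TYPE('k)"

lemma congT_refl: "congT a a"
  by (simp add: congT_def torus_ideal_0)

lemma congT_sym: "congT a b \<Longrightarrow> congT b a"
  unfolding congT_def using torus_ideal_uminus by fastforce

lemma congT_trans: "congT a b \<Longrightarrow> congT b c \<Longrightarrow> congT a c"
  unfolding congT_def using torus_ideal_add by fastforce

lemma congT_add: "congT a b \<Longrightarrow> congT a' b' \<Longrightarrow> congT (a + a') (b + b')"
  unfolding congT_def using torus_ideal_add[of "a - b" "a' - b'"] by (simp add: algebra_simps)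

lemma congT_mult_0: "congT b 0 \<Longrightarrow> congT (a * b) 0"
  unfolding congT_def using torus_ideal_mult by auto

lemma congT_iso: "isomorphic (Rep_variety X) (Rep_variety Y) \<Longrightarrow> congT (gen X) (gen Y)"
  unfolding congT_def by (rule torus_ideal_relation) (auto simp: K0_relations_def)

definition representable :: "('p, 'k::field) fspace \<Rightarrow> bool" where
  "representable X \<longleftrightarrow> (\<exists>Y. isomorphic (Rep_variety Y) X)"

lemma cl_representative:
  assumes "representable X"
  obtains Y where "isomorphic (Rep_variety Y) X" "cl X = gen Y"
  using assms someI_ex[of "\<lambda>Y. isomorphic (Rep_variety Y) X"] unfolding representable_def cl_def by blast

lemma congT_gen: "isomorphic (Rep_variety Y) X \<Longrightarrow> congT (cl X) (gen Y)"
  using cl_representative[of X] congT_iso isomorphic_trans isomorphic_sym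
  by (metis representable_def)

lemma congT_cl_iso: "representable X \<Longrightarrow> isomorphic X Y \<Longrightarrow> congT (cl X) (cl Y)"
  using cl_representative[of X] congT_gen[of _ Y] congT_sym isomorphic_trans by metis

lemma Rep_variety_is_variety: "is_variety (Rep_variety X)"
  using Rep_variety by blast

lemma Rep_Abs_variety: "is_variety X \<Longrightarrow> Rep_variety (Abs_variety X) = X"
  by (simp add: Abs_variety_inverse)

text \<open>The injection merely has to fit the points into the type of points of the generators; transport of
  structure does the rest.\<close>

lemma variety_representable:
  fixes X :: "('p, 'k::field) fspace" and h :: "'p \<Rightarrow> nat \<Rightarrow> 'k alg_closure"
  assumes X: "is_variety X" and inj: "inj_on h (points X)"
  shows "representable X"
proof -
  have "is_variety (transport h X)"
    by (rule isomorphic_variety[OF _ X]) (rule transport_isomorphic[OF inj variety_sheaf[OF X]])+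
  then show ?thesis
    unfolding representable_def
    using transport_isomorphic(1)[OF inj variety_sheaf[OF X]] isomorphic_sym Rep_Abs_variety by metis
qed

text \<open>The defining relation concerns closed subsets of a generator, so \<open>A\<close> is moved to the generator that
  represents \<open>X\<close>. Both parts have to be known to be varieties for the relation to be available.\<close>

lemma cl_scissor:
  fixes X :: "('p, 'k::field) fspace"
  assumes X: "representable X" and A: "closedin (top_of X) A"
    and Z: "is_variety (subspace_of X A)" and U: "is_variety (subspace_of X (points X - A))"
  shows "congT (cl X) (cl (subspace_of X A) + cl (subspace_of X (points X - A)))"
proof -
  obtain V where V: "isomorphic (Rep_variety V) X" "cl X = gen V"
    using cl_representative[OF X] by blast
  from V(1) obtain \<phi> \<psi> where m: "morphism (Rep_variety V) X \<phi>" "morphism X (Rep_variety V) \<psi>"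
    "\<forall>x\<in>points (Rep_variety V). \<psi> (\<phi> x) = x" "\<forall>y\<in>points X. \<phi> (\<psi> y) = y"
    unfolding isomorphic_def by blast
  let ?V = "Rep_variety V"
  let ?A = "{v \<in> points ?V. \<phi> v \<in> A}"
  have cA: "closedin (top_of ?V) ?A"
    by (rule closedin_continuous_map_preimage[OF morphism_continuous[OF m(1)] A])
  have iA: "isomorphic (subspace_of ?V ?A) (subspace_of X A)"
    by (rule isomorphic_subspaceI[OF m(1,2)]) (use m in auto)
  have iU: "isomorphic (subspace_of ?V (points ?V - ?A)) (subspace_of X (points X - A))"
    by (rule isomorphic_subspaceI[OF m(1,2)]) (use m morphism_points[OF m(1)] in auto)
  note sh = is_function_sheaf_subspace[OF variety_sheaf[OF Rep_variety_is_variety]]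
  have vA: "is_variety (subspace_of ?V ?A)"
    by (rule isomorphic_variety[OF isomorphic_sym[OF iA] Z sh])
  have vU: "is_variety (subspace_of ?V (points ?V - ?A))"
    by (rule isomorphic_variety[OF isomorphic_sym[OF iU] U sh])
  define Z' where "Z' = Abs_variety (subspace_of ?V ?A)"
  define U' where "U' = Abs_variety (subspace_of ?V (points ?V - ?A))"
  have Z': "Rep_variety Z' = subspace_of ?V ?A"
    unfolding Z'_def by (rule Rep_Abs_variety[OF vA])
  have U': "Rep_variety U' = subspace_of ?V (points ?V - ?A)"
    unfolding U'_def by (rule Rep_Abs_variety[OF vU])
  have "gen V - gen Z' - gen U' \<in> K0_relations"
    unfolding K0_relations_def using cA Z' U' by blast
  then have "congT (gen V) (gen Z' + gen U')"
    unfolding congT_def using torus_ideal_relation by (metis diff_diff_eq)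
  moreover have "congT (gen Z' + gen U') (cl (subspace_of X A) + cl (subspace_of X (points X - A)))"
    by (intro congT_add congT_sym[OF congT_gen]) (simp_all add: Z' U' iA iU)
  ultimately show ?thesis
    unfolding V(2) by (rule congT_trans)
qed

text \<open>The assumptions say that \<open>X\<close> is the product of \<open>Z\<close> and the torus: \<open>pair\<close> provides the morphisms into
  \<open>X\<close>, and injectivity of \<open>(p, q)\<close> their uniqueness. Then the class of \<open>X\<close> is a multiple of the class of
  the torus.\<close>

lemma cl_product_torus:
  fixes X :: "('p, 'k::field) fspace" and Z :: "('q, 'k) fspace"
  assumes X: "representable X" and Z: "representable Z" and T: "representable (torus TYPE('k))"
    and p: "morphism X Z p" and q: "morphism X (torus TYPE('k)) q"
    and inj: "\<And>x y. x \<in> points X \<Longrightarrow> y \<in> points X \<Longrightarrow> p x = p y \<Longrightarrow> q x = q y \<Longrightarrow> x = y"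
    and pair: "\<And>(W :: (nat \<Rightarrow> 'k alg_closure, 'k) fspace) f g. is_variety W \<Longrightarrow> morphism W Z f \<Longrightarrow>
      morphism W (torus TYPE('k)) g \<Longrightarrow>
      \<exists>h. morphism W X h \<and> (\<forall>w\<in>points W. p (h w) = f w \<and> q (h w) = g w)"
  shows "congT (cl X) 0"
proof -
  let ?T = "torus TYPE('k)"
  obtain P where P: "isomorphic (Rep_variety P) X" "cl X = gen P"
    using cl_representative[OF X] by blast
  obtain Y where Y: "isomorphic (Rep_variety Y) Z" "cl Z = gen Y"
    using cl_representative[OF Z] by blast
  obtain T0 where T0: "isomorphic (Rep_variety T0) ?T" "cl ?T = gen T0"
    using cl_representative[OF T] by blast
  from P(1) obtain \<alpha> \<beta> where a: "morphism (Rep_variety P) X \<alpha>" "morphism X (Rep_variety P) \<beta>"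
    "\<forall>x\<in>points (Rep_variety P). \<beta> (\<alpha> x) = x" "\<forall>y\<in>points X. \<alpha> (\<beta> y) = y"
    unfolding isomorphic_def by blast
  from Y(1) obtain \<gamma> \<delta> where c: "morphism (Rep_variety Y) Z \<gamma>" "morphism Z (Rep_variety Y) \<delta>"
    "\<forall>x\<in>points (Rep_variety Y). \<delta> (\<gamma> x) = x" "\<forall>y\<in>points Z. \<gamma> (\<delta> y) = y"
    unfolding isomorphic_def by blast
  from T0(1) obtain \<epsilon> \<zeta> where e: "morphism (Rep_variety T0) ?T \<epsilon>" "morphism ?T (Rep_variety T0) \<zeta>"
    "\<forall>x\<in>points (Rep_variety T0). \<zeta> (\<epsilon> x) = x" "\<forall>y\<in>points ?T. \<epsilon> (\<zeta> y) = y"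
    unfolding isomorphic_def by blast
  let ?p = "\<lambda>x. \<delta> (p (\<alpha> x))" and ?q = "\<lambda>x. \<zeta> (q (\<alpha> x))"
  have "is_product P Y T0"
    unfolding is_product_def
  proof (rule exI[of _ ?p], rule exI[of _ ?q], intro conjI allI impI; (elim conjE)?)
    show "morphism (Rep_variety P) (Rep_variety Y) ?p"
      by (rule morphism_comp[OF morphism_comp[OF a(1) p] c(2)])
    show "morphism (Rep_variety P) (Rep_variety T0) ?q"
      by (rule morphism_comp[OF morphism_comp[OF a(1) q] e(2)])
    fix W f g
    assume f: "morphism (Rep_variety W) (Rep_variety Y) f" and g: "morphism (Rep_variety W) (Rep_variety T0) g"
    let ?W = "Rep_variety W"
    obtain h where h: "morphism ?W X h" "\<forall>w\<in>points ?W. p (h w) = \<gamma> (f w) \<and> q (h w) = \<epsilon> (g w)"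
      using pair[OF Rep_variety_is_variety morphism_comp[OF f c(1)] morphism_comp[OF g e(1)]] by blast
    show "\<exists>h. morphism ?W (Rep_variety P) h \<and> (\<forall>w\<in>points ?W. ?p (h w) = f w \<and> ?q (h w) = g w) \<and>
      (\<forall>h'. morphism ?W (Rep_variety P) h' \<and> (\<forall>w\<in>points ?W. ?p (h' w) = f w \<and> ?q (h' w) = g w) \<longrightarrow>
        (\<forall>w\<in>points ?W. h' w = h w))"
    proof (rule exI[of _ "\<lambda>w. \<beta> (h w)"], intro conjI allI impI ballI; (elim conjE)?)
      show "morphism ?W (Rep_variety P) (\<lambda>w. \<beta> (h w))"
        by (rule morphism_comp[OF h(1) a(2)])
      fix w assume w: "w \<in> points ?W"
      have hw: "h w \<in> points X" by (rule morphism_points[OF h(1) w])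
      show "?p (\<beta> (h w)) = f w" "?q (\<beta> (h w)) = g w"
        using a(4) hw h(2) w c(3) e(3) morphism_points[OF f w] morphism_points[OF g w] by simp_all
      fix h' assume h': "morphism ?W (Rep_variety P) h'" "\<forall>w\<in>points ?W. ?p (h' w) = f w \<and> ?q (h' w) = g w"
      have h'w: "h' w \<in> points (Rep_variety P)" by (rule morphism_points[OF h'(1) w])
      have x: "\<alpha> (h' w) \<in> points X" by (rule morphism_points[OF a(1) h'w])
      have "p (\<alpha> (h' w)) = p (h w)"
      proof -
        have "\<gamma> (\<delta> (p (\<alpha> (h' w)))) = \<gamma> (f w)" using h'(2) w by simp
        then show ?thesis using c(4) morphism_points[OF p x] h(2) w by simp
      qed
      moreover have "q (\<alpha> (h' w)) = q (h w)"
      proof -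
        have "\<epsilon> (\<zeta> (q (\<alpha> (h' w)))) = \<epsilon> (g w)" using h'(2) w by simp
        then show ?thesis using e(4) morphism_points[OF q x] h(2) w by simp
      qed
      ultimately have "\<alpha> (h' w) = h w" by (rule inj[OF x hw])
      then show "h' w = \<beta> (h w)" using a(3) h'w by metis
    qed
  qed
  then have "gen P - gen Y * gen T0 \<in> K0_relations"
    unfolding K0_relations_def by blast
  then have "congT (gen P) (gen Y * gen T0)"
    unfolding congT_def by (rule torus_ideal_relation)
  moreover have "congT (gen Y * gen T0) 0"
    using torus_ideal_torus[where 'k = 'k] unfolding T0(2) by (intro congT_mult_0) (simp add: congT_def)
  ultimately show ?thesis
    unfolding P(2) by (rule congT_trans)
qed

lemma whole_subspace_isomorphic:
  assumes "is_function_sheaf X" "points X \<subseteq> A"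
  shows "isomorphic X (subspace_of X A)"
  unfolding isomorphic_def
proof (intro exI conjI)
  show "morphism X (subspace_of X A) (\<lambda>x. x)"
    by (intro morphism_into_subspace morphism_id assms) (use assms in auto)
  show "morphism (subspace_of X A) X (\<lambda>x. x)"
    by (rule morphism_inclusion)
qed auto

text \<open>An empty space is the disjoint union of two copies of itself, so its class equals twice its class.\<close>

lemma cl_empty:
  fixes X :: "('p, 'k::field) fspace"
  assumes X: "representable X" and var: "is_variety X" and empty: "points X = {}"
  shows "congT (cl X) 0"
proof -
  have iso: "isomorphic X (subspace_of X {})"
    by (rule whole_subspace_isomorphic[OF variety_sheaf[OF var]]) (simp add: empty)
  have v: "is_variety (subspace_of X {})"
    by (rule isomorphic_variety[OF iso var is_function_sheaf_subspace[OF variety_sheaf[OF var]]])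
  have "congT (cl X) (cl (subspace_of X {}) + cl (subspace_of X {}))"
    using cl_scissor[OF X closedin_empty] v empty by simp
  moreover have "congT (cl X) (cl (subspace_of X {}))"
    by (rule congT_cl_iso[OF X iso])
  ultimately have 1: "cl X - (cl (subspace_of X {}) + cl (subspace_of X {})) \<in> torus_ideal TYPE('k)"
    and 2: "cl X - cl (subspace_of X {}) \<in> torus_ideal TYPE('k)" by (auto simp: congT_def)
  show ?thesis
    using torus_ideal_diff[OF torus_ideal_add[OF 2 2] 1] by (simp add: congT_def algebra_simps)
qed

subsection \<open>Classes of loci\<close>

text \<open>A line is recorded by the coordinates of its chosen vector, listed in some order.\<close>

lemma representable_proj_locus:
  fixes S :: "('i, 'k::field) mpol set"
  assumes I: "finite I" and hom: "all_homogeneous S" "all_homogeneous {f}"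
  shows "representable (proj_locus I S f)"
proof -
  obtain h where h: "bij_betw h I {..<card I}"
    using ex_bij_betw_finite_nat[OF I] unfolding atLeast0LessThan by blast
  define e :: "('i \<Rightarrow> 'k alg_closure) set \<Rightarrow> nat \<Rightarrow> 'k alg_closure" where "e L n = rep L (inv_into I h n)" for L n
  have "inj_on e (points (proj_locus I S f))"
  proof (rule inj_onI)
    fix L M assume L: "L \<in> points (proj_locus I S f)" and M: "M \<in> points (proj_locus I S f)" and eq: "e L = e M"
    have L': "L \<in> proj_points I" and M': "M \<in> proj_points I" using L M by (auto simp: points_proj_locus)
    note l = proj_point_eq_line[OF L' rep_in[OF L']] and m = proj_point_eq_line[OF M' rep_in[OF M']]
    have "rep L i = rep M i" for i
    proof (cases "i \<in> I")
      case True
      then have "inv_into I h (h i) = i" using h by (auto simp: bij_betw_def)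
      with fun_cong[OF eq, of "h i"] show ?thesis by (simp add: e_def)
    next
      case False
      then show ?thesis using l(2) m(2) by (simp add: affine_points_def)
    qed
    then have "rep L = rep M" by blast
    then show "L = M" using l(1) m(1) by simp
  qed
  then show ?thesis
    by (rule variety_representable[OF is_variety_proj_locus[OF assms]])
qed

lemma torus_eq: "torus TYPE('k::field) = affine_locus {0} {} (pvar 0)"
  by (simp add: torus_def affine_locus_def on_locus_def)

lemma representable_torus: "representable (torus TYPE('k::field))"
  unfolding torus_eq
  by (rule variety_representable[of _ "\<lambda>x. x"]) (simp_all add: is_variety_affine_locus)

lemma cl_proj_locus_cut:
  fixes S :: "('i, 'k::field) mpol set"
  assumes I: "finite I" and hom: "all_homogeneous S" "all_homogeneous {f}" "all_homogeneous {g}"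
  shows "congT (cl (proj_locus I S f)) (cl (proj_locus I (insert g S) f) + cl (proj_locus I S (f * g)))"
proof -
  let ?X = "proj_locus I S f"
  let ?B = "{L. \<forall>x\<in>L. peval g x = 0}"
  let ?A = "points ?X \<inter> ?B"
  obtain d where d: "homogeneous d g" using hom(3) by (auto simp: all_homogeneous_def)
  have m: "morphism ?X (proj_space I) (\<lambda>x. x)"
    unfolding proj_locus_def by (rule morphism_inclusion)
  have dich: "\<not> (\<forall>x\<in>L. peval g x = 0) \<longleftrightarrow> (\<forall>x\<in>L. peval g x \<noteq> 0)" if "L \<in> proj_points I" for L
    using that by (elim proj_pointE) (simp add: line_all_iff[OF d])
  have ne: "L \<noteq> {}" if "L \<in> proj_points I" for L :: "('i \<Rightarrow> 'k alg_closure) set"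
    using rep_in[OF that] by blast
  have "openin (top_of ?X) {L \<in> points ?X. L \<in> {L \<in> proj_points I. \<forall>x\<in>L. peval g x \<noteq> 0}}"
    by (rule morphism_openin[OF m]) (simp add: openin_proj_basic[OF d])
  moreover have "{L \<in> points ?X. L \<in> {L \<in> proj_points I. \<forall>x\<in>L. peval g x \<noteq> 0}} = points ?X - ?A"
    using dich ne by (fastforce simp: points_proj_locus)
  ultimately have A: "closedin (top_of ?X) ?A"
    by (simp add: closedin_def)
  have "isomorphic (subspace_of ?X ?A) (subspace_of (proj_space I) ({L. \<forall>x\<in>L. on_locus S f x} \<inter> ?A))"
    unfolding proj_locus_def
    by (rule isomorphic_subspace_subspace[OF ringed_sheaf[OF ringed_proj_space]])
  moreover have "subspace_of (proj_space I) ({L. \<forall>x\<in>L. on_locus S f x} \<inter> ?A) = proj_locus I (insert g S) f"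
    unfolding proj_locus_def[of I "insert g S"]
    by (rule subspace_cong) (auto simp: points_proj_locus on_locus_insert)
  ultimately have iA: "isomorphic (subspace_of ?X ?A) (proj_locus I (insert g S) f)" by simp
  have "isomorphic (subspace_of ?X (points ?X - ?A)) (subspace_of (proj_space I) ({L. \<forall>x\<in>L. on_locus S f x} \<inter> (points ?X - ?A)))"
    unfolding proj_locus_def
    by (rule isomorphic_subspace_subspace[OF ringed_sheaf[OF ringed_proj_space]])
  moreover have "subspace_of (proj_space I) ({L. \<forall>x\<in>L. on_locus S f x} \<inter> (points ?X - ?A)) = proj_locus I S (f * g)"
    unfolding proj_locus_def[of I S "f * g"]
    by (rule subspace_cong) (use dich ne in \<open>fastforce simp: points_proj_locus on_locus_mult\<close>)
  ultimately have iU: "isomorphic (subspace_of ?X (points ?X - ?A)) (proj_locus I S (f * g))" by simp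
  have homA: "all_homogeneous (insert g S)" using hom all_homogeneous_insert by blast
  have homU: "all_homogeneous {f * g}" using hom all_homogeneous_mult by blast
  note sh = is_function_sheaf_subspace[OF ringed_sheaf[OF ringed_proj_locus]]
  have "congT (cl ?X) (cl (subspace_of ?X ?A) + cl (subspace_of ?X (points ?X - ?A)))"
    by (intro cl_scissor representable_proj_locus I hom A
        isomorphic_variety[OF isomorphic_sym[OF iA] is_variety_proj_locus[OF I homA hom(2)] sh]
        isomorphic_variety[OF isomorphic_sym[OF iU] is_variety_proj_locus[OF I hom(1) homU] sh])
  moreover have "congT (cl (subspace_of ?X ?A) + cl (subspace_of ?X (points ?X - ?A)))
      (cl (proj_locus I (insert g S) f) + cl (proj_locus I S (f * g)))"
    by (intro congT_add congT_sym[OF congT_cl_iso] representable_proj_locus I hom homA homU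
        isomorphic_sym[OF iA] isomorphic_sym[OF iU])
  ultimately show ?thesis by (rule congT_trans)
qed

lemma normalized_point:
  fixes S :: "('i, 'k::field) mpol set"
  assumes hom: "all_homogeneous S" "all_homogeneous {f}"
    and L: "L \<in> points (proj_locus I S f)" "L \<in> chart I i"
  shows "(\<lambda>k. ratio i k L) \<in> affine_points I" "ratio i i L = 1" "on_locus S f (\<lambda>k. ratio i k L)"
    "line (\<lambda>k. ratio i k L) = L"
proof -
  obtain x where x: "x \<in> affine_points I" "L = line x" "on_locus S f x"
    using L(1) by (elim proj_locusE)
  have xi: "x i \<noteq> 0" using L(2) x(2) by (simp add: line_in_chart)
  have eq: "(\<lambda>k. ratio i k L) = (\<lambda>k. inverse (x i) * x k)"
    unfolding x(2) by (auto simp: ratio_line divide_inverse mult.commute)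
  show l: "line (\<lambda>k. ratio i k L) = L"
    unfolding eq using line_scale[of "inverse (x i)" x] xi x(2) by simp
  show "on_locus S f (\<lambda>k. ratio i k L)"
    using on_locus_line[OF hom, of x] x(2,3) line_self[of "\<lambda>k. ratio i k L"] unfolding l by blast
  show "(\<lambda>k. ratio i k L) \<in> affine_points I" unfolding eq using x(1) by (auto simp: affine_points_def)
  show "ratio i i L = 1" using xi unfolding x(2) by (simp add: ratio_line)
qed

text \<open>The torus acts on the locus with weights \<open>w\<close>, and the quotient \<open>x\<^sub>j / x\<^sub>i\<close> is a nowhere vanishing
  function of weight 1. Hence every point is moved into the slice \<open>x\<^sub>j = x\<^sub>i\<close> by exactly one element of the
  torus, and the locus is the product of the slice and the torus. That the weights of \<open>x\<^sub>i\<close> and \<open>x\<^sub>j\<close> differ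
  by 1 is what makes the action free.\<close>

lemma cl_torus_action:
  fixes S :: "('i, 'k::field) mpol set" and w :: "'i \<Rightarrow> int"
  assumes I: "finite I" and hom: "all_homogeneous S" "all_homogeneous {f}"
    and ij: "i \<in> I" "j \<in> I" "w i = 0" "w j = 1"
    and nz: "\<And>x. x \<in> affine_points I \<Longrightarrow> on_locus S f x \<Longrightarrow> x \<noteq> (\<lambda>_. 0) \<Longrightarrow> x i \<noteq> 0 \<and> x j \<noteq> 0"
    and act: "\<And>x t. x \<in> affine_points I \<Longrightarrow> on_locus S f x \<Longrightarrow> t \<noteq> 0 \<Longrightarrow> on_locus S f (\<lambda>k. t powi w k * x k)"
  shows "congT (cl (proj_locus I S f)) 0"
proof -
  let ?S' = "insert (pvar j - pvar i) S"
  let ?X = "proj_locus I S f" and ?Z = "proj_locus I ?S' f" and ?T = "torus TYPE('k)"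
  have "homogeneous 1 (pvar j - pvar i :: ('i, 'k) mpol)"
    by (intro homogeneous_diff homogeneous_pvar)
  then have hom': "all_homogeneous ?S'"
    using hom(1) by (auto simp: all_homogeneous_def)
  have X: "is_ringed ?X" by (rule ringed_proj_locus)
  have chX: "L \<in> chart I i \<and> ratio i j L \<noteq> 0" if "L \<in> points ?X" for L
  proof -
    from that obtain x k where x: "x \<in> affine_points I" "L = line x" "on_locus S f x" "x k \<noteq> 0"
      by (elim proj_locusE)
    have "x i \<noteq> 0 \<and> x j \<noteq> 0" using nz[OF x(1,3)] x(4) by auto
    then show ?thesis using x by (auto simp: line_in_chart ratio_line line_in_proj)
  qed
  have chZ: "L \<in> chart I i \<and> ratio i j L = 1 \<and> L \<in> points ?X" if "L \<in> points ?Z" for L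
  proof -
    have 1: "L \<in> points ?X" using that by (auto simp: points_proj_locus on_locus_insert)
    then have c: "L \<in> chart I i" using chX by blast
    have "ratio i i L = 1" "on_locus ?S' f (\<lambda>k. ratio i k L)"
      using normalized_point[OF hom' hom(2) that c] by auto
    then show ?thesis using 1 c by (simp add: on_locus_insert)
  qed
  \<comment> \<open>\<open>q\<close> reads off the element of the torus which brings the slice to the given point, and the vector \<open>v L\<close> spans the point of the slice that the given point comes from.\<close>
  define q :: "('i \<Rightarrow> 'k alg_closure) set \<Rightarrow> nat \<Rightarrow> 'k alg_closure"
    where "q L n = (if n = 0 then ratio i j L else 0)" for L n
  define v where "v L k = ratio i j L powi (- w k) * ratio i k L" for L :: "('i \<Rightarrow> 'k alg_closure) set" and k
  have regX: "regular ?X (points ?X) (ratio i k)" for k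
    by (rule regular_proj_locus_ratio) (use chX in blast)
  have regZ: "regular ?Z (points ?Z) (ratio i k)" for k
    by (rule regular_proj_locus_ratio) (use chZ in blast)
  have p: "morphism ?X ?Z (\<lambda>L. line (v L))"
  proof (rule morphism_into_proj_locus[OF X hom' hom(2)])
    fix L assume L: "L \<in> points ?X"
    with chX have c: "L \<in> chart I i" "ratio i j L \<noteq> 0" by auto
    note n = normalized_point[OF hom L c(1)]
    show "v L \<in> affine_points I" using n(1) by (auto simp: v_def affine_points_def)
    show "\<exists>i. v L i \<noteq> 0" using n(2) ij(3) by (intro exI[of _ i]) (simp add: v_def)
    have "on_locus S f (\<lambda>k. inverse (ratio i j L) powi w k * ratio i k L)"
      by (rule act[OF n(1,3)]) (use c in simp)
    moreover have "v L = (\<lambda>k. inverse (ratio i j L) powi w k * ratio i k L)"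
      by (auto simp: v_def power_int_minus power_int_inverse)
    moreover have "v L j = v L i" using c n(2) ij by (simp add: v_def power_int_minus)
    ultimately show "on_locus ?S' f (v L)" by (simp add: on_locus_insert)
  next
    fix k show "regular ?X (points ?X) (\<lambda>L. v L k)"
      unfolding v_def using chX
      by (intro regular_mult[OF X openin_topspace] regular_power_int[OF X openin_topspace] regX) blast
  qed
  have q: "morphism ?X ?T q"
    unfolding torus_eq
  proof (rule morphism_into_affine_locus[OF X])
    fix L assume "L \<in> points ?X"
    then show "q L \<in> affine_points {0}" "on_locus {} (pvar 0) (q L)"
      using chX by (auto simp: q_def affine_points_def on_locus_def)
  next
    fix n show "regular ?X (points ?X) (\<lambda>L. q L n)"
      by (cases "n = 0") (simp_all add: q_def regX regular_0[OF X openin_topspace])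
  qed
  show ?thesis
  proof (rule cl_product_torus[OF _ _ representable_torus p q])
    show "representable ?X" "representable ?Z"
      by (intro representable_proj_locus I hom hom')+
  next
    fix L M assume L: "L \<in> points ?X" and M: "M \<in> points ?X" and eq: "line (v L) = line (v M)" "q L = q M"
    have r: "ratio i j L = ratio i j M" using fun_cong[OF eq(2), of 0] by (simp add: q_def)
    note cL = chX[OF L] and cM = chX[OF M]
    note nL = normalized_point[OF hom L conjunct1[OF cL]] and nM = normalized_point[OF hom M conjunct1[OF cM]]
    have vi: "v L i = 1" "v M i = 1" using nL(2) nM(2) ij by (auto simp: v_def)
    have "ratio i k L = ratio i k M" for k
    proof -
      have "v L k = v M k"
        using arg_cong[OF eq(1), of "ratio i k"] vi by (simp add: ratio_line)
      then show ?thesis using cL r by (simp add: v_def)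
    qed
    then have "(\<lambda>k. ratio i k L) = (\<lambda>k. ratio i k M)" by blast
    then show "L = M" using nL(4) nM(4) by metis
  next
    fix W :: "(nat \<Rightarrow> 'k alg_closure, 'k) fspace" and \<phi> \<psi>
    assume W: "is_variety W" and \<phi>: "morphism W ?Z \<phi>" and \<psi>: "morphism W ?T \<psi>"
    have W': "is_ringed W" by (rule variety_ringed[OF W])
    \<comment> \<open>The inverse of the pair of the two projections: let the torus act on the point of the slice.\<close>
    define u where "u x k = \<psi> x 0 powi w k * ratio i k (\<phi> x)" for x k
    have \<psi>p: "\<psi> x 0 \<noteq> 0 \<and> (\<forall>n. n \<noteq> 0 \<longrightarrow> \<psi> x n = 0)" if "x \<in> points W" for x
      using morphism_points[OF \<psi> that] by (auto simp: torus_eq points_affine_locus affine_points_def on_locus_def)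
    have r1: "regular W (points W) (\<lambda>x. ratio i k (\<phi> x))" for k
    proof -
      have "{x \<in> points W. \<phi> x \<in> points ?Z} = points W" using morphism_points[OF \<phi>] by blast
      then show ?thesis using morphism_regular[OF \<phi> openin_topspace regZ[of k]] by (simp add: comp_def)
    qed
    have r2: "regular W (points W) (\<lambda>x. \<psi> x 0)"
    proof -
      have "{x \<in> points W. \<psi> x \<in> points ?T} = points W" using morphism_points[OF \<psi>] by blast
      moreover have "regular ?T (points ?T) (\<lambda>x. x 0)"
        unfolding torus_eq by (rule regular_affine_locus_coordinate)
      ultimately show ?thesis
        using morphism_regular[OF \<psi> openin_topspace] by (fastforce simp: comp_def)
    qed
    have h: "morphism W ?X (\<lambda>x. line (u x))"
    proof (rule morphism_into_proj_locus[OF W' hom])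
      fix x assume x: "x \<in> points W"
      note Z = morphism_points[OF \<phi> x]
      note c = chZ[OF Z]
      note n = normalized_point[OF hom conjunct2[OF conjunct2[OF c]] conjunct1[OF c]]
      show "u x \<in> affine_points I" using n(1) by (auto simp: u_def affine_points_def)
      show "\<exists>k. u x k \<noteq> 0" using n(2) ij by (intro exI[of _ i]) (simp add: u_def)
      show "on_locus S f (u x)"
        unfolding u_def by (rule act[OF n(1,3)]) (use \<psi>p[OF x] in simp)
    next
      fix k show "regular W (points W) (\<lambda>x. u x k)"
        unfolding u_def using \<psi>p
        by (intro regular_mult[OF W' openin_topspace] regular_power_int[OF W' openin_topspace] r1 r2) blast
    qed
    have "line (v (line (u x))) = \<phi> x \<and> q (line (u x)) = \<psi> x" if x: "x \<in> points W" for x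
    proof -
      note Z = morphism_points[OF \<phi> x]
      note c = chZ[OF Z]
      note n = normalized_point[OF hom conjunct2[OF conjunct2[OF c]] conjunct1[OF c]]
      note t = \<psi>p[OF x]
      have ui: "u x i = 1" "u x j = \<psi> x 0" using n(2) c ij by (auto simp: u_def)
      have "v (line (u x)) k = ratio i k (\<phi> x)" for k
      proof -
        have "v (line (u x)) k = \<psi> x 0 powi (- w k) * u x k"
          by (simp add: v_def ratio_line ui)
        then show ?thesis using t by (simp add: u_def power_int_minus)
      qed
      then have "v (line (u x)) = (\<lambda>k. ratio i k (\<phi> x))"
        by blast
      moreover have "q (line (u x)) = \<psi> x"
        using t by (auto simp: q_def ratio_line ui)
      ultimately show ?thesis using n(4) by simp
    qed
    with h show "\<exists>h. morphism W ?X h \<and> (\<forall>x\<in>points W. line (v (h x)) = \<phi> x \<and> q (h x) = \<psi> x)"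
      by (intro exI[of _ "\<lambda>x. line (u x)"]) blast
  qed
qed

lemma cl_empty_locus:
  fixes S :: "('i, 'k::field) mpol set"
  assumes I: "finite I" and hom: "all_homogeneous S" "all_homogeneous {f}"
    and "\<And>x. x \<in> affine_points I \<Longrightarrow> x \<noteq> (\<lambda>_. 0) \<Longrightarrow> \<not> on_locus S f x"
  shows "congT (cl (proj_locus I S f)) 0"
proof (rule cl_empty)
  show "points (proj_locus I S f) = {}"
  proof (rule equals0I)
    fix L assume "L \<in> points (proj_locus I S f)"
    then obtain x i where "x \<in> affine_points I" "x i \<noteq> 0" "on_locus S f x" by (elim proj_locusE)
    then show False using assms(4)[of x] by auto
  qed
qed (intro representable_proj_locus is_variety_proj_locus I hom)+

lemma on_locus_pvars: "on_locus (pvar ` M \<union> S) f x \<longleftrightarrow> (\<forall>m\<in>M. x m = 0) \<and> on_locus S f x"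
  by (simp add: on_locus_def ball_Un)

lemma on_locus_empty: "on_locus {} f x \<longleftrightarrow> peval f x \<noteq> 0"
  by (simp add: on_locus_def)

lemma on_locus_only_pvars: "on_locus (pvar ` M) f x \<longleftrightarrow> (\<forall>m\<in>M. x m = 0) \<and> peval f x \<noteq> 0"
  by (simp add: on_locus_def)

lemmas on_locus_simps = on_locus_pvars on_locus_only_pvars on_locus_empty on_locus_mult

lemma all_homogeneous_pvars:
  fixes S :: "('i, 'k::field) mpol set"
  shows "all_homogeneous (pvar ` M \<union> S) \<longleftrightarrow> all_homogeneous S"
proof -
  have "\<exists>d. homogeneous d (pvar m :: ('i, 'k) mpol)" for m by (rule exI, rule homogeneous_pvar)
  then show ?thesis by (simp add: all_homogeneous_def ball_Un)
qed

lemma all_homogeneous_empty [simp]: "all_homogeneous {}"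
  by (simp add: all_homogeneous_def)

lemma all_homogeneous_only_pvars [simp]: "all_homogeneous (pvar ` M)"
  using all_homogeneous_pvars[of M "{}"] by simp

lemma all_homogeneous_1 [simp]: "all_homogeneous {1 :: ('i, 'k::field) mpol}"
  unfolding all_homogeneous_def by (metis homogeneous_1 singletonD)

text \<open>The locus is decomposed according to the first coordinate in \<open>K\<close> that does not vanish, in some order
  of \<open>K\<close>: the coordinates in \<open>M\<close> come before \<open>j\<close>. What remains is the part where all of them vanish.\<close>

lemma cl_exhaust:
  fixes S :: "('i, 'k::field) mpol set"
  assumes K: "finite K" and I: "finite I" and hom: "all_homogeneous S" "all_homogeneous {f}"
    and all: "congT (cl (proj_locus I (pvar ` K \<union> S) f)) 0"
    and step: "\<And>M j. M \<subseteq> K \<Longrightarrow> j \<in> K - M \<Longrightarrow> congT (cl (proj_locus I (pvar ` M \<union> S) (f * pvar j))) 0"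
  shows "congT (cl (proj_locus I S f)) 0"
  using K hom(1) all step
proof (induction K arbitrary: S rule: finite_induct)
  case empty
  then show ?case by simp
next
  case (insert j K)
  have eq: "pvar ` M \<union> insert (pvar j) S = pvar ` (insert j M) \<union> S" for M by auto
  have 1: "congT (cl (proj_locus I (insert (pvar j) S) f)) 0"
  proof (rule insert.IH)
    show "all_homogeneous (insert (pvar j) S)"
      using insert.prems(1) by (subst all_homogeneous_insert) simp
    show "congT (cl (proj_locus I (pvar ` K \<union> insert (pvar j) S) f)) 0"
      using insert.prems(2) by (simp add: eq)
    fix M j' assume "M \<subseteq> K" "j' \<in> K - M"
    then show "congT (cl (proj_locus I (pvar ` M \<union> insert (pvar j) S) (f * pvar j'))) 0"
      unfolding eq using insert.hyps by (intro insert.prems(3)) auto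
  qed
  have 2: "congT (cl (proj_locus I S (f * pvar j))) 0"
    using insert.prems(3)[of "{}" j] by simp
  have "congT (cl (proj_locus I S f)) (cl (proj_locus I (insert (pvar j) S) f) + cl (proj_locus I S (f * pvar j)))"
    by (rule cl_proj_locus_cut[OF I insert.prems(1) hom(2)]) simp
  moreover have "congT (cl (proj_locus I (insert (pvar j) S) f) + cl (proj_locus I S (f * pvar j))) 0"
    using congT_add[OF 1 2] by simp
  ultimately show ?case by (rule congT_trans)
qed

section \<open>Complements with a torus action without fixed points\<close>

text \<open>The torus acts with weights 1, 0 and -1 on the coordinates in \<open>A\<close>, \<open>B\<close> and \<open>C\<close>. The fixed points are the
  lines spanned by vectors supported in one of these sets, and \<open>f\<close> vanishes there. So at a point of the
  complement, coordinates with two different weights do not vanish.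
  
  The complement is decomposed according to the first nonvanishing coordinates. If some \<open>b\<close> in \<open>B\<close>
  occurs, the second coordinate is taken from \<open>A\<close> or \<open>C\<close>, the weights differ by 1 up to sign, and the torus
  acts freely. Otherwise the coordinates come from \<open>A\<close> and \<open>C\<close>, the weights differ by 2, and
  \<open>-1\<close> acts trivially. But as all coordinates in \<open>B\<close> vanish, the square root of this action is available:
  it scales the coordinates in \<open>C\<close> only, and the hypothesis on it is \<open>act0\<close>.\<close>

theorem cl_torus_fixed_point_free:
  fixes f :: "('i, 'k::field) mpol"
  assumes I: "finite I" and hom: "all_homogeneous {f}"
    and part: "I = A \<union> B \<union> C" "A \<inter> B = {}" "A \<inter> C = {}" "B \<inter> C = {}"
    and act: "\<And>x t. x \<in> affine_points I \<Longrightarrow> t \<noteq> 0 \<Longrightarrow> peval f x \<noteq> 0 \<Longrightarrow>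
      peval f (\<lambda>k. t powi (if k \<in> A then 1 else if k \<in> C then - 1 else 0) * x k) \<noteq> 0"
    and act0: "\<And>x t. x \<in> affine_points I \<Longrightarrow> t \<noteq> 0 \<Longrightarrow> peval f x \<noteq> 0 \<Longrightarrow> \<forall>k\<in>B. x k = 0 \<Longrightarrow>
      peval f (\<lambda>k. t powi (if k \<in> C then 1 else 0) * x k) \<noteq> 0"
    and fixed: "\<And>x. x \<in> affine_points I \<Longrightarrow> \<forall>k\<in>A \<union> B. x k = 0 \<Longrightarrow> peval f x = 0"
      "\<And>x. x \<in> affine_points I \<Longrightarrow> \<forall>k\<in>A \<union> C. x k = 0 \<Longrightarrow> peval f x = 0"
      "\<And>x. x \<in> affine_points I \<Longrightarrow> \<forall>k\<in>B \<union> C. x k = 0 \<Longrightarrow> peval f x = 0"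
  shows "congT (cl (proj_locus I {} f)) 0"
proof -
  have fin: "finite A" "finite B" "finite C" using I part by auto
  note homs = all_homogeneous_pvars[THEN iffD2] all_homogeneous_mult all_homogeneous_pvar hom
  have hom0: "all_homogeneous {}" by simp
  show ?thesis
  proof (rule cl_exhaust[OF fin(2) I hom0 hom])
    show "congT (cl (proj_locus I (pvar ` B \<union> {}) f)) 0"
    proof (rule cl_exhaust[OF fin(1) I _ hom])
      show "congT (cl (proj_locus I (pvar ` A \<union> (pvar ` B \<union> {})) f)) 0" (is "congT (cl (proj_locus I ?S ?f)) 0")
      proof (rule cl_empty_locus[OF I])
        fix x :: "'i \<Rightarrow> 'k alg_closure" assume "x \<in> affine_points I"
        then have "(\<forall>k\<in>A \<union> B. x k = 0) \<longrightarrow> peval f x = 0" using fixed(1) by blast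
        then show "\<not> on_locus ?S ?f x" by (auto simp: on_locus_simps)
      qed (intro homs hom0)+
    next
      fix M i assume M: "M \<subseteq> A" "i \<in> A - M"
      show "congT (cl (proj_locus I (pvar ` M \<union> (pvar ` B \<union> {})) (f * pvar i))) 0"
      proof (rule cl_exhaust[OF fin(3) I])
        show "congT (cl (proj_locus I (pvar ` C \<union> (pvar ` M \<union> (pvar ` B \<union> {}))) (f * pvar i))) 0" (is "congT (cl (proj_locus I ?S ?f)) 0")
        proof (rule cl_empty_locus[OF I])
          fix x :: "'i \<Rightarrow> 'k alg_closure" assume "x \<in> affine_points I"
          then have "(\<forall>k\<in>B \<union> C. x k = 0) \<longrightarrow> peval f x = 0" using fixed(3) by blast
          then show "\<not> on_locus ?S ?f x" by (auto simp: on_locus_simps)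
        qed (intro homs hom0)+
      next
        fix M' j assume M': "M' \<subseteq> C" "j \<in> C - M'"
        show "congT (cl (proj_locus I (pvar ` M' \<union> (pvar ` M \<union> (pvar ` B \<union> {}))) (f * pvar i * pvar j))) 0"
        proof (rule cl_torus_action[OF I, where i = i and j = j and w = "\<lambda>k. if k \<in> C then 1 else 0"])
          fix x :: "'i \<Rightarrow> 'k alg_closure" and t :: "'k alg_closure"
          assume x: "x \<in> affine_points I"
            and l: "on_locus (pvar ` M' \<union> (pvar ` M \<union> (pvar ` B \<union> {}))) (f * pvar i * pvar j) x" and t: "t \<noteq> 0"
          from l have l': "\<forall>m\<in>M' \<union> M \<union> B. x m = 0" "x i \<noteq> 0" "x j \<noteq> 0" "peval f x \<noteq> 0"
            by (auto simp: on_locus_simps)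
          have "peval f (\<lambda>k. t powi (if k \<in> C then 1 else 0) * x k) \<noteq> 0"
            using l' by (intro act0[OF x t]) auto
          then show "on_locus (pvar ` M' \<union> (pvar ` M \<union> (pvar ` B \<union> {}))) (f * pvar i * pvar j)
              (\<lambda>k. t powi (if k \<in> C then 1 else 0) * x k)"
            using l' t by (auto simp: on_locus_simps)
        qed (use M M' part in \<open>auto simp: on_locus_simps intro!: homs hom0\<close>)
      qed (intro homs hom0)+
    qed (intro homs hom0)
  next
    fix M b assume M: "M \<subseteq> B" "b \<in> B - M"
    show "congT (cl (proj_locus I (pvar ` M \<union> {}) (f * pvar b))) 0"
    proof (rule cl_exhaust[OF _ I])
      show "finite (A \<union> C)" using fin by simp
      show "congT (cl (proj_locus I (pvar ` (A \<union> C) \<union> (pvar ` M \<union> {})) (f * pvar b))) 0" (is "congT (cl (proj_locus I ?S ?f)) 0")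
      proof (rule cl_empty_locus[OF I])
        fix x :: "'i \<Rightarrow> 'k alg_closure" assume "x \<in> affine_points I"
        then have "(\<forall>k\<in>A \<union> C. x k = 0) \<longrightarrow> peval f x = 0" using fixed(2) by blast
        then show "\<not> on_locus ?S ?f x" by (auto simp: on_locus_simps)
      qed (intro homs hom0)+
    next
      fix M' j assume M': "M' \<subseteq> A \<union> C" "j \<in> A \<union> C - M'"
      \<comment> \<open>The sign \<open>?w j\<close> turns the weight of the coordinate \<open>j\<close> into 1, as required for the slice.\<close>
      let ?w = "\<lambda>k. if k \<in> A then 1 else if k \<in> C then - 1 else 0 :: int"
      show "congT (cl (proj_locus I (pvar ` M' \<union> (pvar ` M \<union> {})) (f * pvar b * pvar j))) 0"
      proof (rule cl_torus_action[OF I, where i = b and j = j and w = "\<lambda>k. ?w j * ?w k"])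
        fix x :: "'i \<Rightarrow> 'k alg_closure" and t :: "'k alg_closure"
        assume x: "x \<in> affine_points I"
          and l: "on_locus (pvar ` M' \<union> (pvar ` M \<union> {})) (f * pvar b * pvar j) x" and t: "t \<noteq> 0"
        from l have l': "\<forall>m\<in>M' \<union> M. x m = 0" "x b \<noteq> 0" "x j \<noteq> 0" "peval f x \<noteq> 0"
          by (auto simp: on_locus_simps)
        have 1: "peval f (\<lambda>k. (t powi ?w j) powi ?w k * x k) \<noteq> 0"
          by (rule act[OF x _ l'(4)]) (use t in simp)
        have 2: "(\<lambda>k. (t powi ?w j) powi ?w k * x k) = (\<lambda>k. t powi (?w j * ?w k) * x k)"
          by (simp only: power_int_mult)
        have "peval f (\<lambda>k. t powi (?w j * ?w k) * x k) \<noteq> 0"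
          using 1 unfolding 2 .
        then show "on_locus (pvar ` M' \<union> (pvar ` M \<union> {})) (f * pvar b * pvar j) (\<lambda>k. t powi (?w j * ?w k) * x k)"
          using l' t by (simp add: on_locus_simps ball_Un)
      qed (use M M' part in \<open>auto simp: on_locus_simps intro!: homs hom0\<close>)
    qed (intro homs hom0)+
  qed
qed

section \<open>The class of projective space\<close>

lemma cl_affine_point: "congT (cl (affine_space {} :: (nat \<Rightarrow> 'k::field alg_closure, 'k) fspace)) 1"
proof -
  let ?P = "affine_space {} :: (nat \<Rightarrow> 'k alg_closure, 'k) fspace"
  have sh: "is_function_sheaf ?P" by (rule ringed_sheaf[OF ringed_affine_space])
  have "isomorphic ?P (affine_locus {} {} 1 :: (nat \<Rightarrow> 'k alg_closure, 'k) fspace)"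
    unfolding affine_locus_def using sh by (rule whole_subspace_isomorphic) (auto simp: on_locus_empty)
  then have v: "is_variety ?P"
    by (rule isomorphic_variety[OF isomorphic_sym _ sh]) (rule is_variety_affine_locus, simp)
  define P where "P = Abs_variety ?P"
  have P: "Rep_variety P = ?P" unfolding P_def by (rule Rep_Abs_variety[OF v])
  then have "gen P - 1 \<in> K0_relations" unfolding K0_relations_def by blast
  then have "congT (gen P) 1" unfolding congT_def by (rule torus_ideal_relation)
  moreover have "congT (cl ?P) (gen P)"
    by (rule congT_gen) (simp add: P isomorphic_refl)
  ultimately show ?thesis using congT_trans by blast
qed

lemma cl_proj_point:
  assumes I: "finite I" and j: "j \<in> I"
  shows "congT (cl (proj_locus I (pvar ` (I - {j})) (pvar j) :: (_, 'k::field) fspace)) 1"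
proof -
  let ?X = "proj_locus I (pvar ` (I - {j})) (pvar j) :: (_, 'k) fspace"
  let ?P = "affine_space {} :: (nat \<Rightarrow> 'k alg_closure, 'k) fspace"
  let ?e = "\<lambda>k. if k = j then 1 else 0 :: 'k alg_closure"
  have hom: "all_homogeneous (pvar ` (I - {j}) :: (_, 'k) mpol set)"
    by simp
  have hom': "all_homogeneous {pvar j :: (_, 'k) mpol}" by simp
  have X: "is_ringed ?X" by (rule ringed_proj_locus)
  have P: "is_ringed ?P" by (rule ringed_affine_space)
  have "morphism ?X ?P (\<lambda>_ _. 0)"
    by (rule morphism_into_affine[OF X]) (auto simp: affine_points_def regular_0[OF X openin_topspace])
  moreover have "morphism ?P ?X (\<lambda>_. line ?e)"
  proof (rule morphism_into_proj_locus[OF P hom hom'])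
    fix k show "regular ?P (points ?P) (\<lambda>_. ?e k)"
      by (cases "k = j") (simp_all add: regular_0[OF P openin_topspace] regular_1[OF P openin_topspace] del: top_of_affine_space)
  qed (use j in \<open>auto simp: affine_points_def on_locus_def\<close>)
  moreover have "line ?e = L" if "L \<in> points ?X" for L
  proof -
    from that obtain x where x: "x \<in> affine_points I" "L = line x" "on_locus (pvar ` (I - {j})) (pvar j) x"
      by (elim proj_locusE)
    then have "x = (\<lambda>k. x j * ?e k)" "x j \<noteq> 0"
      by (auto simp: affine_points_def on_locus_def fun_eq_iff)
    then show ?thesis using x(2) line_scale[of "x j" ?e] by simp
  qed
  moreover have "(\<lambda>_. 0) = y" if "y \<in> points ?P" for y
    using that by (auto simp: affine_points_def)
  ultimately have "isomorphic ?X ?P"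
    unfolding isomorphic_def by (intro exI[of _ "\<lambda>_ _. 0"] exI[of _ "\<lambda>_. line ?e"]) auto
  then have "congT (cl ?X) (cl ?P)"
    by (intro congT_cl_iso representable_proj_locus I hom hom')
  then show ?thesis using cl_affine_point congT_trans by blast
qed

text \<open>The locus is an affine space, with coordinates \<open>x\<^sub>i / x\<^sub>j\<close> for \<open>i\<close> in \<open>J\<close>. Splitting off the locus where one of
  the coordinates vanishes leaves a locus on which the torus acts by scaling this coordinate, so only
  the origin contributes.\<close>

lemma cl_affine_cell:
  assumes I: "finite I" and j: "j \<in> I" and J: "finite J" "J \<subseteq> I" "j \<notin> J"
  shows "congT (cl (proj_locus I (pvar ` (I - insert j J)) (pvar j) :: (_, 'k::field) fspace)) 1"
  using J
proof (induction J rule: finite_induct)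
  case empty
  show ?case using cl_proj_point[OF I j] .
next
  case (insert i J)
  let ?S = "pvar ` (I - insert j (insert i J)) :: (_, 'k) mpol set"
  have eq: "insert (pvar i) ?S = pvar ` (I - insert j J)"
    using insert by auto
  have 1: "congT (cl (proj_locus I ?S (pvar j))) (cl (proj_locus I (insert (pvar i) ?S) (pvar j)) + cl (proj_locus I ?S (pvar j * pvar i)))"
    by (rule cl_proj_locus_cut[OF I]) simp_all
  have 2: "congT (cl (proj_locus I (insert (pvar i) ?S) (pvar j))) 1"
    unfolding eq using insert by (intro insert.IH) auto
  have 3: "congT (cl (proj_locus I ?S (pvar j * pvar i))) 0"
    by (rule cl_torus_action[OF I, where i = j and j = i and w = "\<lambda>k. if k = i then 1 else 0"])
      (use insert j in \<open>auto simp: on_locus_simps intro!: all_homogeneous_mult\<close>)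
  show ?case using congT_trans[OF 1 congT_add[OF 2 3]] by simp
qed

text \<open>Projective space is the union of one affine cell for each coordinate, each of which contributes 1.
  The induction runs over the coordinate subspaces.\<close>

lemma cl_proj_space:
  assumes I: "finite I" and J: "finite J" "J \<subseteq> I"
  shows "congT (cl (proj_locus I (pvar ` (I - J)) 1 :: (_, 'k::field) fspace)) (of_nat (card J))"
  using J
proof (induction J rule: finite_induct)
  case empty
  have "congT (cl (proj_locus I (pvar ` (I - {})) 1 :: (_, 'k) fspace)) 0"
    by (rule cl_empty_locus[OF I]) (auto simp: on_locus_simps affine_points_def fun_eq_iff)
  then show ?case by simp
next
  case (insert i J)
  let ?S = "pvar ` (I - insert i J) :: (_, 'k) mpol set"
  have eq: "insert (pvar i) ?S = pvar ` (I - J)"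
    using insert by auto
  have 1: "congT (cl (proj_locus I ?S 1)) (cl (proj_locus I (insert (pvar i) ?S) 1) + cl (proj_locus I ?S (1 * pvar i)))"
    by (rule cl_proj_locus_cut[OF I]) simp_all
  have 2: "congT (cl (proj_locus I (insert (pvar i) ?S) 1)) (of_nat (card J))"
    unfolding eq using insert by (intro insert.IH) auto
  have 3: "congT (cl (proj_locus I ?S (1 * pvar i))) 1"
    using cl_affine_cell[of I i J] I insert by simp
  show ?case using congT_trans[OF 1 congT_add[OF 2 3]] insert.hyps by (simp add: add.commute)
qed

section \<open>Linear changes of coordinates\<close>

lemma morphism_cong:
  assumes X: "is_function_sheaf X" and m: "morphism X Y \<phi>" and eq: "\<And>x. x \<in> points X \<Longrightarrow> \<phi> x = \<psi> x"
  shows "morphism X Y \<psi>"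
  unfolding morphism_def
proof (intro conjI allI impI; (elim conjE)?)
  show "continuous_map (top_of X) (top_of Y) \<psi>"
    by (rule continuous_map_eq[OF morphism_continuous[OF m] eq])
  fix U f assume U: "openin (top_of Y) U" "regular Y U f"
  have e: "{x \<in> points X. \<psi> x \<in> U} = {x \<in> points X. \<phi> x \<in> U}" using eq by auto
  show "regular X {x \<in> points X. \<psi> x \<in> U} (f \<circ> \<psi>)"
    unfolding e
    by (rule sheaf_cong[OF X morphism_openin[OF m U(1)] morphism_regular[OF m U]]) (use eq in auto)
qed

lemma morphism_locally:
  assumes X: "is_function_sheaf X"
    and loc: "\<And>x. x \<in> points X \<Longrightarrow> \<exists>U. openin (top_of X) U \<and> x \<in> U \<and> morphism (subspace_of X U) Y \<phi>"
  shows "morphism X Y \<phi>"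
proof -
  have *: "\<exists>T. openin (top_of X) T \<and> x \<in> T \<and> T \<subseteq> {x \<in> points X. \<phi> x \<in> V} \<and> (\<forall>f. regular Y V f \<longrightarrow> regular X T (f \<circ> \<phi>))"
    if V: "openin (top_of Y) V" and x: "x \<in> {x \<in> points X. \<phi> x \<in> V}" for V x
  proof -
    from loc[of x] x obtain U where U: "openin (top_of X) U" "x \<in> U" "morphism (subspace_of X U) Y \<phi>" by blast
    let ?T = "{x \<in> points (subspace_of X U). \<phi> x \<in> V}"
    have T: "openin (top_of X) ?T"
      using morphism_openin[OF U(3) V] U(1) by (auto dest: openin_trans_full)
    have TU: "?T \<subseteq> U" by (auto simp: topspace_subtopology)
    have "regular X ?T (f \<circ> \<phi>)" if "regular Y V f" for f
      using morphism_regular[OF U(3) V that] regular_open_subspace[OF X U(1) T TU] by blast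
    then show ?thesis
      using T x U(2) by (intro exI[of _ ?T]) (auto simp: topspace_subtopology)
  qed
  show ?thesis
    unfolding morphism_def
  proof (intro conjI allI impI; (elim conjE)?)
    show "continuous_map (top_of X) (top_of Y) \<phi>"
      unfolding continuous_map_def
    proof (intro conjI allI impI)
      show "\<phi> \<in> points X \<rightarrow> points Y"
      proof
        fix x assume "x \<in> points X"
        from loc[OF this] \<open>x \<in> points X\<close> show "\<phi> x \<in> points Y"
          using morphism_points by (fastforce simp: topspace_subtopology)
      qed
      fix V assume V: "openin (top_of Y) V"
      show "openin (top_of X) {x \<in> points X. \<phi> x \<in> V}"
        unfolding openin_subopen[of _ "{x \<in> points X. \<phi> x \<in> V}"] using *[OF V] by blast
    qed
    fix V f assume V: "openin (top_of Y) V" "regular Y V f"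
    show "regular X {x \<in> points X. \<phi> x \<in> V} (f \<circ> \<phi>)"
      by (rule sheaf_locally[OF X]) (use *[OF V(1)] V(2) in blast)
  qed
qed

text \<open>The chosen vector \<open>rep L\<close> does not depend regularly on \<open>L\<close>. On each chart it can be replaced by the
  multiple whose coordinates are regular functions.\<close>

lemma morphism_linear:
  fixes f g :: "('i, 'k::field) mpol" and \<sigma> :: "'i \<Rightarrow> ('i, 'k) mpol"
  assumes hom: "all_homogeneous {g}" "all_homogeneous {f}" and lin: "\<And>i. homogeneous 1 (\<sigma> i)"
    and im: "\<And>x. x \<in> affine_points I \<Longrightarrow> x \<noteq> (\<lambda>_. 0) \<Longrightarrow> on_locus {} g x \<Longrightarrow>
      (\<lambda>i. peval (\<sigma> i) x) \<in> affine_points I \<and> (\<lambda>i. peval (\<sigma> i) x) \<noteq> (\<lambda>_. 0) \<and> on_locus {} f (\<lambda>i. peval (\<sigma> i) x)"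
  shows "morphism (proj_locus I {} g) (proj_locus I {} f) (\<lambda>L. line (\<lambda>i. peval (\<sigma> i) (rep L)))"
proof (rule morphism_locally)
  let ?X = "proj_locus I {} g" and ?Y = "proj_locus I {} f"
  have hom0: "all_homogeneous {}" by simp
  show "is_function_sheaf ?X" by (rule ringed_sheaf[OF ringed_proj_locus])
  fix L assume L: "L \<in> points ?X"
  then obtain x i where x: "x \<in> affine_points I" "L = line x" "x i \<noteq> 0" by (elim proj_locusE)
  let ?U = "points ?X \<inter> chart I i"
  let ?W = "subspace_of ?X ?U"
  have m: "morphism ?X (proj_space I) (\<lambda>x. x)"
    unfolding proj_locus_def by (rule morphism_inclusion)
  have "openin (top_of ?X) {L \<in> points ?X. L \<in> chart I i}"
    by (rule morphism_openin[OF m]) (simp add: openin_chart)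
  then have U: "openin (top_of ?X) ?U" by (simp add: Int_def)
  have "L \<in> ?U" using L x by (simp add: line_in_chart line_in_proj)
  moreover have "morphism ?W ?Y (\<lambda>L. line (\<lambda>k. peval (\<sigma> k) (rep L)))"
  proof (rule morphism_cong)
    have W: "is_ringed ?W" by (intro ringed_subspace ringed_proj_locus)
    show "is_function_sheaf ?W" by (rule ringed_sheaf[OF W])
    have pW: "points ?W = ?U" by (auto simp: topspace_subtopology)
    have mW: "morphism ?W (proj_space I) (\<lambda>x. x)"
      by (rule morphism_comp[OF morphism_inclusion m])
    have reg: "regular ?W (points ?W) (ratio i k)" for k
    proof -
      have "{w \<in> points ?W. w \<in> chart I i} = points ?W" unfolding pW by blast
      then show ?thesis
        using morphism_regular[OF mW _ regular_ratio, of i k]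
          openin_chart[of I i, where 'k = 'k] by (simp add: comp_def)
    qed
    show "morphism ?W ?Y (\<lambda>L. line (\<lambda>k. peval (\<sigma> k) (\<lambda>m. ratio i m L)))"
    proof (rule morphism_into_proj_locus[OF W hom0 hom(2)])
      fix M assume "M \<in> points ?W"
      then have M: "M \<in> points ?X" "M \<in> chart I i" unfolding pW by auto
      note n = normalized_point[OF hom0 hom(1) M]
      have "(\<lambda>m. ratio i m M) \<noteq> (\<lambda>_. 0)" using n(2) by (auto simp: fun_eq_iff intro: exI[of _ i])
      note z = im[OF n(1) this n(3)]
      from z show "(\<lambda>k. peval (\<sigma> k) (\<lambda>m. ratio i m M)) \<in> affine_points I"
        "\<exists>k. peval (\<sigma> k) (\<lambda>m. ratio i m M) \<noteq> 0" "on_locus {} f (\<lambda>k. peval (\<sigma> k) (\<lambda>m. ratio i m M))" by auto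
    next
      fix k show "regular ?W (points ?W) (\<lambda>L. peval (\<sigma> k) (\<lambda>m. ratio i m L))"
        by (rule regular_peval[OF W openin_topspace reg])
    qed
    fix M assume "M \<in> points ?W"
    then have M: "M \<in> points ?X" "M \<in> chart I i" unfolding pW by auto
    have "rep M i \<noteq> 0" using M(2) rep_in[of M I] unfolding chart_def by blast
    then have "(\<lambda>m. ratio i m M) = (\<lambda>m. inverse (rep M i) * rep M m)"
      by (auto simp: ratio_def divide_inverse mult.commute)
    then have "(\<lambda>k. peval (\<sigma> k) (\<lambda>m. ratio i m M)) = (\<lambda>k. inverse (rep M i) * peval (\<sigma> k) (rep M))"
      by (simp add: peval_scale[OF lin])
    then show "line (\<lambda>k. peval (\<sigma> k) (\<lambda>m. ratio i m M)) = line (\<lambda>k. peval (\<sigma> k) (rep M))"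
      using line_scale[of "inverse (rep M i)"] \<open>rep M i \<noteq> 0\<close> by simp
  qed
  ultimately show "\<exists>U. openin (top_of ?X) U \<and> L \<in> U \<and> morphism (subspace_of ?X U) ?Y (\<lambda>L. line (\<lambda>i. peval (\<sigma> i) (rep L)))"
    using U by blast
qed

lemma line_linear:
  assumes "\<And>i. homogeneous 1 (\<sigma> i)"
  shows "line (\<lambda>i. peval (\<sigma> i) (rep (line x))) = line (\<lambda>i. peval (\<sigma> i) x)"
proof -
  have "rep (line x) \<in> line x"
    unfolding rep_def using line_self by (metis someI)
  then obtain c where c: "c \<noteq> 0" "rep (line x) = (\<lambda>i. c * x i)" unfolding line_def by blast
  then show ?thesis using line_scale[OF c(1)] by (simp add: peval_scale[OF assms])
qed

lemma proj_locus_linear_isomorphic: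
  fixes f :: "('i, 'k::field) mpol" and \<sigma> \<tau> :: "'i \<Rightarrow> ('i, 'k) mpol"
  assumes hom: "homogeneous d f" and lin: "\<And>i. homogeneous 1 (\<sigma> i)" "\<And>i. homogeneous 1 (\<tau> i)"
    and im: "\<And>x. x \<in> affine_points I \<Longrightarrow> (\<lambda>i. peval (\<sigma> i) x) \<in> affine_points I"
      "\<And>x. x \<in> affine_points I \<Longrightarrow> (\<lambda>i. peval (\<tau> i) x) \<in> affine_points I"
    and inv: "\<And>x. x \<in> affine_points I \<Longrightarrow> (\<lambda>i. peval (\<sigma> i) (\<lambda>j. peval (\<tau> j) x)) = x"
      "\<And>x. x \<in> affine_points I \<Longrightarrow> (\<lambda>i. peval (\<tau> i) (\<lambda>j. peval (\<sigma> j) x)) = x"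
  shows "isomorphic (proj_locus I {} f) (proj_locus I {} (psubst \<sigma> f))"
proof -
  let ?X = "proj_locus I {} f" and ?Y = "proj_locus I {} (psubst \<sigma> f)"
  let ?s = "\<lambda>L. line (\<lambda>i. peval (\<sigma> i) (rep L))" and ?t = "\<lambda>L. line (\<lambda>i. peval (\<tau> i) (rep L))"
  have h: "all_homogeneous {f}" "all_homogeneous {psubst \<sigma> f}"
    using hom homogeneous_psubst[OF hom, of \<sigma>] lin(1) unfolding all_homogeneous_def by blast+
  have z: "(\<lambda>i. peval (\<sigma> i) (\<lambda>_. 0)) = (\<lambda>_. 0)" "(\<lambda>i. peval (\<tau> i) (\<lambda>_. 0)) = (\<lambda>_. 0)"
    using peval_scale[OF lin(1), of _ 0 "\<lambda>_. 0"] peval_scale[OF lin(2), of _ 0 "\<lambda>_. 0"] by auto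
  have "morphism ?X ?Y ?t"
  proof (rule morphism_linear[OF h(1,2) lin(2)])
    fix x :: "'i \<Rightarrow> 'k alg_closure" assume x: "x \<in> affine_points I" "x \<noteq> (\<lambda>_. 0)" "on_locus {} f x"
    have "(\<lambda>i. peval (\<tau> i) x) \<noteq> (\<lambda>_. 0)"
    proof
      assume "(\<lambda>i. peval (\<tau> i) x) = (\<lambda>_. 0)"
      with inv(1)[OF x(1)] z(1) x(2) show False by (metis (no_types, lifting))
    qed
    then show "(\<lambda>i. peval (\<tau> i) x) \<in> affine_points I \<and> (\<lambda>i. peval (\<tau> i) x) \<noteq> (\<lambda>_. 0) \<and>
        on_locus {} (psubst \<sigma> f) (\<lambda>i. peval (\<tau> i) x)"
      using im(2)[OF x(1)] x(3) by (simp add: on_locus_def peval_psubst inv(1)[OF x(1)])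
  qed
  moreover have "morphism ?Y ?X ?s"
  proof (rule morphism_linear[OF h(2,1) lin(1)])
    fix x :: "'i \<Rightarrow> 'k alg_closure" assume x: "x \<in> affine_points I" "x \<noteq> (\<lambda>_. 0)" "on_locus {} (psubst \<sigma> f) x"
    have "(\<lambda>i. peval (\<sigma> i) x) \<noteq> (\<lambda>_. 0)"
    proof
      assume "(\<lambda>i. peval (\<sigma> i) x) = (\<lambda>_. 0)"
      with inv(2)[OF x(1)] z(2) x(2) show False by (metis (no_types, lifting))
    qed
    then show "(\<lambda>i. peval (\<sigma> i) x) \<in> affine_points I \<and> (\<lambda>i. peval (\<sigma> i) x) \<noteq> (\<lambda>_. 0) \<and>
        on_locus {} f (\<lambda>i. peval (\<sigma> i) x)"
      using im(1)[OF x(1)] x(3) by (simp add: on_locus_def peval_psubst)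
  qed
  moreover have "?s (?t L) = L" if "L \<in> points ?X" for L
  proof -
    from that obtain x where x: "x \<in> affine_points I" "L = line x" by (elim proj_locusE)
    show ?thesis unfolding x(2) line_linear[OF lin(2)] line_linear[OF lin(1)] inv(1)[OF x(1)] ..
  qed
  moreover have "?t (?s L) = L" if "L \<in> points ?Y" for L
  proof -
    from that obtain x where x: "x \<in> affine_points I" "L = line x" by (elim proj_locusE)
    show ?thesis unfolding x(2) line_linear[OF lin(2)] line_linear[OF lin(1)] inv(2)[OF x(1)] ..
  qed
  ultimately show ?thesis
    unfolding isomorphic_def by (intro exI[of _ ?t] exI[of _ ?s]) auto
qed

section \<open>Determinants over finite index sets\<close>

definition leibniz_det :: "'v set \<Rightarrow> ('v \<Rightarrow> 'v \<Rightarrow> 'a::comm_ring_1) \<Rightarrow> 'a" where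
  "leibniz_det U M = (\<Sum>p | p permutes U. of_int (sign p) * (\<Prod>u\<in>U. M u (p u)))"

lemma det_cong:
  assumes "\<And>u v. u \<in> U \<Longrightarrow> v \<in> U \<Longrightarrow> M u v = N u v"
  shows "leibniz_det U M = leibniz_det U N"
  unfolding leibniz_det_def
  by (intro sum.cong prod.cong refl arg_cong2[of _ _ _ _ "(*)"]) (use assms in \<open>auto simp: permutes_in_image\<close>)

lemma det_zero_row:
  assumes "finite U" "u \<in> U" "\<And>v. v \<in> U \<Longrightarrow> M u v = 0"
  shows "leibniz_det U M = 0"
  unfolding leibniz_det_def
proof (intro sum.neutral ballI)
  fix p assume "p \<in> {p. p permutes U}"
  then have "M u (p u) = 0" using assms by (auto simp: permutes_in_image)
  then have "(\<Prod>u\<in>U. M u (p u)) = 0" using assms by (intro prod_zero) auto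
  then show "of_int (sign p) * (\<Prod>u\<in>U. M u (p u)) = 0" by simp
qed

lemma det_scale:
  assumes "finite U" "\<And>u v. u \<in> U \<Longrightarrow> v \<in> U \<Longrightarrow> N u v = s u * s v * M u v"
  shows "leibniz_det U N = (\<Prod>u\<in>U. s u) ^ 2 * leibniz_det U M"
proof -
  have "(\<Prod>u\<in>U. N u (p u)) = (\<Prod>u\<in>U. s u) ^ 2 * (\<Prod>u\<in>U. M u (p u))" if p: "p permutes U" for p
  proof -
    have "(\<Prod>u\<in>U. N u (p u)) = (\<Prod>u\<in>U. s u * s (p u) * M u (p u))"
      by (rule prod.cong) (use assms p in \<open>auto simp: permutes_in_image\<close>)
    also have "\<dots> = (\<Prod>u\<in>U. s u) * (\<Prod>u\<in>U. s (p u)) * (\<Prod>u\<in>U. M u (p u))"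
      by (simp add: prod.distrib)
    also have "(\<Prod>u\<in>U. s (p u)) = (\<Prod>u\<in>U. s u)"
      by (rule prod.permute[OF p, symmetric, unfolded comp_def])
    finally show ?thesis by (simp add: power2_eq_square mult_ac)
  qed
  then show ?thesis
    unfolding leibniz_det_def by (simp add: sum_distrib_left mult_ac)
qed

text \<open>In each term of the determinant a permutation that avoids the zero blocks exchanges \<open>U1\<close> and \<open>U2\<close>.\<close>

lemma det_bipartite:
  assumes fin: "finite U1" "finite U2" and disj: "U1 \<inter> U2 = {}" and card: "card U1 \<noteq> card U2"
    and zero: "\<And>u v. u \<in> U1 \<Longrightarrow> v \<in> U1 \<Longrightarrow> M u v = 0" "\<And>u v. u \<in> U2 \<Longrightarrow> v \<in> U2 \<Longrightarrow> M u v = 0"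
  shows "leibniz_det (U1 \<union> U2) M = 0"
  unfolding leibniz_det_def
proof (intro sum.neutral ballI)
  fix p assume "p \<in> {p. p permutes U1 \<union> U2}"
  then have p: "p permutes U1 \<union> U2" by simp
  have "\<exists>u\<in>U1 \<union> U2. M u (p u) = 0"
  proof (rule ccontr)
    assume "\<not> ?thesis"
    then have 1: "p ` U1 \<subseteq> U2" "p ` U2 \<subseteq> U1"
      using zero permutes_in_image[OF p] by blast+
    have inj: "inj_on p U1" "inj_on p U2" using permutes_inj[OF p] by (auto intro: inj_on_subset)
    have "card U1 \<le> card U2" by (rule card_inj_on_le[OF inj(1) 1(1) fin(2)])
    moreover have "card U2 \<le> card U1" by (rule card_inj_on_le[OF inj(2) 1(2) fin(1)])
    ultimately show False using card by simp
  qed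
  then have "(\<Prod>u\<in>U1 \<union> U2. M u (p u)) = 0" using fin by (intro prod_zero) auto
  then show "of_int (sign p) * (\<Prod>u\<in>U1 \<union> U2. M u (p u)) = 0" by simp
qed

text \<open>Composition with the transposition of \<open>a\<close> and \<open>b\<close> matches the even with the odd permutations and changes
  only the sign of the terms. This argument does not divide by 2, as the field may have characteristic
  2.\<close>

lemma det_identical_columns:
  assumes fin: "finite U" and ab: "a \<in> U" "b \<in> U" "a \<noteq> b" and eq: "\<And>u. u \<in> U \<Longrightarrow> M u a = M u b"
  shows "leibniz_det U M = 0"
proof -
  let ?t = "transpose a b"
  let ?P = "{p. p permutes U}"
  let ?T = "\<lambda>p. of_int (sign p) * (\<Prod>u\<in>U. M u (p u))"
  have t: "?t permutes U" using ab by (intro permutes_swap_id)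
  have perm: "permutation p" if "p permutes U" for p
    using that fin by (auto simp: permutation_permutes)
  have pt: "permutation ?t" by (rule perm[OF t])
  have tt: "?t \<circ> (?t \<circ> p) = p" for p by (auto simp: fun_eq_iff)
  have ev: "evenperm (?t \<circ> p) \<longleftrightarrow> \<not> evenperm p" if "p permutes U" for p
    using evenperm_comp[OF pt perm[OF that]] ab(3) by (simp add: evenperm_swap)
  have "?T (?t \<circ> p) = - ?T p" if p: "p permutes U" for p
  proof -
    have "M u ((?t \<circ> p) u) = M u (p u)" if "u \<in> U" for u
      using eq[OF that] by (auto simp: transpose_def)
    then have "(\<Prod>u\<in>U. M u ((?t \<circ> p) u)) = (\<Prod>u\<in>U. M u (p u))" by (intro prod.cong) auto
    moreover have "sign (?t \<circ> p) = - sign p"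
      using sign_compose[OF pt perm[OF p]] ab(3) by (simp add: sign_swap_id)
    ultimately show ?thesis by simp
  qed
  then have neg: "(\<Sum>p\<in>{p \<in> ?P. evenperm p}. ?T (?t \<circ> p)) = - (\<Sum>p\<in>{p \<in> ?P. evenperm p}. ?T p)"
    by (simp add: sum_negf)
  have bij: "bij_betw (\<lambda>p. ?t \<circ> p) {p \<in> ?P. evenperm p} {p \<in> ?P. \<not> evenperm p}"
    by (rule bij_betwI[where g = "\<lambda>p. ?t \<circ> p"])
      (use ev t tt in \<open>auto intro: permutes_compose\<close>)
  have finP: "finite ?P" by (rule finite_permutations[OF fin])
  have "leibniz_det U M = (\<Sum>p\<in>{p \<in> ?P. evenperm p}. ?T p) + (\<Sum>p\<in>{p \<in> ?P. \<not> evenperm p}. ?T p)"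
    unfolding leibniz_det_def by (subst sum.union_disjoint[symmetric]) (use finP in \<open>auto intro: sum.cong\<close>)
  also have "(\<Sum>p\<in>{p \<in> ?P. \<not> evenperm p}. ?T p) = (\<Sum>p\<in>{p \<in> ?P. evenperm p}. ?T (?t \<circ> p))"
    by (rule sum.reindex_bij_betw[OF bij, symmetric])
  finally show ?thesis unfolding neg by simp
qed

text \<open>The determinant is additive in the column \<open>z\<close>. Replacing this column by the sum of the columns in
  \<open>Z\<close> gives 0 on the one hand, and on the other hand the original determinant, since all other summands
  have two equal columns.\<close>

lemma det_dependent_columns:
  fixes M :: "'v \<Rightarrow> 'v \<Rightarrow> 'a::comm_ring_1"
  assumes fin: "finite U" and Z: "Z \<subseteq> U" "Z \<noteq> {}" and dep: "\<And>u. u \<in> U \<Longrightarrow> (\<Sum>v\<in>Z. M u v) = 0"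
  shows "leibniz_det U M = 0"
proof -
  obtain z where z: "z \<in> Z" using Z by blast
  have zU: "z \<in> U" and finZ: "finite Z" using z Z fin finite_subset by auto
  define F where "F c = leibniz_det U (\<lambda>u v. if v = z then c u else M u v)" for c :: "'v \<Rightarrow> 'a"
  have expand: "F c = (\<Sum>p | p permutes U. c (inv_into UNIV p z) * (of_int (sign p) * (\<Prod>u\<in>U - {inv_into UNIV p z}. M u (p u))))" for c
    unfolding F_def leibniz_det_def
  proof (rule sum.cong[OF refl])
    fix p assume "p \<in> {p. p permutes U}"
    then have p: "p permutes U" by simp
    have q: "inv_into UNIV p z \<in> U" using permutes_in_image[OF permutes_inv[OF p]] zU by blast
    have "(\<Prod>u\<in>U. if p u = z then c u else M u (p u)) =
        (if p (inv_into UNIV p z) = z then c (inv_into UNIV p z) else M (inv_into UNIV p z) (p (inv_into UNIV p z))) * (\<Prod>u\<in>U - {inv_into UNIV p z}. if p u = z then c u else M u (p u))"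
      by (rule prod.remove[OF fin q])
    also have "(\<Prod>u\<in>U - {inv_into UNIV p z}. if p u = z then c u else M u (p u)) = (\<Prod>u\<in>U - {inv_into UNIV p z}. M u (p u))"
      by (rule prod.cong) (use permutes_inverses[OF p] in auto)
    finally show "of_int (sign p) * (\<Prod>u\<in>U. if p u = z then c u else M u (p u)) =
        c (inv_into UNIV p z) * (of_int (sign p) * (\<Prod>u\<in>U - {inv_into UNIV p z}. M u (p u)))"
      using permutes_inverses[OF p] by (simp add: mult_ac)
  qed
  have cong: "F c = F c'" if "\<And>u. u \<in> U \<Longrightarrow> c u = c' u" for c c'
    unfolding F_def by (rule det_cong) (use that in auto)
  have add: "F (\<lambda>u. \<Sum>v\<in>Z. M u v) = (\<Sum>v\<in>Z. F (\<lambda>u. M u v))"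
    unfolding expand sum_distrib_right by (rule sum.swap)
  have "F (\<lambda>u. \<Sum>v\<in>Z. M u v) = F (\<lambda>_. 0)" by (rule cong) (rule dep)
  also have "\<dots> = 0" unfolding expand by simp
  finally have "(\<Sum>v\<in>Z. F (\<lambda>u. M u v)) = 0" unfolding add .
  moreover have "F (\<lambda>u. M u v) = 0" if "v \<in> Z - {z}" for v
    unfolding F_def by (rule det_identical_columns[OF fin zU, of v]) (use that Z in auto)
  ultimately have "F (\<lambda>u. M u z) = 0"
    by (simp add: sum.remove[OF finZ z])
  then show ?thesis
    unfolding F_def by (subst (asm) det_cong[of U _ M]) auto
qed

section \<open>The matrix-tree theorem\<close>

definition other_end :: "('v, 'e) mgraph \<Rightarrow> 'e \<Rightarrow> 'v \<Rightarrow> 'v" where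
  "other_end G e u = (THE v. ends G e = {u, v})"

definition links :: "('v, 'e) mgraph \<Rightarrow> 'v \<Rightarrow> 'e set" where
  "links G u = {e \<in> edges G. \<not> is_loop G e \<and> u \<in> ends G e}"

definition laplacian :: "('v, 'e) mgraph \<Rightarrow> ('e \<Rightarrow> 'a::comm_ring_1) \<Rightarrow> 'v \<Rightarrow> 'v \<Rightarrow> 'a" where
  "laplacian G x u v = (if u = v then \<Sum>e\<in>links G u. x e else - (\<Sum>e\<in>{e \<in> edges G. ends G e = {u, v}}. x e))"

locale finite_graph =
  fixes G :: "('v, 'e) mgraph"
  assumes graph: "is_graph G"
begin

abbreviation "E \<equiv> edges G"
abbreviation "V \<equiv> verts G"

lemma finite_E: "finite E" and finite_V: "finite V"
  using graph by (auto simp: is_graph_def)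

lemma edge_ends:
  assumes "e \<in> E"
  obtains u v where "ends G e = {u, v}" "u \<in> V" "v \<in> V"
proof -
  from assms graph have s: "ends G e \<subseteq> V" and c: "card (ends G e) = 1 \<or> card (ends G e) = 2"
    by (auto simp: is_graph_def)
  from c show thesis
  proof
    assume "card (ends G e) = 1"
    then obtain u where "ends G e = {u}" by (auto simp: card_1_singleton_iff)
    then show thesis using that[of u u] s by simp
  next
    assume "card (ends G e) = 2"
    then obtain u v where "ends G e = {u, v}" by (auto simp: card_2_iff)
    then show thesis using that[of u v] s by simp
  qed
qed

lemma link_ends:
  assumes "e \<in> links G u"
  shows "ends G e = {u, other_end G e u}" "other_end G e u \<noteq> u" "other_end G e u \<in> V" "u \<in> V" "e \<in> E"
proof -
  from assms have e: "e \<in> E" "\<not> is_loop G e" "u \<in> ends G e" by (auto simp: links_def)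
  from e(1) obtain a b where ab: "ends G e = {a, b}" "a \<in> V" "b \<in> V" by (rule edge_ends)
  have "a \<noteq> b" using e(2) ab(1) by (auto simp: is_loop_def)
  then obtain v where v: "ends G e = {u, v}" "u \<noteq> v" "v \<in> V" "u \<in> V" using e(3) ab by auto
  then have "other_end G e u = v"
    unfolding other_end_def by (intro the_equality) (auto simp: doubleton_eq_iff)
  then show "ends G e = {u, other_end G e u}" "other_end G e u \<noteq> u" "other_end G e u \<in> V" "u \<in> V" "e \<in> E"
    using v e by auto
qed

lemma linksI: "e \<in> E \<Longrightarrow> ends G e = {u, v} \<Longrightarrow> u \<noteq> v \<Longrightarrow> e \<in> links G u \<and> other_end G e u = v"
  unfolding links_def other_end_def is_loop_def by (auto intro!: the_equality simp: doubleton_eq_iff)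

lemma finite_links: "finite (links G u)"
  using finite_E by (simp add: links_def)

text \<open>Following the chosen links leads outside of \<open>U\<close> from everywhere. In terms of sets, this says
  that no nonempty subset of \<open>U\<close> is mapped to itself by the step along the chosen link, a form which
  spares the iteration of steps.\<close>

definition acyclic_choice :: "'v set \<Rightarrow> ('v \<Rightarrow> 'e) \<Rightarrow> bool" where
  "acyclic_choice U f \<longleftrightarrow> (\<forall>Z. Z \<subseteq> U \<and> Z \<noteq> {} \<longrightarrow> (\<exists>u\<in>Z. other_end G (f u) u \<notin> Z))"

text \<open>This is the matrix with the entry 1 on the diagonal and, in each row, the entry -1 at the other end of
  the chosen link, if that end lies in \<open>U\<close>. If the choice is acyclic, then only the identity contributes: the
  vertices moved by another contributing permutation would be an invariant set. If not, then the
  columns in the largest invariant set sum to 0, because a chosen link enters that set only from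
  inside.\<close>

lemma det_choice:
  assumes U: "finite U" and f: "\<And>u. u \<in> U \<Longrightarrow> f u \<in> links G u"
  shows "leibniz_det U (\<lambda>u v. if v = u then 1 else if v = other_end G (f u) u then - 1 else 0) =
    (if acyclic_choice U f then 1 else 0 :: 'a::comm_ring_1)"
proof -
  let ?g = "\<lambda>u. other_end G (f u) u"
  let ?N = "\<lambda>u v. if v = u then 1 else if v = ?g u then - 1 else 0 :: 'a"
  have g: "?g u \<noteq> u" if "u \<in> U" for u using link_ends(2)[OF f[OF that]] .
  show ?thesis
  proof (cases "acyclic_choice U f")
    case True
    have "(\<Prod>u\<in>U. ?N u (p u)) = 0" if p: "p permutes U" "p \<noteq> id" for p
    proof (rule ccontr)
      assume nz: "(\<Prod>u\<in>U. ?N u (p u)) \<noteq> 0"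
      have *: "p u = u \<or> p u = ?g u" if "u \<in> U" for u
      proof (rule ccontr)
        assume "\<not> (p u = u \<or> p u = ?g u)"
        then have "?N u (p u) = 0" by simp
        then have "(\<Prod>u\<in>U. ?N u (p u)) = 0" by (rule prod_zero[OF U bexI]) (rule that)
        with nz show False by contradiction
      qed
      let ?Z = "{u \<in> U. p u \<noteq> u}"
      have "?Z \<noteq> {}"
      proof
        assume "?Z = {}"
        then have "p u = u" for u using p(1) by (cases "u \<in> U") (auto simp: permutes_def)
        then show False using p(2) by auto
      qed
      then obtain u where u: "u \<in> ?Z" "?g u \<notin> ?Z"
        using True[unfolded acyclic_choice_def, rule_format, of ?Z] by blast
      then have gp: "?g u = p u" using *[of u] by auto
      have "p u \<in> U" using u permutes_in_image[OF p(1)] by blast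
      moreover have "p (p u) \<noteq> p u" using u permutes_inj[OF p(1)] by (auto dest: injD)
      ultimately show False using u(2) gp by simp
    qed
    then have "leibniz_det U ?N = (\<Sum>p\<in>{id}. of_int (sign p) * (\<Prod>u\<in>U. ?N u (p u)))"
      unfolding leibniz_det_def
      by (intro sum.mono_neutral_right) (auto simp: finite_permutations[OF U] permutes_id)
    then show ?thesis using True by simp
  next
    case False
    let ?inv = "\<lambda>Z. Z \<subseteq> U \<and> (\<forall>u\<in>Z. ?g u \<in> Z)"
    \<comment> \<open>The largest invariant set.\<close>
    define Z where "Z = \<Union>{Z. ?inv Z}"
    have Z: "?inv Z" unfolding Z_def by blast
    have "Z \<noteq> {}" using False unfolding acyclic_choice_def Z_def by blast
    moreover have "(\<Sum>v\<in>Z. ?N u v) = 0" if u: "u \<in> U" for u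
    proof (cases "u \<in> Z")
      case True
      have finZ: "finite Z" using Z U finite_subset by blast
      have gu: "?g u \<in> Z" using True Z by blast
      have gu': "?g u \<in> Z - {u}" using gu g[OF u] by blast
      have "(\<Sum>v\<in>Z. ?N u v) = 1 + (\<Sum>v\<in>Z - {u}. ?N u v)"
        by (subst sum.remove[OF finZ True]) simp
      also have "(\<Sum>v\<in>Z - {u}. ?N u v) = - 1 + (\<Sum>v\<in>Z - {u} - {?g u}. ?N u v)"
        using gu' finZ by (subst sum.remove[of _ "?g u"]) auto
      also have "(\<Sum>v\<in>Z - {u} - {?g u}. ?N u v) = 0" by (rule sum.neutral) auto
      finally show ?thesis by simp
    next
      case False
      have "?g u \<notin> Z"
      proof
        assume "?g u \<in> Z"
        then have "?inv (insert u Z)" using Z u by auto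
        then have "insert u Z \<subseteq> Z" unfolding Z_def by blast
        with False show False by blast
      qed
      with False show ?thesis by (intro sum.neutral) auto
    qed
    ultimately have "leibniz_det U ?N = 0" using Z by (intro det_dependent_columns[OF U, of Z]) auto
    then show ?thesis using False by simp
  qed
qed

text \<open>Each row of the Laplacian is a sum over the links at its vertex. Expanding all rows turns the
  determinant into a sum over the choices of one link at each vertex.\<close>

lemma det_laplacian:
  fixes x :: "'e \<Rightarrow> 'a::comm_ring_1"
  assumes U: "finite U"
  shows "leibniz_det U (laplacian G x) =
    (\<Sum>f\<in>{f \<in> PiE U (links G). acyclic_choice U f}. \<Prod>u\<in>U. x (f u))"
proof -
  let ?N = "\<lambda>e u v. if v = u then 1 else if v = other_end G e u then - 1 else 0 :: 'a"
  have lap: "laplacian G x u v = (\<Sum>e\<in>links G u. x e * ?N e u v)" for u v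
  proof (cases "v = u")
    case True
    then show ?thesis by (simp add: laplacian_def)
  next
    case False
    have "(\<Sum>e\<in>links G u. x e * ?N e u v) = (\<Sum>e\<in>links G u. if v = other_end G e u then - x e else 0)"
      by (rule sum.cong) (use False in auto)
    also have "\<dots> = (\<Sum>e\<in>{e \<in> links G u. v = other_end G e u}. - x e)"
      by (rule sum.inter_filter[OF finite_links, symmetric])
    also have "{e \<in> links G u. v = other_end G e u} = {e \<in> E. ends G e = {u, v}}"
      using linksI[of _ u v] link_ends(1,5) False by blast
    finally show ?thesis using False by (simp add: laplacian_def sum_negf)
  qed
  have "leibniz_det U (laplacian G x) = (\<Sum>p | p permutes U. \<Sum>f\<in>PiE U (links G).
      of_int (sign p) * (\<Prod>u\<in>U. x (f u) * ?N (f u) u (p u)))"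
    unfolding leibniz_det_def lap by (simp add: prod_sum_PiE[OF U finite_links] sum_distrib_left)
  also have "\<dots> = (\<Sum>f\<in>PiE U (links G). \<Sum>p | p permutes U.
      of_int (sign p) * (\<Prod>u\<in>U. x (f u) * ?N (f u) u (p u)))"
    by (rule sum.swap)
  also have "\<dots> = (\<Sum>f\<in>PiE U (links G). (\<Prod>u\<in>U. x (f u)) * leibniz_det U (\<lambda>u v. ?N (f u) u v))"
    unfolding leibniz_det_def sum_distrib_left prod.distrib by (intro sum.cong refl) (simp only: mult_ac)
  also have "\<dots> = (\<Sum>f\<in>PiE U (links G). if acyclic_choice U f then \<Prod>u\<in>U. x (f u) else 0)"
  proof (rule sum.cong[OF refl])
    fix f assume f: "f \<in> PiE U (links G)"
    have "leibniz_det U (\<lambda>u v. ?N (f u) u v) = (if acyclic_choice U f then 1 else 0 :: 'a)"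
      by (rule det_choice[OF U]) (use f in auto)
    then show "(\<Prod>u\<in>U. x (f u)) * leibniz_det U (\<lambda>u v. ?N (f u) u v) =
        (if acyclic_choice U f then \<Prod>u\<in>U. x (f u) else 0)" by simp
  qed
  also have "\<dots> = (\<Sum>f\<in>{f \<in> PiE U (links G). acyclic_choice U f}. \<Prod>u\<in>U. x (f u))"
    by (rule sum.inter_filter[symmetric]) (intro finite_PiE U finite_links)
  finally show ?thesis .
qed

subsection \<open>Paths and cycles\<close>

definition adj :: "'e set \<Rightarrow> ('v \<times> 'v) set" where
  "adj T = {(u, w). \<exists>e\<in>T. ends G e = {u, w}}"

lemma adj_E: "adj E = adjacency G"
  by (simp add: adj_def adjacency_def)

lemma adj_mono: "S \<subseteq> T \<Longrightarrow> (adj S)\<^sup>* \<subseteq> (adj T)\<^sup>*"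
  by (intro rtrancl_mono) (auto simp: adj_def)

lemma adj_sym: "(a, b) \<in> (adj T)\<^sup>* \<Longrightarrow> (b, a) \<in> (adj T)\<^sup>*"
proof -
  have "sym (adj T)" by (auto simp: sym_def adj_def insert_commute)
  then show "(a, b) \<in> (adj T)\<^sup>* \<Longrightarrow> (b, a) \<in> (adj T)\<^sup>*"
    using sym_rtrancl by (metis symD)
qed

text \<open>A path is extended at its beginning. If the new vertex already lies on the path, then the part of
  the path from there on is taken instead.\<close>

lemma path_exists:
  assumes "(a, b) \<in> (adj T)\<^sup>*"
  shows "\<exists>vs es. vs \<noteq> [] \<and> distinct vs \<and> hd vs = a \<and> last vs = b \<and> length vs = Suc (length es) \<and>
    set es \<subseteq> T \<and> (\<forall>k<length es. ends G (es ! k) = {vs ! k, vs ! Suc k})"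
  using assms
proof (induction rule: converse_rtrancl_induct)
  case base
  show ?case by (rule exI[of _ "[b]"], rule exI[of _ "[]"]) simp
next
  case (step a c)
  then obtain vs es where p: "vs \<noteq> []" "distinct vs" "hd vs = c" "last vs = b" "length vs = Suc (length es)"
    "set es \<subseteq> T" "\<forall>k<length es. ends G (es ! k) = {vs ! k, vs ! Suc k}" by blast
  from step(1) obtain e where e: "e \<in> T" "ends G e = {a, c}" by (auto simp: adj_def)
  show ?case
  proof (cases "a \<in> set vs")
    case True
    then obtain i where i: "i < length vs" "vs ! i = a" by (auto simp: in_set_conv_nth)
    show ?thesis
    proof (intro exI[of _ "drop i vs"] exI[of _ "drop i es"] conjI)
      show "drop i vs \<noteq> []" using i by simp
      show "distinct (drop i vs)" using p(2) by simp
      show "hd (drop i vs) = a" using i by (simp add: hd_drop_conv_nth)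
      show "last (drop i vs) = b" using i p(4) by simp
      show "length (drop i vs) = Suc (length (drop i es))" using i p(5) by simp
      show "set (drop i es) \<subseteq> T" using p(6) set_drop_subset[of i es] by blast
      show "\<forall>k<length (drop i es). ends G (drop i es ! k) = {drop i vs ! k, drop i vs ! Suc k}"
        using p(5,7) i by auto
    qed
  next
    case False
    show ?thesis
    proof (intro exI[of _ "a # vs"] exI[of _ "e # es"] conjI)
      show "\<forall>k<length (e # es). ends G ((e # es) ! k) = {(a # vs) ! k, (a # vs) ! Suc k}"
      proof (intro allI impI)
        fix k assume "k < length (e # es)"
        then show "ends G ((e # es) ! k) = {(a # vs) ! k, (a # vs) ! Suc k}"
          using p(1,3,7) e by (cases k) (auto simp: hd_conv_nth)
      qed
    qed (use False p e in auto)
  qed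
qed

lemma path_closes_to_cycle:
  assumes ab: "(a, b) \<in> (adj T)\<^sup>*" and T: "T \<subseteq> E" and e: "e \<in> E" "e \<notin> T" "ends G e = {a, b}"
  shows "\<exists>vs es. is_cycle G vs es \<and> set es \<subseteq> insert e T"
proof -
  from path_exists[OF ab] obtain vs es where p: "vs \<noteq> []" "distinct vs" "hd vs = a" "last vs = b"
    "length vs = Suc (length es)" "set es \<subseteq> T" "\<forall>k<length es. ends G (es ! k) = {vs ! k, vs ! Suc k}" by blast
  have "distinct es"
    unfolding distinct_conv_nth
  proof (intro allI impI)
    fix i j assume ij: "i < length es" "j < length es" "i \<noteq> j"
    show "es ! i \<noteq> es ! j"
    proof
      assume "es ! i = es ! j"
      then have "{vs ! i, vs ! Suc i} = {vs ! j, vs ! Suc j}" using p(7) ij by metis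
      then show False using ij p(2,5) by (auto simp: doubleton_eq_iff nth_eq_iff_index_eq)
    qed
  qed
  then have "is_cycle G vs (es @ [e])"
    unfolding is_cycle_def
  proof (intro conjI allI impI)
    fix k assume "k < length (es @ [e])"
    then consider "k < length es" | "k = length es" by fastforce
    then show "ends G ((es @ [e]) ! k) = {vs ! k, vs ! (Suc k mod length (es @ [e]))}"
    proof cases
      case 1
      then show ?thesis using p(7) by (simp add: nth_append)
    next
      case 2
      have "vs ! length es = b" using p(1,4,5) by (simp add: last_conv_nth)
      moreover have "vs ! 0 = a" using p(1,3) by (simp add: hd_conv_nth)
      ultimately show ?thesis using 2 e(3) by (simp add: insert_commute)
    qed
  qed (use p T e in auto)
  then show ?thesis using p(6) by (intro exI[of _ vs] exI[of _ "es @ [e]"]) auto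
qed

text \<open>Run around the cycle, starting behind \<open>e\<close> and ending in front of it.\<close>

lemma cycle_connects_ends:
  assumes c: "is_cycle G vs es" "set es \<subseteq> insert e T" "e \<in> set es" and e: "ends G e = {a, b}"
  shows "(a, b) \<in> (adj T)\<^sup>*"
proof -
  define l where "l = length es"
  from c(3) obtain k where k: "k < l" "es ! k = e" by (auto simp: in_set_conv_nth l_def)
  have l0: "l > 0" using k by simp
  have cyc: "ends G (es ! j) = {vs ! j, vs ! (Suc j mod l)}" if "j < l" for j
    using c(1) that by (simp add: is_cycle_def l_def)
  have dist: "distinct es" using c(1) by (simp add: is_cycle_def)
  have "m < l \<Longrightarrow> (vs ! (Suc k mod l), vs ! ((Suc k + m) mod l)) \<in> (adj T)\<^sup>*" for m
  proof (induction m)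
    case 0
    show ?case by simp
  next
    case (Suc m)
    let ?j = "(Suc k + m) mod l"
    have j: "?j < l" using l0 by simp
    have "?j \<noteq> k"
    proof (cases "Suc k + m < l")
      case False
      then have "?j = Suc k + m - l" using k Suc.prems by (simp add: mod_if)
      then show ?thesis using Suc.prems False by linarith
    qed simp
    then have "es ! ?j \<noteq> e" using dist j k by (metis l_def nth_eq_iff_index_eq)
    moreover have "es ! ?j \<in> set es" using j by (simp add: l_def)
    ultimately have "es ! ?j \<in> T" using c(2) by blast
    moreover have "Suc ?j mod l = (Suc k + Suc m) mod l" by (simp add: mod_Suc_eq)
    ultimately have "(vs ! ?j, vs ! ((Suc k + Suc m) mod l)) \<in> adj T"
      using cyc[OF j] unfolding adj_def by force
    with Suc show ?case by (meson Suc_lessD rtrancl.rtrancl_into_rtrancl)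
  qed
  from this[of "l - 1"] have "(vs ! (Suc k mod l), vs ! k) \<in> (adj T)\<^sup>*"
    using k by simp
  moreover have "{a, b} = {vs ! k, vs ! (Suc k mod l)}" using cyc[OF k(1)] k(2) e by simp
  ultimately show ?thesis using adj_sym by (auto simp: doubleton_eq_iff)
qed

end

context finite_graph
begin

subsection \<open>Spanning forests as acyclic choices\<close>

text \<open>The set \<open>U\<close> misses exactly one vertex, the root, of each connected component. The maximal
  forests can then be oriented towards the roots, and they correspond to the acyclic choices of
  links at the vertices of \<open>U\<close>. Isolated vertices are their own roots, so no connectedness is imposed.\<close>

definition cotransversal :: "'v set \<Rightarrow> bool" where
  "cotransversal U \<longleftrightarrow> U \<subseteq> V \<and> (\<forall>u\<in>U. \<exists>r\<in>V - U. (u, r) \<in> (adjacency G)\<^sup>*) \<and>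
     (\<forall>r\<in>V - U. \<forall>s\<in>V - U. (r, s) \<in> (adjacency G)\<^sup>* \<longrightarrow> r = s)"

lemma acyclic_choice_reaches:
  assumes f: "\<And>u. u \<in> U \<Longrightarrow> f u \<in> links G u" and ac: "acyclic_choice U f" and u: "u \<in> V"
  shows "\<exists>r\<in>V - U. (u, r) \<in> (adj (f ` U))\<^sup>*"
proof (cases "u \<in> U")
  case False
  then show ?thesis using u by blast
next
  case True
  let ?Z = "{u \<in> U. \<not> (\<exists>r\<in>V - U. (u, r) \<in> (adj (f ` U))\<^sup>*)}"
  have "\<not> (\<exists>u\<in>?Z. other_end G (f u) u \<notin> ?Z)"
  proof
    assume "\<exists>u\<in>?Z. other_end G (f u) u \<notin> ?Z"
    then obtain u where u: "u \<in> ?Z" "other_end G (f u) u \<notin> ?Z" by blast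
    let ?v = "other_end G (f u) u"
    have uU: "u \<in> U" using u by blast
    note l = link_ends[OF f[OF uU]]
    have uv: "(u, ?v) \<in> adj (f ` U)" unfolding adj_def using l(1) uU by blast
    have "\<exists>r\<in>V - U. (?v, r) \<in> (adj (f ` U))\<^sup>*" using u(2) l(3) by blast
    then obtain r where "r \<in> V - U" "(?v, r) \<in> (adj (f ` U))\<^sup>*" by blast
    with uv have "(u, r) \<in> (adj (f ` U))\<^sup>*" by (meson converse_rtrancl_into_rtrancl)
    with u(1) \<open>r \<in> V - U\<close> show False by blast
  qed
  then have "?Z = {}" using ac unfolding acyclic_choice_def by (metis (no_types, lifting) mem_Collect_eq subsetI)
  then show ?thesis using True by blast
qed

lemma acyclic_choice_inj:
  assumes f: "\<And>u. u \<in> U \<Longrightarrow> f u \<in> links G u" and ac: "acyclic_choice U f"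
  shows "inj_on f U"
proof (rule inj_onI, rule ccontr)
  fix u v assume uv: "u \<in> U" "v \<in> U" "f u = f v" "u \<noteq> v"
  have "{u, other_end G (f u) u} = {v, other_end G (f v) v}"
    using link_ends(1)[OF f[OF uv(1)]] link_ends(1)[OF f[OF uv(2)]] uv(3) by simp
  then have "other_end G (f u) u = v" "other_end G (f v) v = u"
    using uv(4) by (auto simp: doubleton_eq_iff)
  then show False
    using ac[unfolded acyclic_choice_def, rule_format, of "{u, v}"] uv by auto
qed

text \<open>A cycle of chosen links has as many links as vertices, and each of them was chosen at a vertex of the
  cycle. So all vertices of the cycle lie in \<open>U\<close>, and they form an invariant set.\<close>

lemma acyclic_choice_forest:
  assumes f: "\<And>u. u \<in> U \<Longrightarrow> f u \<in> links G u" and ac: "acyclic_choice U f"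
  shows "is_forest G (f ` U)"
  unfolding is_forest_def
proof (intro conjI notI)
  show "f ` U \<subseteq> E" using link_ends(5)[OF f] by blast
  assume "\<exists>vs es. is_cycle G vs es \<and> set es \<subseteq> f ` U"
  then obtain vs es where c: "is_cycle G vs es" "set es \<subseteq> f ` U" by blast
  define l where "l = length es"
  have l: "l > 0" "length vs = l" "distinct vs" "distinct es"
    and cyc: "\<And>k. k < l \<Longrightarrow> ends G (es ! k) = {vs ! k, vs ! (Suc k mod l)}"
    using c(1) by (auto simp: is_cycle_def l_def)
  have "\<exists>u\<in>U. f u = es ! k" if "k < l" for k
  proof -
    have "es ! k \<in> set es" using that by (simp add: l_def)
    then show ?thesis using c(2) by force
  qed
  \<comment> \<open>\<open>h k\<close> is the vertex at which the \<open>k\<close>-th link of the cycle was chosen.\<close>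
  then obtain h where h: "\<And>k. k < l \<Longrightarrow> h k \<in> U \<and> f (h k) = es ! k" by metis
  have in_vs: "vs ! k \<in> set vs" "vs ! (Suc k mod l) \<in> set vs" if "k < l" for k
    using that l by simp_all
  have hvs: "h k \<in> set vs" if "k < l" for k
  proof -
    have "h k \<in> ends G (es ! k)" using link_ends(1)[OF f, of "h k"] h[OF that] by auto
    then show ?thesis using cyc[OF that] in_vs[OF that] by auto
  qed
  have "inj_on h {..<l}"
  proof (rule inj_onI)
    fix i j assume "i \<in> {..<l}" "j \<in> {..<l}" "h i = h j"
    then have "es ! i = es ! j" "i < l" "j < l" using h by (metis lessThan_iff)+
    then show "i = j" using l(4) by (simp add: nth_eq_iff_index_eq l_def)
  qed
  then have "card (h ` {..<l}) = card (set vs)" using l distinct_card[OF l(3)] by (simp add: card_image)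
  moreover have "h ` {..<l} \<subseteq> set vs" using hvs by blast
  ultimately have img: "h ` {..<l} = set vs" by (intro card_subset_eq) auto
  have "set vs \<subseteq> U" unfolding img[symmetric] using h by auto
  moreover have "set vs \<noteq> {}" using l by auto
  moreover have "other_end G (f v) v \<in> set vs" if "v \<in> set vs" for v
  proof -
    from that img obtain k where k: "k < l" "v = h k" by blast
    have "{v, other_end G (f v) v} = {vs ! k, vs ! (Suc k mod l)}"
      using link_ends(1)[OF f, of v] h[OF k(1)] cyc[OF k(1)] k(2) by simp
    then show ?thesis using in_vs[OF k(1)] by (auto simp: doubleton_eq_iff)
  qed
  ultimately show False using ac unfolding acyclic_choice_def by blast
qed

text \<open>Both ends of \<open>e\<close> are joined by chosen links to the root of their common component, hence to each
  other.\<close>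

lemma acyclic_choice_maximal:
  assumes U: "cotransversal U"
    and f: "\<And>u. u \<in> U \<Longrightarrow> f u \<in> links G u" and ac: "acyclic_choice U f"
    and e: "e \<in> E" "e \<notin> f ` U"
  shows "\<exists>vs es. is_cycle G vs es \<and> set es \<subseteq> insert e (f ` U)"
proof -
  have fE: "f ` U \<subseteq> E" using link_ends(5)[OF f] by blast
  from e(1) obtain a b where ab: "ends G e = {a, b}" "a \<in> V" "b \<in> V" by (rule edge_ends)
  obtain r where r: "r \<in> V - U" "(a, r) \<in> (adj (f ` U))\<^sup>*"
    using acyclic_choice_reaches[OF f ac ab(2)] by blast
  obtain s where s: "s \<in> V - U" "(b, s) \<in> (adj (f ` U))\<^sup>*"
    using acyclic_choice_reaches[OF f ac ab(3)] by blast
  have sub: "(adj (f ` U))\<^sup>* \<subseteq> (adjacency G)\<^sup>*"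
    using adj_mono[OF fE] by (simp add: adj_E)
  have "(a, b) \<in> (adjacency G)\<^sup>*"
    using e(1) ab(1) by (auto simp: adjacency_def)
  then have "(r, s) \<in> (adjacency G)\<^sup>*"
    using adj_sym[of a r "f ` U"] r(2) s(2) sub by (meson rtrancl_trans subsetD)
  then have "r = s" using U r(1) s(1) unfolding cotransversal_def by blast
  then have "(a, b) \<in> (adj (f ` U))\<^sup>*"
    using r(2) adj_sym[OF s(2)] by simp
  then show ?thesis by (rule path_closes_to_cycle[OF _ fE e ab(1)])
qed

text \<open>If two choices with the same links differ at \<open>v\<close>, then the second one chooses \<open>f v\<close> at the other end of
  that link, so they also differ there. The vertices where they differ would be an invariant set.\<close>

lemma acyclic_choice_unique:
  assumes f: "\<And>u. u \<in> U \<Longrightarrow> f u \<in> links G u" and ac: "acyclic_choice U f"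
    and f': "\<And>u. u \<in> U \<Longrightarrow> f' u \<in> links G u" and ac': "acyclic_choice U f'"
    and eq: "f ` U = f' ` U" and u: "u \<in> U"
  shows "f u = f' u"
proof (rule ccontr)
  assume ne: "f u \<noteq> f' u"
  let ?Z = "{u \<in> U. f u \<noteq> f' u}"
  have "other_end G (f v) v \<in> ?Z" if v: "v \<in> ?Z" for v
  proof -
    have "f v \<in> f' ` U" using v eq by blast
    then obtain w where w: "w \<in> U" "f' w = f v" by (metis imageE)
    have wv: "w \<noteq> v" using v w by auto
    have "{v, other_end G (f v) v} = {w, other_end G (f' w) w}"
      using link_ends(1)[OF f, of v] link_ends(1)[OF f', of w] v w by simp
    then have ow: "other_end G (f v) v = w" using wv by (auto simp: doubleton_eq_iff)
    have "f w \<noteq> f v" using acyclic_choice_inj[OF f ac] v w(1) wv by (auto dest: inj_onD)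
    then show ?thesis unfolding ow using w by simp
  qed
  moreover have "?Z \<noteq> {}" using u ne by blast
  ultimately show False using ac unfolding acyclic_choice_def by (metis (no_types, lifting) mem_Collect_eq subsetI)
qed

text \<open>Choose at each vertex a link that decreases the distance to the roots.\<close>

lemma connecting_set_has_choice:
  assumes T: "T \<subseteq> E" and conn: "\<And>u. u \<in> U \<Longrightarrow> \<exists>r\<in>V - U. (u, r) \<in> (adj T)\<^sup>*"
  shows "\<exists>f. (\<forall>u\<in>U. f u \<in> links G u) \<and> acyclic_choice U f \<and> f ` U \<subseteq> T"
proof -
  define far where "far n u \<longleftrightarrow> (\<exists>r\<in>V - U. (u, r) \<in> adj T ^^ n)" for n u
  define d where "d u = (LEAST n. far n u)" for u
  have dfar: "far (d u) u" if "u \<in> U" for u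
  proof -
    from conn[OF that] obtain r n where "r \<in> V - U" "(u, r) \<in> adj T ^^ n"
      using rtrancl_imp_relpow by metis
    then have "far n u" unfolding far_def by blast
    then show ?thesis unfolding d_def by (rule LeastI)
  qed
  have "\<exists>e w. e \<in> T \<and> ends G e = {u, w} \<and> d w < d u" if u: "u \<in> U" for u
  proof -
    obtain r where r: "r \<in> V - U" "(u, r) \<in> adj T ^^ d u" using dfar[OF u] unfolding far_def by blast
    have "d u \<noteq> 0" using r u by (metis DiffD2 relpow_0_E)
    then obtain m where m: "d u = Suc m" by (cases "d u") auto
    with r(2) obtain w where w: "(u, w) \<in> adj T" "(w, r) \<in> adj T ^^ m" by (metis relpow_Suc_D2)
    then have "far m w" unfolding far_def using r(1) by blast
    then have "d w \<le> m" unfolding d_def by (rule Least_le)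
    then show ?thesis using w(1) m unfolding adj_def by fastforce
  qed
  then obtain f g where fg: "\<And>u. u \<in> U \<Longrightarrow> f u \<in> T \<and> ends G (f u) = {u, g u} \<and> d (g u) < d u" by metis
  have fl: "f u \<in> links G u \<and> other_end G (f u) u = g u" if "u \<in> U" for u
  proof -
    have "u \<noteq> g u" using fg[OF that] by (metis less_irrefl)
    then show ?thesis using linksI[of "f u" u "g u"] fg[OF that] T by blast
  qed
  have "acyclic_choice U f"
    unfolding acyclic_choice_def
  proof (intro allI impI)
    fix Z assume Z: "Z \<subseteq> U \<and> Z \<noteq> {}"
    then obtain z where "z \<in> Z" by blast
    from ex_has_least_nat[of "\<lambda>z. z \<in> Z", OF this, of d] obtain u where u: "u \<in> Z" "\<forall>y. y \<in> Z \<longrightarrow> d u \<le> d y"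
      by blast
    have "g u \<notin> Z" using u fg[of u] Z by (metis leD subsetD)
    then show "\<exists>u\<in>Z. other_end G (f u) u \<notin> Z" using u(1) fl[of u] Z by (metis subsetD)
  qed
  moreover have "f ` U \<subseteq> T" using fg by blast
  ultimately show ?thesis using fl by blast
qed

text \<open>By maximality, an edge that is not in \<open>T\<close> closes a cycle with edges of \<open>T\<close>.\<close>

lemma spanning_forest_connects:
  assumes T: "T \<in> spanning_forests G"
  shows "(adjacency G)\<^sup>* \<subseteq> (adj T)\<^sup>*"
proof -
  have forT: "is_forest G T" and max: "\<And>T'. is_forest G T' \<Longrightarrow> T \<subseteq> T' \<Longrightarrow> T' = T"
    using T by (auto simp: spanning_forests_def)
  have "(a, b) \<in> (adj T)\<^sup>*" if "(a, b) \<in> adjacency G" for a b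
  proof -
    from that obtain e where e: "e \<in> E" "ends G e = {a, b}" by (auto simp: adjacency_def)
    show ?thesis
    proof (cases "e \<in> T")
      case True
      then show ?thesis using e by (auto simp: adj_def)
    next
      case False
      then have "\<not> is_forest G (insert e T)" using max[of "insert e T"] by blast
      then obtain vs es where c: "is_cycle G vs es" "set es \<subseteq> insert e T"
        using forT e(1) unfolding is_forest_def by blast
      have "e \<in> set es"
      proof (rule ccontr)
        assume "e \<notin> set es"
        then have "set es \<subseteq> T" using c(2) by blast
        then show False using forT c(1) unfolding is_forest_def by blast
      qed
      then show ?thesis by (rule cycle_connects_ends[OF c _ e(2)])
    qed
  qed
  then have "adjacency G \<subseteq> (adj T)\<^sup>*" by auto
  then show ?thesis by (rule rtrancl_subset_rtrancl)
qed

lemma spanning_forests_choices: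
  assumes U: "cotransversal U"
  shows "bij_betw (\<lambda>f. f ` U) {f \<in> PiE U (links G). acyclic_choice U f} (spanning_forests G)"
  unfolding bij_betw_def
proof
  show "inj_on (\<lambda>f. f ` U) {f \<in> PiE U (links G). acyclic_choice U f}"
  proof (rule inj_onI)
    fix f f' assume f: "f \<in> {f \<in> PiE U (links G). acyclic_choice U f}"
      and f': "f' \<in> {f \<in> PiE U (links G). acyclic_choice U f}" and eq: "f ` U = f' ` U"
    show "f = f'"
    proof (rule PiE_ext)
      show "f \<in> PiE U (links G)" "f' \<in> PiE U (links G)" using f f' by auto
      fix u assume "u \<in> U"
      then show "f u = f' u"
        by (rule acyclic_choice_unique[rotated 5]) (use f f' eq in auto)
    qed
  qed
  show "(\<lambda>f. f ` U) ` {f \<in> PiE U (links G). acyclic_choice U f} = spanning_forests G"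
  proof (intro Set.set_eqI iffI)
    fix T assume "T \<in> (\<lambda>f. f ` U) ` {f \<in> PiE U (links G). acyclic_choice U f}"
    then obtain f where f: "\<And>u. u \<in> U \<Longrightarrow> f u \<in> links G u" "acyclic_choice U f" "T = f ` U"
      by (auto simp: PiE_iff)
    have "T' = T" if T': "is_forest G T'" "T \<subseteq> T'" for T'
    proof (rule ccontr)
      assume "T' \<noteq> T"
      then obtain e where e: "e \<in> T'" "e \<notin> f ` U" using T' f(3) by blast
      have "e \<in> E" using T'(1) e(1) by (auto simp: is_forest_def)
      from acyclic_choice_maximal[OF U f(1,2) this e(2)] obtain vs es where
        "is_cycle G vs es" "set es \<subseteq> insert e (f ` U)" by blast
      moreover have "insert e (f ` U) \<subseteq> T'" using e T' f(3) by blast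
      ultimately show False using T'(1) unfolding is_forest_def by blast
    qed
    then show "T \<in> spanning_forests G"
      unfolding spanning_forests_def using acyclic_choice_forest[OF f(1,2)] f(3) by blast
  next
    fix T assume T: "T \<in> spanning_forests G"
    then have TE: "T \<subseteq> E" and noc: "\<not> (\<exists>vs es. is_cycle G vs es \<and> set es \<subseteq> T)"
      by (auto simp: spanning_forests_def is_forest_def)
    have "\<exists>r\<in>V - U. (u, r) \<in> (adj T)\<^sup>*" if "u \<in> U" for u
      using U that spanning_forest_connects[OF T] unfolding cotransversal_def by blast
    from connecting_set_has_choice[OF TE this] obtain f where
      f: "\<And>u. u \<in> U \<Longrightarrow> f u \<in> links G u" "acyclic_choice U f" "f ` U \<subseteq> T" by blast
    have "T \<subseteq> f ` U"
    proof (rule ccontr)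
      assume "\<not> T \<subseteq> f ` U"
      then obtain e where e: "e \<in> T" "e \<notin> f ` U" by blast
      from acyclic_choice_maximal[OF U f(1,2) subsetD[OF TE e(1)] e(2)] noc e(1) f(3) show False
        by (meson insert_subset subset_trans)
    qed
    then have "T = f ` U" using f(3) by blast
    moreover have "restrict f U ` U = f ` U" by simp
    moreover have "acyclic_choice U (restrict f U)"
      using f(2) unfolding acyclic_choice_def by (metis (no_types, lifting) restrict_apply' subsetD)
    moreover have "restrict f U \<in> PiE U (links G)" using f(1) by auto
    ultimately show "T \<in> (\<lambda>f. f ` U) ` {f \<in> PiE U (links G). acyclic_choice U f}"
      by (intro image_eqI[of _ _ "restrict f U"]) auto
  qed
qed

text \<open>The expansion of the determinant is indexed by the acyclic choices, and these are the maximal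
  forests.\<close>

theorem matrix_tree:
  fixes x :: "'e \<Rightarrow> 'a::comm_ring_1"
  assumes U: "cotransversal U"
  shows "(\<Sum>T\<in>spanning_forests G. \<Prod>e\<in>T. x e) = leibniz_det U (laplacian G x)"
proof -
  have finU: "finite U" using U finite_V finite_subset unfolding cotransversal_def by blast
  have "(\<Sum>T\<in>spanning_forests G. \<Prod>e\<in>T. x e) =
      (\<Sum>f\<in>{f \<in> PiE U (links G). acyclic_choice U f}. \<Prod>e\<in>f ` U. x e)"
    by (rule sum.reindex_bij_betw[OF spanning_forests_choices[OF U], symmetric])
  also have "\<dots> = (\<Sum>f\<in>{f \<in> PiE U (links G). acyclic_choice U f}. \<Prod>u\<in>U. x (f u))"
  proof (rule sum.cong[OF refl])
    fix f assume "f \<in> {f \<in> PiE U (links G). acyclic_choice U f}"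
    then have "inj_on f U" by (intro acyclic_choice_inj) auto
    then show "(\<Prod>e\<in>f ` U. x e) = (\<Prod>u\<in>U. x (f u))" by (simp add: prod.reindex)
  qed
  also have "\<dots> = leibniz_det U (laplacian G x)"
    by (rule det_laplacian[OF finU, symmetric])
  finally show ?thesis .
qed

lemma spanning_forest_card:
  assumes U: "cotransversal U" and T: "T \<in> spanning_forests G"
  shows "card T = card U" "finite T"
proof -
  have finU: "finite U" using U finite_V finite_subset unfolding cotransversal_def by blast
  from T have "T \<in> (\<lambda>f. f ` U) ` {f \<in> PiE U (links G). acyclic_choice U f}"
    using spanning_forests_choices[OF U] by (simp add: bij_betw_def)
  then obtain f where f: "f \<in> PiE U (links G)" "acyclic_choice U f" "T = f ` U" by blast
  have "inj_on f U" using f by (intro acyclic_choice_inj) auto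
  then show "card T = card U" "finite T" using f(3) finU by (auto simp: card_image)
qed

lemma kirchhoff_pvar: "kirchhoff G = (\<Sum>T\<in>spanning_forests G. \<Prod>e\<in>T. pvar e :: ('e, 'k::field) mpol)"
  by (simp add: kirchhoff_def pvar_def)

lemma peval_kirchhoff:
  assumes "cotransversal U"
  shows "peval (kirchhoff G :: ('e, 'k::field) mpol) x = leibniz_det U (laplacian G x)"
  using matrix_tree[OF assms, of x] by (simp add: kirchhoff_pvar peval_sum peval_prod)

lemma homogeneous_kirchhoff:
  assumes "cotransversal U"
  shows "homogeneous (card U) (kirchhoff G :: ('e, 'k::field) mpol)"
  unfolding kirchhoff_pvar
proof (rule homogeneous_sum)
  fix T assume T: "T \<in> spanning_forests G"
  have "homogeneous (\<Sum>e\<in>T. 1) (\<Prod>e\<in>T. pvar e :: ('e, 'k) mpol)"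
    by (rule homogeneous_prod) (rule homogeneous_pvar)
  then show "homogeneous (card U) (\<Prod>e\<in>T. pvar e :: ('e, 'k) mpol)"
    using spanning_forest_card[OF assms T] by simp
qed

end

section \<open>The torus action on the complement of a graph hypersurface\<close>

context finite_graph
begin

definition rooted :: "'v set \<Rightarrow> 'v \<Rightarrow> bool" where
  "rooted U u \<longleftrightarrow> (\<exists>e\<in>E. \<exists>r\<in>V - U. ends G e = {u, r})"

definition crossing :: "'v set \<Rightarrow> 'v set \<Rightarrow> 'e set" where
  "crossing U1 U2 = {e \<in> E. \<exists>u\<in>U1. \<exists>w\<in>U2. ends G e = {u, w}}"

text \<open>The rows of a Laplacian sum to 0 up to the edges to the roots, so the diagonal entry at a vertex
  involves the crossing edges as well. At a rooted vertex \<open>u\<close>, this is undone by the linear change of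
  coordinates that adds the coordinates of the crossing edges at \<open>u\<close> to that of one edge from \<open>u\<close> to a root,
  which occurs in no other entry. After it, the crossing edges occur only in the off-diagonal
  entries.\<close>

lemma straighten_laplacian:
  fixes U1 U2 :: "'v set"
  defines "U \<equiv> U1 \<union> U2" and "B \<equiv> crossing U1 U2"
  assumes disj: "U1 \<inter> U2 = {}" and UV: "U \<subseteq> V"
    and root: "\<And>b u. b \<in> B \<Longrightarrow> u \<in> ends G b \<Longrightarrow> rooted U u"
  obtains \<sigma> \<tau> :: "'e \<Rightarrow> ('e, 'k::field) mpol"
    where "\<And>e. homogeneous 1 (\<sigma> e)" "\<And>e. homogeneous 1 (\<tau> e)"
      "\<And>x. x \<in> affine_points E \<Longrightarrow> (\<lambda>e. peval (\<sigma> e) x) \<in> affine_points E"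
      "\<And>x. x \<in> affine_points E \<Longrightarrow> (\<lambda>e. peval (\<tau> e) x) \<in> affine_points E"
      "\<And>x. (\<lambda>e. peval (\<sigma> e) (\<lambda>e. peval (\<tau> e) x)) = x"
      "\<And>x. (\<lambda>e. peval (\<tau> e) (\<lambda>e. peval (\<sigma> e) x)) = x"
      "\<And>y u v. u \<in> U \<Longrightarrow> v \<in> U \<Longrightarrow> laplacian G (\<lambda>e. peval (\<sigma> e) y) u v =
        (if u = v then \<Sum>e\<in>links G u - B. y e else - (\<Sum>e\<in>{e \<in> E. ends G e = {u, v}}. y e))"
proof -
  have B: "b \<in> E" "\<exists>u\<in>U1. \<exists>w\<in>U2. ends G b = {u, w}" if "b \<in> B" for b
    using that unfolding B_def crossing_def by auto
  have finB: "finite B" using finite_E unfolding B_def crossing_def by simp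
  have B_links: "b \<in> links G u" if b: "b \<in> B" "u \<in> ends G b" for b u
  proof -
    from B(2)[OF b(1)] obtain p q where pq: "p \<in> U1" "q \<in> U2" "ends G b = {p, q}" by blast
    then have "p \<noteq> q" using disj by blast
    then show ?thesis using linksI[OF B(1)[OF b(1)]] pq(3) b(2) by (auto simp: insert_commute)
  qed
  have B_U: "ends G b \<subseteq> U" if "b \<in> B" for b
    using B(2)[OF that] unfolding U_def by auto
  define UB where "UB = {u. \<exists>b\<in>B. u \<in> ends G b}"
  have "\<forall>u\<in>UB. \<exists>e. e \<in> E \<and> (\<exists>r\<in>V - U. ends G e = {u, r})"
    using root unfolding UB_def rooted_def by blast
  then obtain c where c: "\<And>u. u \<in> UB \<Longrightarrow> c u \<in> E \<and> (\<exists>r\<in>V - U. ends G (c u) = {u, r})" by metis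
  have UB_U: "UB \<subseteq> U" unfolding UB_def using B_U by blast
  have c_ends: "ends G (c u) \<inter> U = {u}" "\<not> ends G (c u) \<subseteq> U" if "u \<in> UB" for u
    using c[OF that] UB_U that by auto
  have c_links: "c u \<in> links G u" if u: "u \<in> UB" for u
  proof -
    from c[OF u] obtain r where r: "c u \<in> E" "r \<in> V - U" "ends G (c u) = {u, r}" by blast
    then have "u \<noteq> r" using UB_U u by blast
    then show ?thesis using linksI[OF r(1,3)] by blast
  qed
  \<comment> \<open>The coordinate of \<open>b\<close> has to be subtracted from that of \<open>e\<close>.\<close>
  define corr where "corr e b \<longleftrightarrow> (\<exists>u\<in>UB. c u = e \<and> u \<in> ends G b)" for e b
  have corr_E: "e \<in> E" "\<not> ends G e \<subseteq> U" if "corr e b" for e b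
    using that c c_ends(2) unfolding corr_def by blast+
  have corr_B: "\<not> corr b b'" if "b \<in> B" for b b'
    using corr_E(2) B_U[OF that] by blast
  define P :: "'e \<Rightarrow> ('e, 'k) mpol" where "P e = (\<Sum>b\<in>B. if corr e b then pvar b else 0)" for e
  define \<sigma> where "\<sigma> e = pvar e - P e" for e
  define \<tau> where "\<tau> e = pvar e + P e" for e
  have P: "peval (P e) y = (\<Sum>b\<in>B. if corr e b then y b else 0)" for e y
    unfolding P_def peval_sum by (rule sum.cong) auto
  have P0: "P b = 0" if "b \<in> B" for b
    unfolding P_def using corr_B[OF that] by simp
  have P0': "P e = 0" if "e \<notin> E" for e
    unfolding P_def using corr_E(1) that by (intro sum.neutral) auto
  have hP: "homogeneous 1 (P e)" for e
    unfolding P_def by (rule homogeneous_sum) (simp add: homogeneous_pvar[simplified])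
  have Pinv: "peval (P e) (\<lambda>e. peval (\<sigma> e) x) = peval (P e) x" "peval (P e) (\<lambda>e. peval (\<tau> e) x) = peval (P e) x" for e x
    unfolding P by (auto intro!: sum.cong simp: \<sigma>_def \<tau>_def P0)
  show thesis
  proof (rule that[of \<sigma> \<tau>])
    show "homogeneous 1 (\<sigma> e)" "homogeneous 1 (\<tau> e)" for e
      unfolding \<sigma>_def \<tau>_def by (intro homogeneous_diff homogeneous_add homogeneous_pvar hP)+
    show "(\<lambda>e. peval (\<sigma> e) x) \<in> affine_points E" "(\<lambda>e. peval (\<tau> e) x) \<in> affine_points E"
      if "x \<in> affine_points E" for x
      using that by (auto simp: affine_points_def \<sigma>_def \<tau>_def P0')
    show "(\<lambda>e. peval (\<sigma> e) (\<lambda>e. peval (\<tau> e) x)) = x" for x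
    proof
      fix e
      have "peval (\<sigma> e) (\<lambda>e. peval (\<tau> e) x) = peval (\<tau> e) x - peval (P e) (\<lambda>e. peval (\<tau> e) x)"
        by (simp add: \<sigma>_def)
      then show "peval (\<sigma> e) (\<lambda>e. peval (\<tau> e) x) = x e" unfolding Pinv by (simp add: \<tau>_def)
    qed
    show "(\<lambda>e. peval (\<tau> e) (\<lambda>e. peval (\<sigma> e) x)) = x" for x
    proof
      fix e
      have "peval (\<tau> e) (\<lambda>e. peval (\<sigma> e) x) = peval (\<sigma> e) x + peval (P e) (\<lambda>e. peval (\<sigma> e) x)"
        by (simp add: \<tau>_def)
      then show "peval (\<tau> e) (\<lambda>e. peval (\<sigma> e) x) = x e" unfolding Pinv by (simp add: \<sigma>_def)
    qed
    fix y :: "'e \<Rightarrow> 'k alg_closure" and u v assume u: "u \<in> U" and v: "v \<in> U"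
    show "laplacian G (\<lambda>e. peval (\<sigma> e) y) u v =
        (if u = v then \<Sum>e\<in>links G u - B. y e else - (\<Sum>e\<in>{e \<in> E. ends G e = {u, v}}. y e))"
    proof (cases "u = v")
      case False
      have "peval (\<sigma> e) y = y e" if "ends G e = {u, v}" for e
      proof -
        have "\<not> corr e b" for b using corr_E(2)[of e b] that u v by auto
        then show ?thesis by (simp add: \<sigma>_def P)
      qed
      then have "(\<Sum>e\<in>{e \<in> E. ends G e = {u, v}}. peval (\<sigma> e) y) = (\<Sum>e\<in>{e \<in> E. ends G e = {u, v}}. y e)"
        by (intro sum.cong) auto
      then show ?thesis using False by (simp add: laplacian_def)
    next
      case True
      have inner: "(\<Sum>e\<in>links G u. if corr e b then y b else 0) = (if u \<in> ends G b then y b else 0)"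
        if b: "b \<in> B" for b
      proof -
        have eq: "{e \<in> links G u. corr e b} = (if u \<in> ends G b then {c u} else {})"
        proof -
          have "e = c u \<and> u \<in> ends G b" if e: "e \<in> links G u" "corr e b" for e
          proof -
            from e(2) obtain w where w: "w \<in> UB" "c w = e" "w \<in> ends G b" unfolding corr_def by blast
            have "u \<in> ends G e" using e(1) by (simp add: links_def)
            then have "u = w" using c_ends(1)[OF w(1)] w(2) u by blast
            then show ?thesis using w by simp
          qed
          moreover have "c u \<in> links G u \<and> corr (c u) b" if "u \<in> ends G b"
          proof -
            have "u \<in> UB" unfolding UB_def using that b by blast
            then show ?thesis using c_links that unfolding corr_def by blast
          qed
          ultimately show ?thesis by auto
        qed
        have "(\<Sum>e\<in>links G u. if corr e b then y b else 0) = (\<Sum>e\<in>{e \<in> links G u. corr e b}. y b)"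
          by (rule sum.inter_filter[OF finite_links, symmetric])
        then show ?thesis unfolding eq by simp
      qed
      have "(\<Sum>e\<in>links G u. peval (P e) y) = (\<Sum>b\<in>B. \<Sum>e\<in>links G u. if corr e b then y b else 0)"
        unfolding P by (rule sum.swap)
      also have "\<dots> = (\<Sum>b\<in>B. if u \<in> ends G b then y b else 0)"
        by (rule sum.cong[OF refl inner])
      also have "\<dots> = (\<Sum>b\<in>{b \<in> B. u \<in> ends G b}. y b)"
        by (rule sum.inter_filter[OF finB, symmetric])
      also have "{b \<in> B. u \<in> ends G b} = links G u \<inter> B"
        using B_links by (auto simp: links_def)
      finally have "(\<Sum>e\<in>links G u. peval (\<sigma> e) y) = (\<Sum>e\<in>links G u. y e) - (\<Sum>e\<in>links G u \<inter> B. y e)"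
        by (simp add: \<sigma>_def sum_subtractf)
      also have "\<dots> = (\<Sum>e\<in>links G u - B. y e)"
        using sum.Int_Diff[OF finite_links, of y u B] by simp
      finally show ?thesis using True by (simp add: laplacian_def)
    qed
  qed
qed

text \<open>Let \<open>B\<close> be the crossing edges, \<open>A\<close> the other edges that meet \<open>U1\<close>, and \<open>C\<close> the rest. In the straightened
  coordinates, the diagonal blocks of the Laplacian belong to \<open>A\<close> and \<open>C\<close>, the off-diagonal blocks to
  \<open>B\<close>. Scaling \<open>A\<close> by \<open>t\<close> and \<open>C\<close> by the inverse of \<open>t\<close> therefore amounts to multiplying the rows and the columns
  of \<open>U1\<close> by a square root of \<open>t\<close>, those of \<open>U2\<close> by its inverse, which preserves the nonvanishing of the
  determinant.
  
  The determinant vanishes at the fixed points: if only \<open>A\<close> or only \<open>C\<close> occurs, then the rows of \<open>U2\<close> or those of \<open>U1\<close>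
  are 0. If only \<open>B\<close> occurs, then the row of a vertex without an edge to a root is 0, all rows are 0 if
  there are no crossing edges, and if \<open>U1\<close> and \<open>U2\<close> differ in size, then the matrix is bipartite with parts
  of different size.\<close>

theorem cl_complement_split:
  assumes U: "cotransversal (U1 \<union> U2)" and disj: "U1 \<inter> U2 = {}" and ne: "U1 \<noteq> {}" "U2 \<noteq> {}"
    and root: "\<And>e u. e \<in> crossing U1 U2 \<Longrightarrow> u \<in> ends G e \<Longrightarrow> rooted (U1 \<union> U2) u"
    and unbalanced: "crossing U1 U2 = {} \<or> (\<exists>u\<in>U1 \<union> U2. \<not> rooted (U1 \<union> U2) u) \<or> card U1 \<noteq> card U2"
  shows "congT (cl (proj_locus E {} (kirchhoff G :: ('e, 'k::field) mpol))) 0"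
proof -
  let ?U = "U1 \<union> U2"
  define B where "B = crossing U1 U2"
  define A where "A = {e \<in> E - B. ends G e \<inter> U1 \<noteq> {}}"
  define C where "C = E - B - A"
  have UV: "?U \<subseteq> V" using U unfolding cotransversal_def by blast
  have finU: "finite ?U" "finite U1" "finite U2" using UV finite_V finite_subset by auto
  have BE: "B \<subseteq> E" unfolding B_def crossing_def by blast
  obtain \<sigma> \<tau> :: "'e \<Rightarrow> ('e, 'k) mpol" where s:
      "\<And>e. homogeneous 1 (\<sigma> e)" "\<And>e. homogeneous 1 (\<tau> e)"
      "\<And>x. x \<in> affine_points E \<Longrightarrow> (\<lambda>e. peval (\<sigma> e) x) \<in> affine_points E"
      "\<And>x. x \<in> affine_points E \<Longrightarrow> (\<lambda>e. peval (\<tau> e) x) \<in> affine_points E"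
      "\<And>x. (\<lambda>e. peval (\<sigma> e) (\<lambda>e. peval (\<tau> e) x)) = x"
      "\<And>x. (\<lambda>e. peval (\<tau> e) (\<lambda>e. peval (\<sigma> e) x)) = x"
    and lap: "\<And>y u v. u \<in> ?U \<Longrightarrow> v \<in> ?U \<Longrightarrow> laplacian G (\<lambda>e. peval (\<sigma> e) y) u v =
        (if u = v then \<Sum>e\<in>links G u - B. y e else - (\<Sum>e\<in>{e \<in> E. ends G e = {u, v}}. y e))"
    unfolding B_def by (rule straighten_laplacian[OF disj UV root]) auto
  define M :: "('e \<Rightarrow> 'k alg_closure) \<Rightarrow> 'v \<Rightarrow> 'v \<Rightarrow> 'k alg_closure" where
    "M y u v = (if u = v then \<Sum>e\<in>links G u - B. y e else - (\<Sum>e\<in>{e \<in> E. ends G e = {u, v}}. y e))" for y u v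
  define f :: "('e, 'k) mpol" where "f = psubst \<sigma> (kirchhoff G)"
  note hk = homogeneous_kirchhoff[OF U, where 'k = 'k]
  have hf: "all_homogeneous {f}"
    unfolding f_def all_homogeneous_def using homogeneous_psubst[OF hk, of \<sigma>] s(1) by blast
  have f: "peval f y = leibniz_det ?U (M y)" for y
    unfolding f_def peval_psubst peval_kirchhoff[OF U]
    by (rule det_cong) (simp add: lap M_def)
  have diag1: "e \<in> A" if "u \<in> U1" "e \<in> links G u - B" for e u
    using that unfolding A_def links_def by auto
  have diag2: "e \<in> C" if u: "u \<in> U2" "e \<in> links G u - B" for e u
  proof -
    have e: "e \<in> E" "e \<notin> B" "ends G e = {u, other_end G e u}" using u link_ends[of e u] by auto
    have "ends G e \<inter> U1 = {}"
    proof (rule ccontr)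
      assume "ends G e \<inter> U1 \<noteq> {}"
      then have "other_end G e u \<in> U1" using e(3) u(1) disj by auto
      then have "e \<in> B" unfolding B_def crossing_def using e(1,3) u(1) by (auto simp: insert_commute)
      with e(2) show False by blast
    qed
    then show ?thesis unfolding C_def A_def using e by blast
  qed
  have off1: "e \<in> A" if "u \<in> U1" "v \<in> U1" "e \<in> E" "ends G e = {u, v}" for e u v
    using that disj unfolding A_def B_def crossing_def by (auto simp: doubleton_eq_iff)
  have off2: "e \<in> C" if "u \<in> U2" "v \<in> U2" "e \<in> E" "ends G e = {u, v}" for e u v
    using that disj unfolding C_def A_def B_def crossing_def by (auto simp: doubleton_eq_iff)
  have off3: "e \<in> B" if "u \<in> U1 \<and> v \<in> U2 \<or> u \<in> U2 \<and> v \<in> U1" "e \<in> E" "ends G e = {u, v}" for e u v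
    using that unfolding B_def crossing_def by (auto simp: insert_commute)
  have scale: "peval f (\<lambda>e. t e * y e) \<noteq> 0"
    if nz: "peval f y \<noteq> 0" and s0: "\<And>u. u \<in> ?U \<Longrightarrow> s u \<noteq> 0"
      and A: "\<And>e u v. e \<in> A \<Longrightarrow> u \<in> U1 \<Longrightarrow> v \<in> U1 \<Longrightarrow> t e * y e = s u * s v * y e"
      and B: "\<And>e u v. e \<in> B \<Longrightarrow> u \<in> U1 \<Longrightarrow> v \<in> U2 \<Longrightarrow> t e * y e = s u * s v * y e"
      and C: "\<And>e u v. e \<in> C \<Longrightarrow> u \<in> U2 \<Longrightarrow> v \<in> U2 \<Longrightarrow> t e * y e = s u * s v * y e"
    for t y and s :: "'v \<Rightarrow> 'k alg_closure"
  proof -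
    have "M (\<lambda>e. t e * y e) u v = s u * s v * M y u v" if uv: "u \<in> ?U" "v \<in> ?U" for u v
    proof (cases "u = v")
      case True
      have "t e * y e = s u * s u * y e" if "e \<in> links G u - B" for e
        using uv(1) A C diag1 diag2 that by blast
      then have "(\<Sum>e\<in>links G u - B. t e * y e) = (\<Sum>e\<in>links G u - B. s u * s u * y e)"
        by (rule sum.cong[OF refl])
      then show ?thesis using True by (simp add: M_def sum_distrib_left)
    next
      case False
      have "t e * y e = s u * s v * y e" if e: "e \<in> E" "ends G e = {u, v}" for e
      proof -
        consider "u \<in> U1" "v \<in> U1" | "u \<in> U2" "v \<in> U2" | "u \<in> U1" "v \<in> U2" | "u \<in> U2" "v \<in> U1"
          using uv by blast
        then show ?thesis
        proof cases
          case 1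
          show ?thesis by (rule A[OF off1[OF 1 e] 1])
        next
          case 2
          show ?thesis by (rule C[OF off2[OF 2 e] 2])
        next
          case 3
          have "e \<in> B" using off3[of u v e] 3 e by blast
          then show ?thesis by (rule B[OF _ 3])
        next
          case 4
          have "e \<in> B" using off3[of u v e] 4 e by blast
          then have "t e * y e = s v * s u * y e" by (rule B[OF _ 4(2,1)])
          then show ?thesis by (simp add: mult_ac)
        qed
      qed
      then have "(\<Sum>e\<in>{e \<in> E. ends G e = {u, v}}. t e * y e) =
          (\<Sum>e\<in>{e \<in> E. ends G e = {u, v}}. s u * s v * y e)"
        by (intro sum.cong refl) blast
      then show ?thesis using False by (simp add: M_def sum_distrib_left)
    qed
    then have "leibniz_det ?U (M (\<lambda>e. t e * y e)) = (\<Prod>u\<in>?U. s u) ^ 2 * leibniz_det ?U (M y)"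
      by (rule det_scale[OF finU(1)])
    then show ?thesis using nz s0 finU(1) unfolding f by simp
  qed
  have zero_row: "peval f y = 0"
    if u: "u \<in> ?U" and z: "\<And>e. e \<in> links G u \<Longrightarrow> e \<in> B \<or> y e = 0"
      and z': "\<And>e v. v \<in> ?U \<Longrightarrow> u \<noteq> v \<Longrightarrow> e \<in> E \<Longrightarrow> ends G e = {u, v} \<Longrightarrow> y e = 0" for u y
    unfolding f
  proof (rule det_zero_row[OF finU(1) u])
    fix v assume v: "v \<in> ?U"
    show "M y u v = 0"
      unfolding M_def using z z'[OF v] by (auto intro!: sum.neutral)
  qed
  have "congT (cl (proj_locus E {} f)) 0"
  proof (rule cl_torus_fixed_point_free[OF finite_E hf, of A B C])
    show "E = A \<union> B \<union> C" using BE unfolding A_def C_def by blast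
    show "A \<inter> B = {}" "A \<inter> C = {}" "B \<inter> C = {}" unfolding A_def C_def by blast+
  next
    fix y :: "'e \<Rightarrow> 'k alg_closure" and t :: "'k alg_closure"
    assume t: "t \<noteq> 0" and nz: "peval f y \<noteq> 0"
    \<comment> \<open>Square roots exist, as the points have coordinates in an algebraic closure.\<close>
    obtain r where r: "r ^ 2 = t" using nth_root_exists[of 2 t] by auto
    then have r0: "r \<noteq> 0" using t by auto
    have dis: "A \<inter> B = {}" "A \<inter> C = {}" "B \<inter> C = {}" unfolding A_def C_def by blast+
    show "peval f (\<lambda>k. t powi (if k \<in> A then 1 else if k \<in> C then - 1 else 0) * y k) \<noteq> 0"
      by (rule scale[OF nz, of "\<lambda>u. if u \<in> U1 then r else inverse r"])
        (use dis disj r r0 in \<open>auto simp: power2_eq_square power_int_minus field_simps\<close>)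
    assume yB: "\<forall>k\<in>B. y k = 0"
    show "peval f (\<lambda>k. t powi (if k \<in> C then 1 else 0) * y k) \<noteq> 0"
      by (rule scale[OF nz, of "\<lambda>u. if u \<in> U1 then 1 else r"])
        (use dis disj r r0 yB in \<open>auto simp: power2_eq_square\<close>)
  next
    fix y :: "'e \<Rightarrow> 'k alg_closure" assume y: "\<forall>k\<in>A \<union> B. y k = 0"
    obtain u where u: "u \<in> U1" using ne by blast
    show "peval f y = 0"
      by (rule zero_row[of u]) (use u y diag1 off1 off3 in blast)+
  next
    fix y :: "'e \<Rightarrow> 'k alg_closure" assume y: "\<forall>k\<in>B \<union> C. y k = 0"
    obtain u where u: "u \<in> U2" using ne by blast
    show "peval f y = 0"
      by (rule zero_row[of u]) (use u y diag2 off2 off3 in blast)+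
  next
    fix y :: "'e \<Rightarrow> 'k alg_closure" assume y: "\<forall>k\<in>A \<union> C. y k = 0"
    from unbalanced consider "B = {}" | u where "u \<in> ?U" "\<not> rooted ?U u" | "card U1 \<noteq> card U2"
      unfolding B_def by blast
    then show "peval f y = 0"
    proof cases
      case 1
      obtain u where u: "u \<in> U1" using ne by blast
      show ?thesis
        by (rule zero_row[of u]) (use 1 u y diag1 off1 off3 in blast)+
    next
      case 2
      have no: "u \<notin> ends G e" if "e \<in> B" for e
        using root[of e u] that 2 unfolding B_def by blast
      show ?thesis
      proof (rule zero_row[of u])
        show "u \<in> ?U" by (rule 2)
        fix e
        show "e \<in> B \<or> y e = 0" if "e \<in> links G u"
          using that 2 y diag1 diag2 by blast
        show "y e = 0" if "v \<in> ?U" "u \<noteq> v" "e \<in> E" "ends G e = {u, v}" for v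
        proof -
          have "e \<notin> B" using no that(4) by blast
          then have "e \<in> A \<union> C" using that(3) unfolding C_def by blast
          then show ?thesis using y by blast
        qed
      qed
    next
      case 3
      show ?thesis
        unfolding f
      proof (rule det_bipartite[OF finU(2,3) disj 3])
        fix u v assume "u \<in> U1" "v \<in> U1"
        then show "M y u v = 0"
          unfolding M_def using y diag1 off1 by (auto intro!: sum.neutral)
      next
        fix u v assume "u \<in> U2" "v \<in> U2"
        then show "M y u v = 0"
          unfolding M_def using y diag2 off2 by (auto intro!: sum.neutral)
      qed
    qed
  qed
  moreover have "congT (cl (proj_locus E {} (kirchhoff G :: ('e, 'k) mpol))) (cl (proj_locus E {} f))"
  proof (rule congT_cl_iso)
    have "all_homogeneous {kirchhoff G :: ('e, 'k) mpol}" using hk by (auto simp: all_homogeneous_def)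
    then show "representable (proj_locus E {} (kirchhoff G :: ('e, 'k) mpol))"
      by (intro representable_proj_locus finite_E) simp
    show "isomorphic (proj_locus E {} (kirchhoff G)) (proj_locus E {} f)"
      unfolding f_def
      by (rule proj_locus_linear_isomorphic[where \<tau> = \<tau>, OF hk s(1,2,3,4) s(5) s(6)])
  qed
  ultimately show ?thesis by (rule congT_trans[rotated])
qed

end

section \<open>Nexus and fat nexus\<close>

context finite_graph
begin

lemma simplification_simps:
  "edges (simplification G) = {ends G e | e. e \<in> E \<and> \<not> is_loop G e}"
  "verts (simplification G) = \<Union>{ends G e | e. e \<in> E \<and> \<not> is_loop G e}"
  "ends (simplification G) = (\<lambda>d. d)"
  by (simp_all add: simplification_def Let_def)

lemma simplification_edge:
  "{u, w} \<in> edges (simplification G) \<longleftrightarrow> u \<noteq> w \<and> (\<exists>e\<in>E. ends G e = {u, w})"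
proof -
  have "card {u, w} = 1 \<longleftrightarrow> u = w" by (cases "u = w") auto
  then have "\<not> is_loop G e \<longleftrightarrow> u \<noteq> w" if "ends G e = {u, w}" for e
    unfolding is_loop_def that by simp
  moreover have "{u, w} \<in> edges (simplification G) \<longleftrightarrow> (\<exists>e\<in>E. \<not> is_loop G e \<and> ends G e = {u, w})"
    unfolding simplification_simps by auto
  ultimately show ?thesis by blast
qed

lemma simplification_vertex:
  "v \<in> verts (simplification G) \<longleftrightarrow> (\<exists>w. {v, w} \<in> edges (simplification G))"
proof
  assume "v \<in> verts (simplification G)"
  then obtain e where "e \<in> E" "\<not> is_loop G e" "v \<in> ends G e" unfolding simplification_simps by blast
  then have "e \<in> links G v" by (simp add: links_def)
  from link_ends[OF this] show "\<exists>w. {v, w} \<in> edges (simplification G)"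
    unfolding simplification_edge by metis
next
  assume "\<exists>w. {v, w} \<in> edges (simplification G)"
  then show "v \<in> verts (simplification G)" unfolding simplification_simps by auto
qed

lemma simplification_verts_subset: "verts (simplification G) \<subseteq> V"
  using graph unfolding simplification_simps is_graph_def by blast

lemma simplification_connected:
  "(adjacency (simplification G))\<^sup>* = (adjacency G)\<^sup>*"
proof (rule rtrancl_subset[symmetric])
  have "(u, w) \<in> adjacency (simplification G) \<longleftrightarrow> u \<noteq> w \<and> (u, w) \<in> adjacency G" for u w
    using simplification_edge[of u w] unfolding adjacency_def simplification_simps(3) by auto
  then show "adjacency (simplification G) \<subseteq> adjacency G" "adjacency G \<subseteq> (adjacency (simplification G))\<^sup>*"
    by auto
qed

lemma connected_in_simplification:
  assumes "(r, s) \<in> (adjacency G)\<^sup>*" "r \<noteq> s"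
  shows "r \<in> verts (simplification G)"
proof -
  from assms have "(r, s) \<in> (adjacency (simplification G))\<^sup>*" by (simp add: simplification_connected)
  with assms(2) obtain t where "(r, t) \<in> adjacency (simplification G)"
    by (meson converse_rtranclE)
  then have "{r, t} \<in> edges (simplification G)" unfolding adjacency_def simplification_simps(3) by auto
  then show ?thesis using simplification_vertex by blast
qed

lemma connected_sym: "(a, b) \<in> (adjacency G)\<^sup>* \<Longrightarrow> (b, a) \<in> (adjacency G)\<^sup>*"
  using adj_sym[of a b E] by (simp add: adj_E)

lemma crossing_simplification:
  assumes "e \<in> crossing U1 U2" "U1 \<inter> U2 = {}"
  shows "\<exists>u\<in>U1. \<exists>w\<in>U2. ends G e = {u, w} \<and> {u, w} \<in> edges (simplification G)"
  using assms unfolding crossing_def simplification_edge by blast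

text \<open>Every component of the simplification has at least two vertices. Choose a root in each component
  and let \<open>U1\<close> consist of the remaining vertices of one component. There are no crossing edges.\<close>

lemma cl_complement_disconnected:
  assumes "disconnected (simplification G)"
  shows "\<exists>U. cotransversal U \<and> congT (cl (proj_locus E {} (kirchhoff G :: ('e, 'k::field) mpol))) 0"
proof -
  let ?conn = "(adjacency G)\<^sup>*"
  from assms obtain a b where ab: "a \<in> verts (simplification G)" "b \<in> verts (simplification G)" "(a, b) \<notin> ?conn"
    unfolding disconnected_def simplification_connected by blast
  \<comment> \<open>The root of the component of \<open>v\<close>; as it is chosen by the set of vertices connected to \<open>v\<close>, connected vertices have the same root.\<close>
  define \<rho> where "\<rho> v = (SOME w. w \<in> V \<and> (v, w) \<in> ?conn)" for v
  have \<rho>: "\<rho> v \<in> V \<and> (v, \<rho> v) \<in> ?conn" if "v \<in> V" for v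
    unfolding \<rho>_def by (rule someI[of _ v]) (use that in auto)
  have \<rho>_eq: "\<rho> v = \<rho> w" if "(v, w) \<in> ?conn" for v w
  proof -
    have "(v, x) \<in> ?conn \<longleftrightarrow> (w, x) \<in> ?conn" for x
      using that connected_sym[OF that] rtrancl_trans by metis
    then show ?thesis unfolding \<rho>_def by simp
  qed
  define U where "U = V - \<rho> ` V"
  define U1 where "U1 = {v \<in> U. (a, v) \<in> ?conn}"
  define U2 where "U2 = U - U1"
  have U12: "U1 \<union> U2 = U" "U1 \<inter> U2 = {}" unfolding U1_def U2_def by auto
  have R: "V - U = \<rho> ` V" unfolding U_def using \<rho> by blast
  have R_unique: "r = s" if rs: "r \<in> V - U" "s \<in> V - U" "(r, s) \<in> ?conn" for r s
  proof -
    have "r \<in> \<rho> ` V" "s \<in> \<rho> ` V" using rs(1,2) R by simp_all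
    then obtain v w where v: "v \<in> V" "r = \<rho> v" and w: "w \<in> V" "s = \<rho> w"
      by (elim imageE)
    have "(v, r) \<in> ?conn" "(s, w) \<in> ?conn"
      using \<rho>[OF v(1)] connected_sym[of w s] \<rho>[OF w(1)] v(2) w(2) by auto
    then have "(v, w) \<in> ?conn"
      using rtrancl_trans[OF rtrancl_trans[OF _ rs(3)]] by blast
    then show ?thesis using \<rho>_eq v w by blast
  qed
  have cot: "cotransversal U"
    unfolding cotransversal_def
  proof (intro conjI ballI impI)
    show "U \<subseteq> V" unfolding U_def by blast
    fix u assume "u \<in> U"
    then have "u \<in> V" unfolding U_def by blast
    then have "\<rho> u \<in> V - U" "(u, \<rho> u) \<in> ?conn" using \<rho>[of u] R by auto
    then show "\<exists>r\<in>V - U. (u, r) \<in> ?conn" by blast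
  qed (rule R_unique)
  have comp: "\<exists>v\<in>U. (c, v) \<in> ?conn" if c: "c \<in> verts (simplification G)" for c
  proof -
    from c obtain d where "{c, d} \<in> edges (simplification G)" using simplification_vertex by blast
    then have cd: "c \<noteq> d" "(c, d) \<in> adjacency G" "{d, c} \<in> edges (simplification G)"
      unfolding simplification_edge adjacency_def by (auto simp: insert_commute)
    have "d \<in> verts (simplification G)" using cd(3) simplification_vertex by blast
    then have V: "c \<in> V" "d \<in> V" using c simplification_verts_subset by auto
    show ?thesis
    proof (cases "c \<in> U")
      case False
      have "d \<in> U"
      proof (rule ccontr)
        assume "d \<notin> U"
        then have "c = d" using R_unique[of c d] False V cd(2) by blast
        with cd(1) show False by contradiction
      qed
      then show ?thesis using cd(2) by blast
    qed blast
  qed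
  have "U1 \<noteq> {}" using comp[OF ab(1)] unfolding U1_def by blast
  moreover have "U2 \<noteq> {}"
  proof -
    obtain v where v: "v \<in> U" "(b, v) \<in> ?conn" using comp[OF ab(2)] by blast
    have "(a, v) \<notin> ?conn" using ab(3) connected_sym[OF v(2)] by (meson rtrancl_trans)
    then show ?thesis using v(1) unfolding U2_def U1_def by blast
  qed
  moreover have cr: "crossing U1 U2 = {}"
  proof (rule ccontr)
    assume "crossing U1 U2 \<noteq> {}"
    then obtain e u w where e: "e \<in> E" "u \<in> U1" "w \<in> U2" "ends G e = {u, w}" unfolding crossing_def by blast
    then have "(u, w) \<in> adjacency G" unfolding adjacency_def by blast
    moreover have "(a, u) \<in> ?conn" using e(2) unfolding U1_def by blast
    ultimately have "(a, w) \<in> ?conn" by (meson rtrancl.rtrancl_into_rtrancl)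
    then show False using e(3) unfolding U1_def U2_def by blast
  qed
  ultimately have "congT (cl (proj_locus E {} (kirchhoff G :: ('e, 'k) mpol))) 0"
    using cot U12 by (intro cl_complement_split[of U1 U2]) auto
  then show ?thesis using cot by blast
qed

text \<open>The roots are \<open>v\<close> and the vertices of \<open>G\<close> that the simplification lacks, each of which is a component
  of its own.\<close>

lemma cotransversal_without_vertex:
  assumes conn: "\<not> disconnected (simplification G)" and v: "v \<in> verts (simplification G)"
  shows "cotransversal (verts (simplification G) - {v})"
  unfolding cotransversal_def
proof (intro conjI ballI impI)
  let ?W = "verts (simplification G)"
  have c: "(a, b) \<in> (adjacency G)\<^sup>*" if "a \<in> ?W" "b \<in> ?W" for a b
    using conn that unfolding disconnected_def simplification_connected by blast
  show "?W - {v} \<subseteq> V" using simplification_verts_subset by blast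
  show "\<exists>r\<in>V - (?W - {v}). (u, r) \<in> (adjacency G)\<^sup>*" if "u \<in> ?W - {v}" for u
    using c[of u v] that v simplification_verts_subset by blast
  fix r s assume r: "r \<in> V - (?W - {v})" and s: "s \<in> V - (?W - {v})" and rs: "(r, s) \<in> (adjacency G)\<^sup>*"
  show "r = s"
    using connected_in_simplification[OF rs] connected_in_simplification[OF connected_sym[OF rs]] r s by blast
qed

text \<open>With the nexus as root, the components of its deletion are not joined by crossing edges.\<close>

lemma cl_complement_nexus:
  assumes conn: "\<not> disconnected (simplification G)" and nexus: "is_nexus (simplification G) v"
  shows "\<exists>U. cotransversal U \<and> congT (cl (proj_locus E {} (kirchhoff G :: ('e, 'k::field) mpol))) 0"
proof -
  let ?W = "verts (simplification G)" and ?D = "delete_vertex (simplification G) v"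
  have D: "verts ?D = ?W - {v}" "adjacency ?D = {(u, w). {u, w} \<in> edges (simplification G) \<and> v \<notin> {u, w}}"
    by (auto simp: delete_vertex_def adjacency_def simplification_simps(3))
  from nexus obtain a b where v: "v \<in> ?W" and ab: "a \<in> ?W - {v}" "b \<in> ?W - {v}" "(a, b) \<notin> (adjacency ?D)\<^sup>*"
    unfolding is_nexus_def disconnected_def D(1) by blast
  define U1 where "U1 = {x \<in> ?W - {v}. (a, x) \<in> (adjacency ?D)\<^sup>*}"
  define U2 where "U2 = ?W - {v} - U1"
  have U12: "U1 \<union> U2 = ?W - {v}" "U1 \<inter> U2 = {}" unfolding U1_def U2_def by auto
  have ne: "U1 \<noteq> {}" "U2 \<noteq> {}" using ab unfolding U1_def U2_def by blast+
  have cr: "crossing U1 U2 = {}"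
  proof (rule ccontr)
    assume "crossing U1 U2 \<noteq> {}"
    then obtain e where "e \<in> crossing U1 U2" by blast
    from crossing_simplification[OF this U12(2)] obtain u w where
      e: "u \<in> U1" "w \<in> U2" "{u, w} \<in> edges (simplification G)" by blast
    then have "(u, w) \<in> adjacency ?D" unfolding D(2) U1_def U2_def by auto
    then have "(a, w) \<in> (adjacency ?D)\<^sup>*"
      using e(1) unfolding U1_def by (auto intro: rtrancl.rtrancl_into_rtrancl)
    then show False using e(2) unfolding U1_def U2_def by blast
  qed
  have cot: "cotransversal (U1 \<union> U2)" unfolding U12(1) by (rule cotransversal_without_vertex[OF conn v])
  have "congT (cl (proj_locus E {} (kirchhoff G :: ('e, 'k) mpol))) 0"
    by (rule cl_complement_split[OF cot U12(2) ne]) (auto simp: cr)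
  then show ?thesis using cot by blast
qed

text \<open>With the fat nexus \<open>v\<close> as root, the vertices incident to crossing edges are neighbors of \<open>v\<close>, that is,
  rooted. If \<open>v\<close> is not an apex, then some vertex is not rooted; otherwise the two parts differ in size.\<close>

lemma cl_complement_fat_nexus:
  assumes conn: "\<not> disconnected (simplification G)" and nexus: "is_fat_nexus (simplification G) v"
  shows "\<exists>U. cotransversal U \<and> congT (cl (proj_locus E {} (kirchhoff G :: ('e, 'k::field) mpol))) 0"
proof -
  let ?W = "verts (simplification G)" and ?N = "neighborhood (simplification G) v"
  from nexus obtain U1 U2 where v: "v \<in> ?W" and W: "?W = {v} \<union> U1 \<union> U2" "v \<notin> U1" "v \<notin> U2" "U1 \<inter> U2 = {}"
    and ne: "U1 \<noteq> {}" "U2 \<noteq> {}"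
    and cross: "\<forall>d\<in>edges (simplification G). \<forall>u\<in>U1. \<forall>w\<in>U2. d = {u, w} \<longrightarrow> u \<in> ?N \<and> w \<in> ?N"
    and cone: "is_cone (simplification G) v \<longrightarrow> card U1 \<noteq> card U2"
    unfolding is_fat_nexus_def simplification_simps(3) by (elim conjE exE)
  have U12: "U1 \<union> U2 = ?W - {v}" using W by auto
  have cot: "cotransversal (U1 \<union> U2)" unfolding U12 by (rule cotransversal_without_vertex[OF conn v])
  have vV: "v \<in> V - (U1 \<union> U2)" using v W simplification_verts_subset by blast
  have N: "u \<in> ?N \<longleftrightarrow> {u, v} \<in> edges (simplification G)" if "u \<in> U1 \<union> U2" for u
    using that W unfolding neighborhood_def simplification_simps(3) by auto
  have root: "rooted (U1 \<union> U2) u \<longleftrightarrow> u \<in> ?N" if u: "u \<in> U1 \<union> U2" for u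
  proof
    assume "rooted (U1 \<union> U2) u"
    then obtain e r where e: "e \<in> E" "r \<in> V - (U1 \<union> U2)" "ends G e = {u, r}" unfolding rooted_def by blast
    then have "u \<noteq> r" using u by blast
    then have "{r, u} \<in> edges (simplification G)" using e simplification_edge[of r u] by (auto simp: insert_commute)
    moreover from this have "r \<in> ?W" using simplification_vertex by blast
    then have "r = v" using W e(2) by blast
    ultimately show "u \<in> ?N" unfolding N[OF u] by (simp add: insert_commute)
  next
    assume "u \<in> ?N"
    then show "rooted (U1 \<union> U2) u"
      unfolding N[OF u] simplification_edge rooted_def using vV by blast
  qed
  have "congT (cl (proj_locus E {} (kirchhoff G :: ('e, 'k) mpol))) 0"
  proof (rule cl_complement_split[OF cot W(4) ne])
    fix e u assume e: "e \<in> crossing U1 U2" "u \<in> ends G e"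
    from crossing_simplification[OF e(1) W(4)] obtain p q where
      pq: "p \<in> U1" "q \<in> U2" "ends G e = {p, q}" "{p, q} \<in> edges (simplification G)" by blast
    have "p \<in> ?N \<and> q \<in> ?N" using cross pq(4,1,2) by blast
    then show "rooted (U1 \<union> U2) u" using root pq(1-3) e(2) by auto
  next
    have "\<exists>u\<in>U1 \<union> U2. \<not> rooted (U1 \<union> U2) u" if nc: "\<not> is_cone (simplification G) v"
    proof -
      have "?N \<subseteq> ?W" unfolding neighborhood_def using v by auto
      then obtain u where "u \<in> ?W" "u \<notin> ?N" using nc unfolding is_cone_def by blast
      moreover have "v \<in> ?N" unfolding neighborhood_def by blast
      ultimately have "u \<in> U1 \<union> U2" "u \<notin> ?N" using W by auto
      then show ?thesis using root by blast
    qed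
    then show "crossing U1 U2 = {} \<or> (\<exists>u\<in>U1 \<union> U2. \<not> rooted (U1 \<union> U2) u) \<or> card U1 \<noteq> card U2"
      using cone by blast
  qed
  then show ?thesis using cot by blast
qed

end

section \<open>The classes of the graph hypersurface and of its complement\<close>

theorem theorem2p6:
  fixes G :: "('v, 'e) mgraph"
  assumes "is_graph G"
    and "\<exists>e\<in>edges G. \<not> is_loop G e"
    and "(\<exists>v. is_nexus (simplification G) v) \<or> (\<exists>v. is_fat_nexus (simplification G) v)"
  shows "var_class (graph_hypersurface G :: (('e \<Rightarrow> 'k::field alg_closure) set, 'k) fspace)
           \<ominus>\<^bsub>K0 TYPE('k)\<^esub> ([card (edges G)] \<cdot>\<^bsub>K0 TYPE('k)\<^esub> \<one>\<^bsub>K0 TYPE('k)\<^esub>)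
         \<in> Idl\<^bsub>K0 TYPE('k)\<^esub> {torus_class TYPE('k)}
       \<and> var_class (graph_complement G :: (('e \<Rightarrow> 'k::field alg_closure) set, 'k) fspace)
         \<in> Idl\<^bsub>K0 TYPE('k)\<^esub> {torus_class TYPE('k)}"
proof -
  interpret finite_graph G by unfold_locales (rule assms(1))
  let ?\<psi> = "kirchhoff G :: ('e, 'k) mpol"
  let ?X = "graph_hypersurface G :: (('e \<Rightarrow> 'k alg_closure) set, 'k) fspace"
  let ?Y = "graph_complement G :: (('e \<Rightarrow> 'k alg_closure) set, 'k) fspace"
  obtain U where U: "cotransversal U" and Y0: "congT (cl (proj_locus E {} ?\<psi>)) 0"
    using assms(3) cl_complement_disconnected cl_complement_nexus cl_complement_fat_nexus by metis
  note hom = homogeneous_kirchhoff[OF U, where 'k = 'k]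
  then have hom': "all_homogeneous {?\<psi>}" by (auto simp: all_homogeneous_def)
  have X: "?X = proj_locus E {?\<psi>} 1"
    by (simp add: graph_hypersurface_def proj_hypersurface_def proj_locus_def on_locus_def)
  have "\<not> (\<forall>x\<in>L. peval ?\<psi> x = 0) \<longleftrightarrow> (\<forall>x\<in>L. peval ?\<psi> x \<noteq> 0)" if "L \<in> proj_points E" for L
    using that by (elim proj_pointE) (simp add: line_all_iff[OF hom])
  then have Y: "?Y = proj_locus E {} ?\<psi>"
    unfolding graph_complement_def proj_locus_def X points_proj_locus
    by (intro subspace_cong) (auto simp: on_locus_def)
  have P: "congT (cl (proj_locus E {} 1 :: (('e \<Rightarrow> 'k alg_closure) set, 'k) fspace)) (of_nat (card E))"
    using cl_proj_space[OF finite_E finite_E] by simp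
  have "congT (cl (proj_locus E {} 1)) (cl ?X + cl ?Y)"
    using cl_proj_locus_cut[OF finite_E all_homogeneous_empty all_homogeneous_1 hom'] by (simp add: X Y)
  moreover have "congT (cl ?X + cl ?Y) (cl ?X)"
    using congT_add[OF congT_refl Y0, of "cl ?X"] by (simp add: Y)
  ultimately have "congT (cl ?X) (of_nat (card E))"
    using P congT_sym congT_trans by blast
  moreover have "congT (cl ?Y) 0" using Y0 by (simp add: Y)
  ultimately show ?thesis
    by (simp add: congT_def torus_ideal_def var_class_cl K0_coset_simps)
qed

end
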